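(* Let $T>0$, $r>0$, $\sigma>0$ and $K_T>0$ be constants, put $\gamma=r-\sigma^2/2$, and let $N$ denote the cumulative distribution function of the standard normal law $\mathcal N(0,1)$. Assume that the asset price satisfies $dX_t=rX_t\,dt+\sigma X_t\,dW_t$ under the risk-neutral measure $\mathsf Q$. Consider the American put option with maturity $T$ and time-dependent strike $$K(t)=2K_T\,e^{-\gamma(T-t)}N\left(\sigma\sqrt{T-t}\right),\qquad t\in[0,T],$$ (so that $K(T)=K_T$), with value function $$V(t,x)=\sup_{t\le\tau\le T}\mathsf E_{t,x}\left[e^{-r(\tau-t)}(K(\tau)-X_\tau)^+\right],\qquad t\in[0,T),\ x>0.$$ Then the optimal exercise boundary of this option is $$b(t)=K_T\,e^{-\gamma(T-t)},\qquad t\in[0,T);$$ that is, $\{(t,x)\in[0,T)\times(0,\infty): V(t,x)=K(t)-x\}=\{(t,x)\in[0,T)\times(0,\infty): x\le b(t)\}$.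
   Context: $W$ is a standard Brownian motion under the risk-neutral measure $\mathsf Q$; $\mathsf E_{t,x}$ is the expectation under $\mathsf Q$ given $X_t=x$; the supremum is over all stopping times $\tau$ of the filtration $\mathcal F^X$ generated by $X$ taking values in $[t,T]$. The exercise region is $\mathcal E=\{(t,x)\in[0,T)\times(0,\infty): V(t,x)=K(t)-x\}$. The optimal exercise boundary is the function $b:[0,T)\to(0,\infty)$ such that $\mathcal E=\{(t,x)\in[0,T)\times(0,\infty): x\le b(t)\}$. *)

theory Defs
  imports "HOL-Probability.Probability"
begin

section \<open>Brownian motion\<close>

definition filtered_prob_space :: "'a measure \<Rightarrow> (real \<Rightarrow> 'a measure) \<Rightarrow> bool" where
  "filtered_prob_space M F \<longleftrightarrow>
     prob_space M \<and> filtration (space M) F \<and> (\<forall>t. sets (F t) \<subseteq> sets M)"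

text \<open>Standard Brownian motion relative to a filtration \<open>F\<close>; with \<open>F\<close> the filtration generated
  by \<open>W\<close> this is the usual notion without reference to a filtration.\<close>

definition standard_brownian_motion ::
    "'a measure \<Rightarrow> (real \<Rightarrow> 'a measure) \<Rightarrow> (real \<Rightarrow> 'a \<Rightarrow> real) \<Rightarrow> bool" where
  "standard_brownian_motion M F W \<longleftrightarrow>
     (\<forall>t\<ge>0. W t \<in> borel_measurable (F t)) \<and>
     (AE \<omega> in M. W 0 \<omega> = 0) \<and>
     (\<forall>\<omega>\<in>space M. continuous_on {0..} (\<lambda>t. W t \<omega>)) \<and>
     (\<forall>s t. 0 \<le> s \<and> s < t \<longrightarrow>
        distributed M lborel (\<lambda>\<omega>. W t \<omega> - W s \<omega>) (normal_density 0 (sqrt (t - s))) \<and>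
        prob_space.indep_set M (sets (F s))
          {(\<lambda>\<omega>. W t \<omega> - W s \<omega>) -` A \<inter> space M | A. A \<in> sets borel})"


section \<open>The Ito integral\<close>

definition converges_in_prob ::
    "'a measure \<Rightarrow> (nat \<Rightarrow> 'a \<Rightarrow> real) \<Rightarrow> ('a \<Rightarrow> real) \<Rightarrow> bool" where
  "converges_in_prob M Y Z \<longleftrightarrow>
     (\<forall>k. Y k \<in> borel_measurable M) \<and> Z \<in> borel_measurable M \<and>
     (\<forall>\<epsilon>>0. (\<lambda>k. measure M {\<omega> \<in> space M. \<bar>Y k \<omega> - Z \<omega>\<bar> > \<epsilon>}) \<longlonglongrightarrow> 0)"

text \<open>A triple \<open>(n, p, \<xi>)\<close> encodes the simple process that is constantly \<open>\<xi> i\<close> on the time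
  interval from \<open>p i\<close> (exclusive) to \<open>p (Suc i)\<close> (inclusive), for \<open>i < n\<close>.\<close>

definition simple_integrand ::
    "(real \<Rightarrow> 'a measure) \<Rightarrow> real \<Rightarrow> real \<Rightarrow>
      nat \<Rightarrow> (nat \<Rightarrow> real) \<Rightarrow> (nat \<Rightarrow> 'a \<Rightarrow> real) \<Rightarrow> bool" where
  "simple_integrand F a b n p \<xi> \<longleftrightarrow>
     p 0 = a \<and> p n = b \<and> (\<forall>i<n. p i \<le> p (Suc i)) \<and>
     (\<forall>i<n. \<xi> i \<in> borel_measurable (F (p i)) \<and>
        (\<exists>C. \<forall>\<omega>\<in>space (F (p i)). \<bar>\<xi> i \<omega>\<bar> \<le> C))"

definition simple_process ::
    "nat \<Rightarrow> (nat \<Rightarrow> real) \<Rightarrow> (nat \<Rightarrow> 'a \<Rightarrow> real) \<Rightarrow> real \<Rightarrow> 'a \<Rightarrow> real" where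
  "simple_process n p \<xi> u \<omega> = (\<Sum>i<n. \<xi> i \<omega> * indicator {p i<..p (Suc i)} u)"

definition simple_integral ::
    "(real \<Rightarrow> 'a \<Rightarrow> real) \<Rightarrow> nat \<Rightarrow> (nat \<Rightarrow> real) \<Rightarrow> (nat \<Rightarrow> 'a \<Rightarrow> real) \<Rightarrow> 'a \<Rightarrow> real" where
  "simple_integral W n p \<xi> \<omega> = (\<Sum>i<n. \<xi> i \<omega> * (W (p (Suc i)) \<omega> - W (p i) \<omega>))"

definition progressively_measurable ::
    "(real \<Rightarrow> 'a measure) \<Rightarrow> real \<Rightarrow> real \<Rightarrow> (real \<Rightarrow> 'a \<Rightarrow> real) \<Rightarrow> bool" where
  "progressively_measurable F a b H \<longleftrightarrow>
     (\<forall>s\<in>{a..b}. (\<lambda>(u, \<omega>). H u \<omega>) \<in> borel_measurable (restrict_space borel {a..s} \<Otimes>\<^sub>M F s))"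

text \<open>\<open>I\<close> is (a version of) the Ito integral of \<open>H\<close> with respect to \<open>W\<close> over \<open>{a..b}\<close>, for
  progressively measurable \<open>H\<close> with almost surely square integrable paths: the limit in
  probability of the integrals of simple processes that approximate \<open>H\<close> in the sense that the
  integrated squared error tends to 0 in probability.\<close>

definition has_ito_integral ::
    "'a measure \<Rightarrow> (real \<Rightarrow> 'a measure) \<Rightarrow> (real \<Rightarrow> 'a \<Rightarrow> real) \<Rightarrow> real \<Rightarrow> real \<Rightarrow>
      (real \<Rightarrow> 'a \<Rightarrow> real) \<Rightarrow> ('a \<Rightarrow> real) \<Rightarrow> bool" where
  "has_ito_integral M F W a b H I \<longleftrightarrow>
     progressively_measurable F a b H \<and>
     (AE \<omega> in M. set_integrable lborel {a..b} (\<lambda>u. (H u \<omega>)\<^sup>2)) \<and>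
     (\<exists>n p \<xi>. (\<forall>k. simple_integrand F a b (n k) (p k) (\<xi> k)) \<and>
        converges_in_prob M
          (\<lambda>k \<omega>. LBINT u:{a..b}. (simple_process (n k) (p k) (\<xi> k) u \<omega> - H u \<omega>)\<^sup>2) (\<lambda>_. 0) \<and>
        converges_in_prob M (\<lambda>k. simple_integral W (n k) (p k) (\<xi> k)) I)"

text \<open>\<open>X\<close> is a continuous adapted solution on \<open>{t..T}\<close> of
  \<open>dX = \<mu>(X) ds + \<sigma>(X) dW\<close> with initial condition \<open>X t = x\<close>.\<close>

definition sde_solution ::
    "'a measure \<Rightarrow> (real \<Rightarrow> 'a measure) \<Rightarrow> (real \<Rightarrow> 'a \<Rightarrow> real) \<Rightarrow> (real \<Rightarrow> real) \<Rightarrow> (real \<Rightarrow> real) \<Rightarrow>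
      real \<Rightarrow> real \<Rightarrow> real \<Rightarrow> (real \<Rightarrow> 'a \<Rightarrow> real) \<Rightarrow> bool" where
  "sde_solution M F W \<mu> \<sigma> t T x X \<longleftrightarrow>
     (\<forall>s\<in>{t..T}. X s \<in> borel_measurable (F s)) \<and>
     (\<forall>\<omega>\<in>space M. continuous_on {t..T} (\<lambda>s. X s \<omega>)) \<and>
     (AE \<omega> in M. X t \<omega> = x) \<and>
     (\<forall>s\<in>{t..T}. \<exists>I. has_ito_integral M F W t s (\<lambda>u \<omega>. \<sigma> (X u \<omega>)) I \<and>
        (AE \<omega> in M. X s \<omega> = x + (LBINT u:{t..s}. \<mu> (X u \<omega>)) + I \<omega>))"


section \<open>American put options with time-dependent strike\<close>

text \<open>The filtration generated by a process \<open>X\<close> with time set \<open>{t..T}\<close>, extended to all real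
  indices (trivial before \<open>t\<close>, constant after \<open>T\<close>).\<close>

definition generated_filtration ::
    "'a measure \<Rightarrow> real \<Rightarrow> real \<Rightarrow> (real \<Rightarrow> 'a \<Rightarrow> real) \<Rightarrow> real \<Rightarrow> 'a measure" where
  "generated_filtration M t T X s =
     sigma (space M)
       {X u -` A \<inter> space M | u A. u \<in> {t..T} \<and> u \<le> s \<and> A \<in> sets borel}"

definition admissible_stopping_times ::
    "'a measure \<Rightarrow> real \<Rightarrow> real \<Rightarrow> (real \<Rightarrow> 'a \<Rightarrow> real) \<Rightarrow> ('a \<Rightarrow> real) set" where
  "admissible_stopping_times M t T X =
     {\<tau>. stopping_time (generated_filtration M t T X) \<tau> \<and> (\<forall>\<omega>\<in>space M. \<tau> \<omega> \<in> {t..T})}"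

text \<open>In the following, \<open>X t x\<close> is the price process started at time \<open>t\<close> from \<open>x\<close>, so that
  integration over \<open>M\<close> of functionals of \<open>X t x\<close> is the expectation given \<open>X\<^sub>t = x\<close>. The payoffs
  take values between 0 and the maximal strike, so the supremum is over a bounded set.\<close>

definition american_put_value ::
    "'a measure \<Rightarrow> (real \<Rightarrow> real \<Rightarrow> real \<Rightarrow> 'a \<Rightarrow> real) \<Rightarrow> real \<Rightarrow> real \<Rightarrow> (real \<Rightarrow> real) \<Rightarrow>
      real \<Rightarrow> real \<Rightarrow> real" where
  "american_put_value M X r T K t x =
     (SUP \<tau> \<in> admissible_stopping_times M t T (X t x).
        \<integral>\<omega>. exp (- r * (\<tau> \<omega> - t)) * max 0 (K (\<tau> \<omega>) - X t x (\<tau> \<omega>) \<omega>) \<partial>M)"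

definition exercise_region ::
    "real \<Rightarrow> (real \<Rightarrow> real) \<Rightarrow> (real \<Rightarrow> real \<Rightarrow> real) \<Rightarrow> (real \<times> real) set" where
  "exercise_region T K V = {(t, x). t \<in> {0..<T} \<and> x > 0 \<and> V t x = K t - x}"

definition is_optimal_exercise_boundary ::
    "real \<Rightarrow> (real \<Rightarrow> real) \<Rightarrow> (real \<Rightarrow> real \<Rightarrow> real) \<Rightarrow> (real \<Rightarrow> real) \<Rightarrow> bool" where
  "is_optimal_exercise_boundary T K V b \<longleftrightarrow>
     (\<forall>t\<in>{0..<T}. b t > 0) \<and>
     exercise_region T K V = {(t, x). t \<in> {0..<T} \<and> x > 0 \<and> x \<le> b t}"

end

theory Submission
  imports Defs
begin

text \<open>
  Along the curve \<open>b s = K\<^sub>T * exp (- \<gamma> * (T - s))\<close> the price is \<open>X s = b s * exp (\<sigma> * B s)\<close> with a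
  driftless Brownian motion \<open>B\<close>, and the strike is
  \<open>K s = K\<^sub>T * exp (- r * (T - s)) * E (exp (\<sigma> * \<bar>W T - W s\<bar>))\<close>.  So, up to a constant, the
  discounted gain is \<open>\<Psi> s 0 - M s (B s)\<close>, where \<open>\<Psi> s y\<close> and \<open>M s y\<close> are the expectations of
  \<open>exp (\<sigma> * \<bar>y + W T - W s\<bar>)\<close> and \<open>exp (\<sigma> * (y + W T - W s))\<close>; both are martingales along a Brownian
  motion, and \<open>\<Psi> s\<close> has its strict minimum at \<open>0\<close>.

  If \<open>B\<close> starts at \<open>y \<le> 0\<close>, then \<open>\<Psi> s (W s - W t) - M s (B s)\<close> is a martingale dominating the
  positive part of the gain and equal to the gain at time \<open>t\<close>, so immediate exercise is optimal.  If
  \<open>y > 0\<close>, then stopping when \<open>B\<close> reaches \<open>0\<close> (or at \<open>T\<close>) yields \<open>\<Psi> t y - M t y > \<Psi> t 0 - M t y\<close>;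
  grid times suffice, with an arbitrarily small loss from the overshoot.

  That \<open>X\<close> is the geometric Brownian motion is proved without the Ito formula: the difference of
  the two processes, cut off when they leave a bounded set, satisfies a Gronwall inequality in \<open>L\<^sup>2\<close>,
  because the Euler defect of the geometric Brownian motion has explicit moments.
\<close>

section \<open>Gaussian integrals\<close>

text \<open>The strike is no accident: by symmetry and a shift of the Gaussian law,
  \<open>E (exp (\<sigma> * \<bar>W T - W s\<bar>))\<close> is twice
  \<open>exp (\<sigma>\<^sup>2 * (T - s) / 2)\<close> times the normal distribution function at
  \<open>\<sigma> * sqrt (T - s)\<close>. A claim of value \<open>\<Psi> - M\<close> is worth the
  gain when \<open>B = 0\<close>, and nothing at \<open>T\<close> when \<open>B > 0\<close>, which
  is why stopping at 0 realises \<open>\<Psi> t y - M t y\<close>. Three obstacles shape the proof.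
  The Ito integral is a limit in probability along unknown simple processes, so it has to be
  identified with Riemann sums by a comparison that uses no moments of the integrand. Stopping times
  refer to the filtration of \<open>X\<close>, independence of increments refers to
  \<open>F\<close>, and \<open>X\<close> is the geometric Brownian motion only almost surely;
  stopping rules are therefore stated through \<open>X\<close> and evaluated through
  \<open>W\<close>. Optional stopping is used only at finitely many grid times, where it is a finite
  sum of integrals over events of \<open>F s\<close>, so no martingale theory in continuous time
  enters.\<close>

abbreviation gauss :: "real measure" where
  "gauss \<equiv> std_normal_distribution"

lemma prob_space_std_normal: "prob_space gauss"
  by (rule prob_space_normal_density) simp

text \<open>Completing the square: tilting the standard normal law by an exponential shifts its mean
  to \<open>c\<close>, so exponential moments become moments of a shifted normal law.\<close>

lemma std_normal_density_times_exp:
  "std_normal_density z * exp (c * z) = exp (c\<^sup>2 / 2) * normal_density c 1 z"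
  by (simp add: normal_density_def mult_exp_exp power2_eq_square field_simps)

lemma
  shows integrable_std_normal_exp: "integrable gauss (\<lambda>z. exp (c * z))"
    and integral_std_normal_exp: "(\<integral>z. exp (c * z) \<partial>gauss) = exp (c\<^sup>2 / 2)"
  by (simp_all add: integrable_density integral_density std_normal_density_times_exp)

lemma
  shows integrable_std_normal_mult_exp:
      "integrable gauss (\<lambda>z. z * exp (c * z))"
    and integral_std_normal_mult_exp:
      "(\<integral>z. z * exp (c * z) \<partial>gauss) = c * exp (c\<^sup>2 / 2)"
proof -
  have eq: "std_normal_density z * (z * exp (c * z)) = exp (c\<^sup>2 / 2) * (normal_density c 1 z * z)" for z
    using std_normal_density_times_exp[of z c] by (simp add: algebra_simps)
  show "integrable gauss (\<lambda>z. z * exp (c * z))"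
    using integrable_normal_moment_nz_1[of 1 c] by (simp add: integrable_density eq)
  have "(\<integral>z. normal_density c 1 z * z \<partial>lborel) = c"
    using normal_moment_nz_1[of 1 c] by (simp add: has_bochner_integral_integral_eq)
  then show "(\<integral>z. z * exp (c * z) \<partial>gauss) = c * exp (c\<^sup>2 / 2)"
    by (simp add: integral_density eq)
qed

lemma
  shows integrable_std_normal_square: "integrable gauss (\<lambda>z. z\<^sup>2)"
    and integral_std_normal_square: "(\<integral>z. z\<^sup>2 \<partial>gauss) = 1"
    and integrable_std_normal_id: "integrable gauss (\<lambda>z. z)"
    and integral_std_normal_id: "(\<integral>z. z \<partial>gauss) = 0"
  using integrable_std_normal_distribution_moment[of 2] std_normal_distribution_even_moments(1)[of 1]
    integrable_std_normal_distribution_moment[of 1] integral_std_normal_distribution_moment_odd[of 1]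
  by simp_all

lemma integral_std_normal_uminus:
  fixes f :: "real \<Rightarrow> real"
  assumes [measurable]: "f \<in> borel_measurable borel"
  shows "(\<integral>z. f (- z) \<partial>gauss) = (\<integral>z. f z \<partial>gauss)"
proof -
  have "(\<integral>z. std_normal_density z * f z \<partial>lborel) = (\<integral>z. std_normal_density (0 + (-1) * z) * f (0 + (-1) * z) \<partial>lborel)"
    using lborel_integral_real_affine[of "-1" "\<lambda>z. std_normal_density z * f z" 0] by simp
  then show ?thesis
    by (simp add: integral_density std_normal_density_def)
qed

section \<open>The mean of exp (\<sigma> |y + a Z|) for standard normal Z\<close>

lemma cdf_std_normal_distribution:
  "cdf gauss c = (\<integral>z. indicator {..c} z \<partial>gauss)"
  by (simp add: cdf_def)

text \<open>With \<open>a = sqrt (T - s)\<close> this is the function \<open>\<Psi> s\<close> of the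
  overview. The standard deviation is a parameter of its own, so that the Gaussian estimates do not
  mention time.\<close>

definition abs_exp_mean :: "real \<Rightarrow> real \<Rightarrow> real \<Rightarrow> real" where
  "abs_exp_mean \<sigma> a y = (\<integral>z. exp (\<sigma> * \<bar>y + a * z\<bar>) \<partial>gauss)"

lemma exp_abs_le: "exp (c * \<bar>v\<bar>) \<le> exp (c * v) + exp (- (c * v))" for c v :: real
  by (cases "v \<ge> 0") (auto simp: abs_if)

lemma integrable_abs_exp:
  "integrable gauss (\<lambda>z. exp (\<sigma> * \<bar>y + a * z\<bar>))"
proof (rule Bochner_Integration.integrable_bound)
  show "integrable gauss
     (\<lambda>z. exp (\<sigma> * y) * exp ((\<sigma> * a) * z) + exp (- (\<sigma> * y)) * exp ((- (\<sigma> * a)) * z))"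
    by (intro Bochner_Integration.integrable_add integrable_mult_right integrable_std_normal_exp)
  show "AE z in gauss. norm (exp (\<sigma> * \<bar>y + a * z\<bar>))
      \<le> norm (exp (\<sigma> * y) * exp ((\<sigma> * a) * z) + exp (- (\<sigma> * y)) * exp ((- (\<sigma> * a)) * z))"
    using exp_abs_le[of \<sigma> "y + a * _"] by (intro always_eventually allI) (simp add: mult_exp_exp algebra_simps)
qed simp

text \<open>This is where the form of the strike comes from. The two half-lines contribute equally,
  which gives the factor 2; on the positive one the tilt by \<open>c = \<sigma> * a\<close> moves
  the mean to \<open>c\<close>, and a reflection turns the mass of the positive half-line into the
  distribution function at \<open>c\<close>.\<close>

lemma abs_exp_mean_zero:
  assumes "0 \<le> a"
  shows "abs_exp_mean \<sigma> a 0 = 2 * exp ((\<sigma> * a)\<^sup>2 / 2) * cdf gauss (\<sigma> * a)"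
proof -
  let ?N = gauss
  define c where "c = \<sigma> * a"
  define f where "f z = indicator {0<..} z * exp (c * z)" for z :: real
  have f_meas [measurable]: "f \<in> borel_measurable borel"
    unfolding f_def by measurable
  have int: "integrable ?N f" "integrable ?N (\<lambda>z. f (- z))"
    by (rule Bochner_Integration.integrable_bound[OF integrable_std_normal_exp[of c]]
        Bochner_Integration.integrable_bound[OF integrable_std_normal_exp[of "-c"]];
        auto simp: f_def indicator_def)+
  have f_sum: "exp (\<sigma> * \<bar>0 + a * z\<bar>) = f z + f (- z)" if "z \<noteq> 0" for z
  proof -
    have "\<bar>a * z\<bar> = a * \<bar>z\<bar>" using assms by (simp add: abs_mult)
    then show ?thesis using that by (auto simp: f_def c_def indicator_def abs_if)
  qed
  \<comment> \<open>At 0 both indicators vanish while the left-hand side of \<open>f_sum\<close> is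
    1, so the splitting holds only almost everywhere.\<close>
  have ne: "AE z in ?N. z \<noteq> 0"
    using AE_lborel_singleton[of "0::real"] by (subst AE_density) auto
  have "abs_exp_mean \<sigma> a 0 = (\<integral>z. f z + f (- z) \<partial>?N)"
    unfolding abs_exp_mean_def using ne by (intro integral_cong_AE) (auto elim!: eventually_mono simp: f_sum[simplified])
  also have "\<dots> = 2 * (\<integral>z. f z \<partial>?N)"
    using int by (simp add: integral_std_normal_uminus)
  also have "(\<integral>z. f z \<partial>?N) = (\<integral>z. exp (c\<^sup>2 / 2) * (std_normal_density (z - c) * indicator {0<..} z) \<partial>lborel)"
  proof -
    have "std_normal_density z * f z = exp (c\<^sup>2 / 2) * (std_normal_density (z - c) * indicator {0<..} z)" for z
      using std_normal_density_times_exp[of z c] by (auto simp: f_def normal_density_def indicator_def)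
    then show ?thesis by (subst integral_density) (auto simp del: integral_mult_right_zero)
  qed
  also have "\<dots> = exp (c\<^sup>2 / 2) * (\<integral>z. std_normal_density (c - z - c) * indicator {0<..} (c - z) \<partial>lborel)"
    using lborel_integral_real_affine[of "-1" "\<lambda>z. std_normal_density (z - c) * indicator {0<..} z" c] by simp
  also have "(\<integral>z. std_normal_density (c - z - c) * indicator {0<..} (c - z) \<partial>lborel)
      = (\<integral>z. indicator {..c} z \<partial>?N)"
  proof (subst integral_density)
    show "(\<integral>z. std_normal_density (c - z - c) * indicator {0<..} (c - z) \<partial>lborel)
      = (\<integral>z. std_normal_density z *\<^sub>R indicator {..c} z \<partial>lborel)"
      using AE_lborel_singleton[of c]
      by (intro integral_cong_AE) (auto simp: indicator_def std_normal_density_def elim!: eventually_mono)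
  qed auto
  finally show ?thesis
    by (simp add: c_def cdf_std_normal_distribution)
qed

text \<open>The integrand averaged over \<open>z\<close> and \<open>-z\<close> is an even convex function of \<open>y\<close>.\<close>

lemma exp_abs_sum_ge:
  fixes \<sigma> y v :: real
  assumes "\<sigma> > 0"
  shows "2 * exp (\<sigma> * \<bar>v\<bar>) \<le> exp (\<sigma> * \<bar>y + v\<bar>) + exp (\<sigma> * \<bar>y - v\<bar>)"
    and "y \<noteq> 0 \<Longrightarrow> 2 * exp (\<sigma> * \<bar>v\<bar>) < exp (\<sigma> * \<bar>y + v\<bar>) + exp (\<sigma> * \<bar>y - v\<bar>)"
proof -
  have amgm: "2 * exp ((p + q) / 2) \<le> exp p + exp q" for p q :: real
  proof -
    have "0 \<le> (exp (p / 2) - exp (q / 2))\<^sup>2" by simp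
    then show ?thesis
      by (simp add: power2_diff exp_double[symmetric] exp_add add_divide_distrib)
  qed
  have amgm': "2 * exp ((p + q) / 2) < exp p + exp q" if "p \<noteq> q" for p q :: real
  proof -
    have "0 < (exp (p / 2) - exp (q / 2))\<^sup>2" using that by simp
    then show ?thesis
      by (simp add: power2_diff exp_double[symmetric] exp_add add_divide_distrib)
  qed
  let ?p = "\<sigma> * \<bar>y + v\<bar>" and ?q = "\<sigma> * \<bar>y - v\<bar>"
  have le: "\<sigma> * \<bar>v\<bar> \<le> (?p + ?q) / 2"
    using assms by (simp add: distrib_left[symmetric] mult_le_cancel_left) 
  show "2 * exp (\<sigma> * \<bar>v\<bar>) \<le> exp ?p + exp ?q"
    using amgm[of ?p ?q] le by (smt (verit) exp_le_cancel_iff)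
  assume "y \<noteq> 0"
  show "2 * exp (\<sigma> * \<bar>v\<bar>) < exp ?p + exp ?q"
  \<comment> \<open>The inequality between arithmetic and geometric mean is strict unless the
    exponents agree. They agree only if \<open>v = 0\<close>, and then the triangle inequality
    \<open>le\<close> is the strict one because \<open>y\<close> is not 0.\<close>
  proof (cases "?p = ?q")
    case False
    then show ?thesis using amgm'[of ?p ?q] le by (smt (verit) exp_le_cancel_iff)
  next
    case True
    then have "v = 0" using assms \<open>y \<noteq> 0\<close> by (auto simp: abs_if split: if_splits)
    then show ?thesis using assms \<open>y \<noteq> 0\<close> by simp
  qed
qed

text \<open>The reflection symmetry of \<open>gauss\<close> makes twice the difference equal to the
  integral of the symmetrised integrand \<open>g\<close>, which is nonnegative pointwise, and
  positive pointwise for \<open>y\<close> other than 0. The strict form yields the gain from waiting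
  above the boundary.\<close>

lemma abs_exp_mean_ge_zero:
  assumes "\<sigma> > 0"
  shows "abs_exp_mean \<sigma> a 0 \<le> abs_exp_mean \<sigma> a y"
    and "y \<noteq> 0 \<Longrightarrow> abs_exp_mean \<sigma> a 0 < abs_exp_mean \<sigma> a y"
proof -
  let ?N = gauss
  interpret N: prob_space ?N by (rule prob_space_std_normal)
  define g where "g z = exp (\<sigma> * \<bar>y + a * z\<bar>) + exp (\<sigma> * \<bar>y - a * z\<bar>) - 2 * exp (\<sigma> * \<bar>0 + a * z\<bar>)" for z
  have int: "integrable ?N (\<lambda>z. exp (\<sigma> * \<bar>y + a * z\<bar>))" "integrable ?N (\<lambda>z. exp (\<sigma> * \<bar>y - a * z\<bar>))"
    "integrable ?N (\<lambda>z. exp (\<sigma> * \<bar>0 + a * z\<bar>))"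
    using integrable_abs_exp[of \<sigma> y a] integrable_abs_exp[of \<sigma> y "-a"] integrable_abs_exp[of \<sigma> 0 a] by simp_all
  have "(\<integral>z. exp (\<sigma> * \<bar>y - a * z\<bar>) \<partial>?N) = abs_exp_mean \<sigma> a y"
    using integral_std_normal_uminus[of "\<lambda>z. exp (\<sigma> * \<bar>y + a * z\<bar>)"] by (simp add: abs_exp_mean_def)
  then have g: "(\<integral>z. g z \<partial>?N) = 2 * (abs_exp_mean \<sigma> a y - abs_exp_mean \<sigma> a 0)" "integrable ?N g"
    unfolding g_def using int by (auto simp: abs_exp_mean_def)
  have "0 \<le> g z" for z
    using exp_abs_sum_ge(1)[OF assms, of "a * z" y] by (simp add: g_def)
  then have "0 \<le> (\<integral>z. g z \<partial>?N)" by simp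
  with g show "abs_exp_mean \<sigma> a 0 \<le> abs_exp_mean \<sigma> a y" by simp
  assume "y \<noteq> 0"
  then have "0 < g z" for z
    using exp_abs_sum_ge(2)[OF assms, of y "a * z"] by (simp add: g_def)
  then have "(\<integral>z. 0 \<partial>?N) < (\<integral>z. g z \<partial>?N)"
    using g N.emeasure_space_1 by (intro N.integral_less_AE_space) (auto simp del: space_density)
  with g show "abs_exp_mean \<sigma> a 0 < abs_exp_mean \<sigma> a y" by simp
qed

text \<open>Controls the loss from overshoot: stopping at a point \<open>y\<close> near 0 instead of
  at 0 raises the mean by a factor close to 1 at most, uniformly in \<open>a\<close>.\<close>

lemma abs_exp_mean_le:
  assumes "\<sigma> > 0"
  shows "abs_exp_mean \<sigma> a y \<le> exp (\<sigma> * \<bar>y\<bar>) * abs_exp_mean \<sigma> a 0"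
proof -
  have "exp (\<sigma> * \<bar>y + a * z\<bar>) \<le> exp (\<sigma> * \<bar>y\<bar>) * exp (\<sigma> * \<bar>0 + a * z\<bar>)" for z
    using assms by (simp add: mult_exp_exp flip: distrib_left)
  then show ?thesis
    unfolding abs_exp_mean_def
    using integrable_abs_exp[of \<sigma> y a] integrable_abs_exp[of \<sigma> 0 a]
    by (subst integral_mult_right_zero[symmetric]) (intro integral_mono integrable_mult_right)
qed

text \<open>The left-hand side is the mean of \<open>exp (\<sigma> * (y + a * z))\<close>, so this
  is \<open>M \<le> \<Psi>\<close>; it keeps \<open>\<Psi> - M\<close> nonnegative and lets it
  dominate a positive part.\<close>

lemma exp_mean_le_abs_exp_mean:
  assumes "\<sigma> > 0"
  shows "exp (\<sigma> * y + \<sigma>\<^sup>2 * a\<^sup>2 / 2) \<le> abs_exp_mean \<sigma> a y"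
proof -
  have "exp (\<sigma> * y + \<sigma>\<^sup>2 * a\<^sup>2 / 2) = (\<integral>z. exp (\<sigma> * y) * exp ((\<sigma> * a) * z) \<partial>gauss)"
    by (subst integral_mult_right_zero) (simp add: integral_std_normal_exp power_mult_distrib exp_add)
  also have "\<dots> \<le> abs_exp_mean \<sigma> a y"
    unfolding abs_exp_mean_def
  proof (intro integral_mono integrable_abs_exp integrable_mult_right integrable_std_normal_exp)
    show "exp (\<sigma> * y) * exp ((\<sigma> * a) * z) \<le> exp (\<sigma> * \<bar>y + a * z\<bar>)" for z
    proof -
      have "\<sigma> * (y + a * z) \<le> \<sigma> * \<bar>y + a * z\<bar>" using assms by (intro mult_left_mono) auto
      then show ?thesis by (simp add: mult_exp_exp algebra_simps)
    qed
  qed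
  finally show ?thesis .
qed

section \<open>Increments of Brownian motion\<close>

locale brownian_setting =
  fixes M :: "'a measure" and F :: "real \<Rightarrow> 'a measure" and W :: "real \<Rightarrow> 'a \<Rightarrow> real"
  assumes filtered: "filtered_prob_space M F"
    and brownian: "standard_brownian_motion M F W"
begin

sublocale prob_space M
  using filtered by (simp add: filtered_prob_space_def)

sublocale filtration "space M" F
  using filtered by (simp add: filtered_prob_space_def)

lemma sets_F_subset: "sets (F s) \<subseteq> sets M"
  using filtered by (simp add: filtered_prob_space_def)

lemma measurable_F_M: "f \<in> measurable (F s) N \<Longrightarrow> f \<in> measurable M N"
  using sets_F_subset[of s] space_F[of s] by (auto simp: measurable_def)

lemma measurable_F_mono: "s \<le> u \<Longrightarrow> f \<in> measurable (F s) N \<Longrightarrow> f \<in> measurable (F u) N"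
  using sets_F_mono[of s u] space_F[of s] space_F[of u] by (auto simp: measurable_def)

lemma W_measurable_F: "0 \<le> s \<Longrightarrow> s \<le> u \<Longrightarrow> W s \<in> borel_measurable (F u)"
  using brownian by (auto simp: standard_brownian_motion_def intro: measurable_F_mono)

lemma W_measurable [measurable]: "0 \<le> s \<Longrightarrow> W s \<in> borel_measurable M"
  by (rule measurable_F_M[OF W_measurable_F[OF _ order_refl]])

lemma W_continuous: "\<omega> \<in> space M \<Longrightarrow> continuous_on {0..} (\<lambda>t. W t \<omega>)"
  using brownian by (simp add: standard_brownian_motion_def)

text \<open>The definition of Brownian motion gives a density only for \<open>s < u\<close>. Stating
  the law as an image of \<open>gauss\<close> under scaling includes \<open>s = u\<close>, where it
  is a point mass at 0; this case occurs at the last grid time.\<close>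

lemma distr_W_increment:
  assumes "0 \<le> s" "s \<le> u"
  shows "distr M borel (\<lambda>\<omega>. W u \<omega> - W s \<omega>)
    = distr gauss borel (\<lambda>z. sqrt (u - s) * z)"
proof (cases "s = u")
  case True
  interpret N: prob_space gauss by (rule prob_space_std_normal)
  show ?thesis
    using True by (simp add: distr_const N.distr_const)
next
  case False
  with assms have less: "s < u" by simp
  interpret N: prob_space gauss by (rule prob_space_std_normal)
  have "distributed M lborel (\<lambda>\<omega>. W u \<omega> - W s \<omega>) (normal_density 0 (sqrt (u - s)))"
    using brownian assms less by (simp add: standard_brownian_motion_def)
  then have 1: "distr M lborel (\<lambda>\<omega>. W u \<omega> - W s \<omega>) = density lborel (normal_density 0 (sqrt (u - s)))"
    by (simp add: distributed_def)
  have "distributed gauss lborel (\<lambda>z. z) std_normal_density"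
    by (auto simp: distributed_def intro!: measure_eqI simp: emeasure_distr)
  from N.normal_density_affine[OF this, of "sqrt (u - s)" 0] less
  have 2: "distr gauss lborel (\<lambda>z. sqrt (u - s) * z) = density lborel (normal_density 0 (sqrt (u - s)))"
    by (simp add: distributed_def)
  have "distr M borel (\<lambda>\<omega>. W u \<omega> - W s \<omega>) = distr M lborel (\<lambda>\<omega>. W u \<omega> - W s \<omega>)"
    by (rule distr_cong) auto
  also have "\<dots> = distr gauss lborel (\<lambda>z. sqrt (u - s) * z)"
    using 1 2 by simp
  also have "\<dots> = distr gauss borel (\<lambda>z. sqrt (u - s) * z)"
    by (rule distr_cong) auto
  finally show ?thesis .
qed

lemma
  fixes f :: "real \<Rightarrow> real"
  assumes "0 \<le> s" "s \<le> u" and [measurable]: "f \<in> borel_measurable borel"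
  shows integral_W_increment:
      "(\<integral>\<omega>. f (W u \<omega> - W s \<omega>) \<partial>M) = (\<integral>z. f (sqrt (u - s) * z) \<partial>gauss)"
    and integrable_W_increment_iff:
      "integrable M (\<lambda>\<omega>. f (W u \<omega> - W s \<omega>))
        \<longleftrightarrow> integrable gauss (\<lambda>z. f (sqrt (u - s) * z))"
proof -
  have [measurable]: "W s \<in> borel_measurable M" "W u \<in> borel_measurable M"
    using assms by auto
  show "(\<integral>\<omega>. f (W u \<omega> - W s \<omega>) \<partial>M) = (\<integral>z. f (sqrt (u - s) * z) \<partial>gauss)"
    using integral_distr[of "\<lambda>\<omega>. W u \<omega> - W s \<omega>" M borel f]
      integral_distr[of "\<lambda>z. sqrt (u - s) * z" gauss borel f]
      distr_W_increment[OF assms(1,2)] by simp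
  show "integrable M (\<lambda>\<omega>. f (W u \<omega> - W s \<omega>))
        \<longleftrightarrow> integrable gauss (\<lambda>z. f (sqrt (u - s) * z))"
    using integrable_distr_eq[of "\<lambda>\<omega>. W u \<omega> - W s \<omega>" M borel f]
      integrable_distr_eq[of "\<lambda>z. sqrt (u - s) * z" gauss borel f]
      distr_W_increment[OF assms(1,2)] by simp
qed

lemma
  assumes "0 \<le> s" "s \<le> u"
  shows integrable_W_increment: "integrable M (\<lambda>\<omega>. W u \<omega> - W s \<omega>)"
    and expectation_W_increment: "(\<integral>\<omega>. W u \<omega> - W s \<omega> \<partial>M) = 0"
    and integrable_W_increment_square: "integrable M (\<lambda>\<omega>. (W u \<omega> - W s \<omega>)\<^sup>2)"
    and expectation_W_increment_square: "(\<integral>\<omega>. (W u \<omega> - W s \<omega>)\<^sup>2 \<partial>M) = u - s"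
    and integrable_W_increment_exp: "integrable M (\<lambda>\<omega>. exp (c * (W u \<omega> - W s \<omega>)))"
    and expectation_W_increment_exp: "(\<integral>\<omega>. exp (c * (W u \<omega> - W s \<omega>)) \<partial>M) = exp (c\<^sup>2 * (u - s) / 2)"
    and integrable_W_increment_mult_exp:
      "integrable M (\<lambda>\<omega>. (W u \<omega> - W s \<omega>) * exp (c * (W u \<omega> - W s \<omega>)))"
    and expectation_W_increment_mult_exp:
      "(\<integral>\<omega>. (W u \<omega> - W s \<omega>) * exp (c * (W u \<omega> - W s \<omega>)) \<partial>M) = c * (u - s) * exp (c\<^sup>2 * (u - s) / 2)"
proof -
  note int = integrable_W_increment_iff[OF assms, THEN iffD2]
    and eq = integral_W_increment[OF assms, THEN trans]
  have exp: "exp (c * (sqrt (u - s) * z)) = exp ((c * sqrt (u - s)) * z)" for z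
    by (simp add: mult.assoc)
  have [simp]: "(c * sqrt (u - s))\<^sup>2 = c\<^sup>2 * (u - s)" "(sqrt (u - s))\<^sup>2 = u - s"
    "sqrt (u - s) * (c * sqrt (u - s)) = c * (u - s)"
    using assms by (simp_all add: power_mult_distrib)
  show "integrable M (\<lambda>\<omega>. W u \<omega> - W s \<omega>)" 
    by (rule int) (auto intro!: integrable_mult_right integrable_std_normal_id)
  show "(\<integral>\<omega>. W u \<omega> - W s \<omega> \<partial>M) = 0"
    by (rule eq) (simp_all add: integral_std_normal_id)
  show "integrable M (\<lambda>\<omega>. (W u \<omega> - W s \<omega>)\<^sup>2)" 
    by (rule int) (auto simp: power_mult_distrib intro!: integrable_mult_right integrable_std_normal_square)
  show "(\<integral>\<omega>. (W u \<omega> - W s \<omega>)\<^sup>2 \<partial>M) = u - s"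
    by (rule eq) (simp_all add: power_mult_distrib integral_std_normal_square)
  show "integrable M (\<lambda>\<omega>. exp (c * (W u \<omega> - W s \<omega>)))"
    by (rule int) (simp_all only: exp integrable_std_normal_exp, simp)
  show "(\<integral>\<omega>. exp (c * (W u \<omega> - W s \<omega>)) \<partial>M) = exp (c\<^sup>2 * (u - s) / 2)"
    by (rule eq) (simp_all only: exp integral_std_normal_exp, simp_all)
  show "integrable M (\<lambda>\<omega>. (W u \<omega> - W s \<omega>) * exp (c * (W u \<omega> - W s \<omega>)))"
    by (rule int) (auto simp only: exp mult.assoc[of "sqrt (u - s)"]
        intro!: integrable_mult_right integrable_std_normal_mult_exp, simp)
  show "(\<integral>\<omega>. (W u \<omega> - W s \<omega>) * exp (c * (W u \<omega> - W s \<omega>)) \<partial>M) = c * (u - s) * exp (c\<^sup>2 * (u - s) / 2)"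
    by (rule eq) (simp_all only: exp mult.assoc[of "sqrt (u - s)"] integral_mult_right_zero
        integral_std_normal_mult_exp, use assms in \<open>simp_all flip: mult.assoc\<close>)
qed

section \<open>Independence of increments from the past\<close>

lemma indep_set_F_W_increment:
  assumes "0 \<le> s" "s \<le> u"
  shows "indep_set (sets (F s)) {(\<lambda>\<omega>. W u \<omega> - W s \<omega>) -` A \<inter> space M | A. A \<in> sets borel}"
proof (cases "s = u")
  case False
  then show ?thesis
    using brownian assms unfolding standard_brownian_motion_def by auto
next
  case True
  let ?D = "\<lambda>\<omega>. W u \<omega> - W s \<omega>"
  have D: "?D \<in> borel_measurable M"
    using assms by simp
  show ?thesis
  proof (rule indep_setI)
    show "sets (F s) \<subseteq> events" by (rule sets_F_subset)
    show "{?D -` A \<inter> space M | A. A \<in> sets borel} \<subseteq> events"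
      using measurable_sets[OF D] by auto
    fix a b assume "a \<in> sets (F s)" and "b \<in> {?D -` A \<inter> space M | A. A \<in> sets borel}"
    then obtain A where A: "b = ?D -` A \<inter> space M" and a: "a \<subseteq> space M"
      using sets.sets_into_space[of a "F s"] space_F[of s] by auto
    show "prob (a \<inter> b) = prob a * prob b"
    proof (cases "0 \<in> A")
      case True
      then have "b = space M" using A \<open>s = u\<close> by auto
      then show ?thesis using a by (simp add: Int_absorb2 prob_space)
    next
      case False
      then have "b = {}" using A \<open>s = u\<close> by auto
      then show ?thesis by simp
    qed
  qed
qed

lemma indep_var_F_W_increment:
  fixes \<xi> y :: "_ \<Rightarrow> real"
  assumes su: "0 \<le> s" "s \<le> u" and \<xi>: "\<xi> \<in> borel_measurable (F s)" and y: "y \<in> borel_measurable borel"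
  shows "indep_var borel \<xi> borel (\<lambda>\<omega>. y (W u \<omega> - W s \<omega>))"
proof -
  let ?D = "\<lambda>\<omega>. W u \<omega> - W s \<omega>"
  have D: "?D \<in> borel_measurable M" "\<xi> \<in> borel_measurable M"
    using su measurable_F_M[OF \<xi>] by auto
  have stable: "Int_stable {X -` A \<inter> space M | A. A \<in> sets borel}" for X :: "'a \<Rightarrow> real"
  proof (safe intro!: Int_stableI)
    fix A B :: "real set" assume "A \<in> sets borel" "B \<in> sets borel"
    then show "\<exists>C. (X -` A \<inter> space M) \<inter> (X -` B \<inter> space M) = X -` C \<inter> space M \<and> C \<in> sets borel"
      by (intro exI[of _ "A \<inter> B"]) auto
  qed
  have "{\<xi> -` A \<inter> space M | A. A \<in> sets borel} \<subseteq> sets (F s)"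
    using measurable_sets[OF \<xi>] space_F[of s] by auto
  then have "indep_set {\<xi> -` A \<inter> space M | A. A \<in> sets borel} {?D -` A \<inter> space M | A. A \<in> sets borel}"
    using indep_set_F_W_increment[OF su] unfolding indep_sets2_eq by (smt (verit) subset_iff)
  then have "indep_var borel \<xi> borel ?D"
    unfolding indep_var_eq by (intro conjI D indep_set_sigma_sets stable)
  from indep_var_compose[OF this measurable_ident y] show ?thesis
    by (simp add: comp_def)
qed

text \<open>Stands in for conditional expectation: \<open>h (w \<omega>)\<close> is the conditional
  expectation of \<open>g\<close> at \<open>w\<close> plus the increment given \<open>F s\<close>,
  tested on events \<open>A\<close> of \<open>F s\<close>. Independence makes the joint law of past
  and increment a product, and Fubini integrates out the increment.\<close>

lemma freezing:
  fixes g :: "real \<Rightarrow> real"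
  assumes su: "0 \<le> s" "s \<le> u" and A: "A \<in> sets (F s)" and w: "w \<in> borel_measurable (F s)"
    and g [measurable]: "g \<in> borel_measurable borel"
    and int: "integrable M (\<lambda>\<omega>. g (w \<omega> + (W u \<omega> - W s \<omega>)))"
    defines "h \<equiv> \<lambda>y. \<integral>z. g (y + sqrt (u - s) * z) \<partial>gauss"
  shows "(\<integral>\<omega>. indicator A \<omega> * g (w \<omega> + (W u \<omega> - W s \<omega>)) \<partial>M) = (\<integral>\<omega>. indicator A \<omega> * h (w \<omega>) \<partial>M)"
    and "integrable M (\<lambda>\<omega>. indicator A \<omega> * h (w \<omega>))"
proof -
  let ?D = "\<lambda>\<omega>. W u \<omega> - W s \<omega>"
  let ?P = "distr M (F s) (\<lambda>\<omega>. \<omega>)" and ?Q = "distr M borel ?D"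
  define f where "f = (\<lambda>(\<omega>, z). indicator A \<omega> * g (w \<omega> + z))"
  note [measurable] = A w
  have id [measurable]: "(\<lambda>\<omega>. \<omega>) \<in> measurable M (F s)"
    by (rule measurable_F_M[OF measurable_ident_sets[OF refl]])
  have D [measurable]: "?D \<in> borel_measurable M"
    using su by simp
  have AM [measurable]: "A \<in> sets M" using A sets_F_subset[of s] by auto
  have f [measurable]: "f \<in> borel_measurable (F s \<Otimes>\<^sub>M borel)"
    unfolding f_def by measurable
  interpret P: prob_space ?P by (rule prob_space_distr) simp
  interpret Q: prob_space ?Q by (rule prob_space_distr) simp
  interpret PQ: pair_prob_space ?P ?Q ..
  \<comment> \<open>The past enters as the identity map into \<open>F s\<close>, so that the product
    formula expresses independence from the whole sigma-algebra and not only from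
    \<open>w\<close>.\<close>
  have prod: "?P \<Otimes>\<^sub>M ?Q = distr M (F s \<Otimes>\<^sub>M borel) (\<lambda>\<omega>. (\<omega>, ?D \<omega>))"
  proof (rule pair_measure_eqI)
    fix a b assume "a \<in> sets ?P" "b \<in> sets ?Q"
    then have a: "a \<in> sets (F s)" and b: "b \<in> sets borel" by auto
    have "(\<lambda>\<omega>. (\<omega>, ?D \<omega>)) -` (a \<times> b) \<inter> space M = a \<inter> (?D -` b \<inter> space M)"
      by auto
    moreover have "(\<lambda>\<omega>. \<omega>) -` a \<inter> space M = a"
      using sets.sets_into_space[OF a] space_F[of s] by auto
    moreover have "prob (a \<inter> (?D -` b \<inter> space M)) = prob a * prob (?D -` b \<inter> space M)"
      using indep_set_F_W_increment[OF su] a b by (intro indep_setD) auto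
    ultimately show "emeasure ?P a * emeasure ?Q b
        = emeasure (distr M (F s \<Otimes>\<^sub>M borel) (\<lambda>\<omega>. (\<omega>, ?D \<omega>))) (a \<times> b)"
      using a b by (simp add: emeasure_distr emeasure_eq_measure ennreal_mult)
  qed (auto intro!: P.sigma_finite_measure_axioms Q.sigma_finite_measure_axioms sets_pair_measure_cong)
  have "integrable M (\<lambda>\<omega>. indicator A \<omega> * g (w \<omega> + ?D \<omega>))"
    using integrable_real_mult_indicator[OF AM int] by (simp add: mult.commute)
  then have "integrable (distr M (F s \<Otimes>\<^sub>M borel) (\<lambda>\<omega>. (\<omega>, ?D \<omega>))) f"
    by (subst integrable_distr_eq) (auto simp: f_def)
  then have intf: "integrable (?P \<Otimes>\<^sub>M ?Q) f"
    unfolding prod .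
  have inner: "(\<integral>z. f (\<omega>, z) \<partial>?Q) = indicator A \<omega> * h (w \<omega>)" for \<omega>
  proof -
    have "(\<integral>z. f (\<omega>, z) \<partial>?Q) = indicator A \<omega> * (\<integral>z. g (w \<omega> + z) \<partial>?Q)"
      by (simp add: f_def)
    also have "(\<integral>z. g (w \<omega> + z) \<partial>?Q) = h (w \<omega>)"
      unfolding h_def distr_W_increment[OF su] by (subst integral_distr) auto
    finally show ?thesis .
  qed
  have h_meas [measurable]: "h \<in> borel_measurable borel"
  proof -
    interpret N: prob_space gauss by (rule prob_space_std_normal)
    show ?thesis unfolding h_def by measurable
  qed
  have "(\<integral>\<omega>. indicator A \<omega> * g (w \<omega> + ?D \<omega>) \<partial>M) = integral\<^sup>L (?P \<Otimes>\<^sub>M ?Q) f"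
    unfolding prod by (subst integral_distr) (auto simp: f_def)
  also have "\<dots> = (\<integral>\<omega>. \<integral>z. f (\<omega>, z) \<partial>?Q \<partial>?P)"
    using PQ.integral_fst'[OF intf] by simp
  also have "\<dots> = (\<integral>\<omega>. indicator A \<omega> * h (w \<omega>) \<partial>?P)"
    unfolding inner ..
  also have "\<dots> = (\<integral>\<omega>. indicator A \<omega> * h (w \<omega>) \<partial>M)"
    by (subst integral_distr) auto
  finally show "(\<integral>\<omega>. indicator A \<omega> * g (w \<omega> + ?D \<omega>) \<partial>M) = (\<integral>\<omega>. indicator A \<omega> * h (w \<omega>) \<partial>M)" .
  have "integrable ?P (\<lambda>\<omega>. indicator A \<omega> * h (w \<omega>))"
    using PQ.integrable_fst'[OF intf] unfolding inner .
  then show "integrable M (\<lambda>\<omega>. indicator A \<omega> * h (w \<omega>))"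
    by (subst (asm) integrable_distr_eq) auto
qed

end

section \<open>Ito integrals as limits of Riemann sums\<close>

context brownian_setting begin

abbreviation square_integrable :: "('a \<Rightarrow> real) \<Rightarrow> bool" where
  "square_integrable f \<equiv> integrable M (\<lambda>\<omega>. (f \<omega>)\<^sup>2)"

abbreviation msq :: "('a \<Rightarrow> real) \<Rightarrow> real" where
  "msq f \<equiv> \<integral>\<omega>. (f \<omega>)\<^sup>2 \<partial>M"

abbreviation incr :: "(nat \<Rightarrow> real) \<Rightarrow> nat \<Rightarrow> 'a \<Rightarrow> real" where
  "incr q j \<omega> \<equiv> W (q (Suc j)) \<omega> - W (q j) \<omega>"

lemma integrable_if_square_integrable:
  assumes [measurable]: "f \<in> borel_measurable M" and "integrable M (\<lambda>\<omega>. (f \<omega> :: real)\<^sup>2)"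
  shows "integrable M f"
proof (rule Bochner_Integration.integrable_bound)
  show "integrable M (\<lambda>\<omega>. 1 + (f \<omega>)\<^sup>2)" using assms by auto
  have "\<bar>v\<bar> \<le> 1 + v\<^sup>2" for v :: real
    using zero_le_power2[of "\<bar>v\<bar> - 1"] zero_le_power2[of v] by (simp add: power2_diff) 
  then show "AE \<omega> in M. norm (f \<omega>) \<le> norm (1 + (f \<omega>)\<^sup>2)" by auto
qed simp

lemma integrable_product_if_square_integrable:
  assumes [measurable]: "f \<in> borel_measurable M" "g \<in> borel_measurable M"
    and "integrable M (\<lambda>\<omega>. (f \<omega> :: real)\<^sup>2)" "integrable M (\<lambda>\<omega>. (g \<omega>)\<^sup>2)"
  shows "integrable M (\<lambda>\<omega>. f \<omega> * g \<omega>)"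
proof (rule Bochner_Integration.integrable_bound)
  show "integrable M (\<lambda>\<omega>. (f \<omega>)\<^sup>2 + (g \<omega>)\<^sup>2)" using assms by auto
  have "\<bar>v * w\<bar> \<le> v\<^sup>2 + w\<^sup>2" for v w :: real
  proof -
    have "0 \<le> \<bar>v\<bar> * \<bar>w\<bar>" by simp
    then show ?thesis
      using sum_squares_bound[of "\<bar>v\<bar>" "\<bar>w\<bar>"] unfolding abs_mult power2_abs by linarith
  qed
  then show "AE \<omega> in M. norm (f \<omega> * g \<omega>) \<le> norm ((f \<omega>)\<^sup>2 + (g \<omega>)\<^sup>2)" by auto
qed simp

lemma transform_second_moment:
  fixes q :: "nat \<Rightarrow> real" and \<xi> :: "nat \<Rightarrow> 'a \<Rightarrow> real" and y :: "nat \<Rightarrow> real \<Rightarrow> real"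
  assumes q: "0 \<le> q 0" "\<And>j. j < n \<Longrightarrow> q j \<le> q (Suc j)"
    and \<xi>: "\<And>j. j < n \<Longrightarrow> \<xi> j \<in> borel_measurable (F (q j))"
      "\<And>j. j < n \<Longrightarrow> square_integrable (\<xi> j)"
    and y: "\<And>j. j < n \<Longrightarrow> y j \<in> borel_measurable borel"
      "\<And>j. j < n \<Longrightarrow> integrable M (\<lambda>\<omega>. (y j (incr q j \<omega>))\<^sup>2)"
      "\<And>j. j < n \<Longrightarrow> (\<integral>\<omega>. y j (incr q j \<omega>) \<partial>M) = 0"
  defines "S \<equiv> \<lambda>\<omega>. \<Sum>j<n. \<xi> j \<omega> * y j (incr q j \<omega>)"
  shows "square_integrable S" (is ?int)
    and "msq S
      = (\<Sum>j<n. msq (\<xi> j) * (\<integral>\<omega>. (y j (incr q j \<omega>))\<^sup>2 \<partial>M))" (is ?eq)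
proof -
  have "0 \<le> q n \<and> S \<in> borel_measurable (F (q n)) \<and> ?int \<and> ?eq"
    using assms(1-7) unfolding S_def
  proof (induction n)
    case 0
    then show ?case by simp
  next
    case (Suc n)
    define Z where "Z \<omega> = (\<Sum>j<n. \<xi> j \<omega> * y j (incr q j \<omega>))" for \<omega>
    define Y where "Y \<omega> = y n (incr q n \<omega>)" for \<omega>
    have IH: "0 \<le> q n" "Z \<in> borel_measurable (F (q n))" "square_integrable Z"
      "msq Z
      = (\<Sum>j<n. msq (\<xi> j) * (\<integral>\<omega>. (y j (incr q j \<omega>))\<^sup>2 \<partial>M))"
      using Suc.IH Suc.prems unfolding Z_def by auto
    have le: "q n \<le> q (Suc n)" using Suc.prems by simp
    note yn [measurable] = Suc.prems(5)[of n, simplified]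
    note \<xi>n = Suc.prems(3)[of n, simplified]
    have [measurable]: "Z \<in> borel_measurable M" "\<xi> n \<in> borel_measurable M"
      using IH \<xi>n by (auto intro: measurable_F_M)
    have WM: "W (q (Suc n)) \<in> borel_measurable (F (q (Suc n)))" "W (q n) \<in> borel_measurable (F (q (Suc n)))"
      using IH le by (auto intro: W_measurable_F)
    have YF: "Y \<in> borel_measurable (F (q (Suc n)))"
      unfolding Y_def using WM yn by measurable
    then have [measurable]: "Y \<in> borel_measurable M" by (rule measurable_F_M)
    have Y: "square_integrable Y" "integrable M Y" "(\<integral>\<omega>. Y \<omega> \<partial>M) = 0"
      using Suc.prems(6,7)[of n] integrable_if_square_integrable[of Y] unfolding Y_def[symmetric] by auto
    note indep = indep_var_F_W_increment[OF IH(1) le]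
    have Z\<xi>: "(\<lambda>\<omega>. Z \<omega> * \<xi> n \<omega>) \<in> borel_measurable (F (q n))"
      using IH \<xi>n by measurable
    \<comment> \<open>\<open>Z * \<xi> n\<close> is integrable as a product of square integrable
      functions; independence from \<open>Y\<close> then gives integrability of the triple product
      without higher moments.\<close>
    have int1: "integrable M (\<lambda>\<omega>. (Z \<omega> * \<xi> n \<omega>) * Y \<omega>)"
      "(\<integral>\<omega>. (Z \<omega> * \<xi> n \<omega>) * Y \<omega> \<partial>M) = 0"
    proof -
      have i: "integrable M (\<lambda>\<omega>. Z \<omega> * \<xi> n \<omega>)"
        by (rule integrable_product_if_square_integrable) (use IH Suc.prems in auto)
      have "indep_var borel (\<lambda>\<omega>. Z \<omega> * \<xi> n \<omega>) borel Y"
        using indep[OF Z\<xi> yn] unfolding Y_def .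
      from indep_var_integrable[OF this i Y(2)] indep_var_lebesgue_integral[OF this i Y(2)] Y(3)
      show "integrable M (\<lambda>\<omega>. (Z \<omega> * \<xi> n \<omega>) * Y \<omega>)"
        "(\<integral>\<omega>. (Z \<omega> * \<xi> n \<omega>) * Y \<omega> \<partial>M) = 0" by simp_all
    qed
    have int2: "integrable M (\<lambda>\<omega>. (\<xi> n \<omega>)\<^sup>2 * (Y \<omega>)\<^sup>2)"
      "(\<integral>\<omega>. (\<xi> n \<omega>)\<^sup>2 * (Y \<omega>)\<^sup>2 \<partial>M) = msq (\<xi> n) * msq Y"
    proof -
      have "(\<lambda>\<omega>. (\<xi> n \<omega>)\<^sup>2) \<in> borel_measurable (F (q n))"
        using \<xi>n by measurable
      then have iv: "indep_var borel (\<lambda>\<omega>. (\<xi> n \<omega>)\<^sup>2) borel (\<lambda>\<omega>. (Y \<omega>)\<^sup>2)"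
        using indep[of "\<lambda>\<omega>. (\<xi> n \<omega>)\<^sup>2" "\<lambda>z. (y n z)\<^sup>2"] unfolding Y_def by simp
      have i: "square_integrable (\<xi> n)" using Suc.prems by simp
      show "integrable M (\<lambda>\<omega>. (\<xi> n \<omega>)\<^sup>2 * (Y \<omega>)\<^sup>2)"
      "(\<integral>\<omega>. (\<xi> n \<omega>)\<^sup>2 * (Y \<omega>)\<^sup>2 \<partial>M) = msq (\<xi> n) * msq Y"
        using indep_var_integrable[OF iv i Y(1)] indep_var_lebesgue_integral[OF iv i Y(1)] by simp_all
    qed
    have expand: "(Z \<omega> + \<xi> n \<omega> * Y \<omega>)\<^sup>2 = (Z \<omega>)\<^sup>2 + (2 * ((Z \<omega> * \<xi> n \<omega>) * Y \<omega>) + (\<xi> n \<omega>)\<^sup>2 * (Y \<omega>)\<^sup>2)" for \<omega>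
      by (simp add: power2_sum power_mult_distrib)
    have "(\<lambda>\<omega>. Z \<omega> + \<xi> n \<omega> * Y \<omega>) \<in> borel_measurable (F (q (Suc n)))"
      using measurable_F_mono[OF le IH(2)] measurable_F_mono[OF le \<xi>n] YF by measurable
    moreover have "integrable M (\<lambda>\<omega>. (Z \<omega> + \<xi> n \<omega> * Y \<omega>)\<^sup>2)"
      unfolding expand using IH int1 int2 by (intro Bochner_Integration.integrable_add integrable_mult_right) auto
    moreover have "(\<integral>\<omega>. (Z \<omega> + \<xi> n \<omega> * Y \<omega>)\<^sup>2 \<partial>M)
      = msq Z + msq (\<xi> n) * msq Y"
      unfolding expand using IH int1 int2 by simp
    ultimately show ?case
      using IH le unfolding Z_def Y_def by simp
  qed
  then show ?int ?eq by auto
qed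

text \<open>Stopping the transform as soon as its quadratic variation exceeds \<open>\<delta>\<close> makes it square
  integrable, whatever the integrands are.\<close>

lemma prob_transform_le:
  fixes q :: "nat \<Rightarrow> real" and \<xi> :: "nat \<Rightarrow> 'a \<Rightarrow> real"
  assumes q: "0 \<le> q 0" "\<And>j. j < n \<Longrightarrow> q j < q (Suc j)"
    and \<xi>: "\<And>j. j < n \<Longrightarrow> \<xi> j \<in> borel_measurable (F (q j))"
    and pos: "\<epsilon> > 0" "\<delta> > 0"
  shows "prob {\<omega>\<in>space M. \<epsilon> < \<bar>\<Sum>j<n. \<xi> j \<omega> * (incr q j \<omega>)\<bar>}
    \<le> prob {\<omega>\<in>space M. \<delta> < (\<Sum>j<n. (\<xi> j \<omega>)\<^sup>2 * (q (Suc j) - q j))} + \<delta> / \<epsilon>\<^sup>2"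
proof -
  define Q where "Q k \<omega> = (\<Sum>j<k. (\<xi> j \<omega>)\<^sup>2 * (q (Suc j) - q j))" for k \<omega>
  \<comment> \<open>The truncation tests \<open>Q (Suc j)\<close>, which already contains the term
    of \<open>\<xi> j\<close>: it is known at time \<open>q j\<close>, and the sum of the kept terms
    never exceeds \<open>\<delta>\<close>, not even by the last one.\<close>
  define \<eta> where "\<eta> j \<omega> = (if Q (Suc j) \<omega> \<le> \<delta> then \<xi> j \<omega> else 0)" for j \<omega>
  have q_mono: "0 \<le> q i \<and> q i \<le> q j" if "i \<le> j" "j \<le> n" for i j
  proof -
    have "q i \<le> q j" if "i \<le> j" "j \<le> n" for i j
      using that
    proof (induction rule: dec_induct)
      case (step k)
      then show ?case using q(2)[of k] by simp
    qed simp
    from this[OF that] this[of 0 i] show ?thesis using that q(1) by auto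
  qed
  have \<xi>M: "\<xi> j \<in> borel_measurable (F (q i))" if "j \<le> i" "i < n" for i j
    using measurable_F_mono[of "q j" "q i"] q_mono[of j i] \<xi>[of j] that by auto
  have \<xi>M': "\<xi> j \<in> borel_measurable M" if "j < n" for j
    using \<xi>[OF that] by (rule measurable_F_M)
  have Q_mono: "Q i \<omega> \<le> Q j \<omega>" if "i \<le> j" "j \<le> n" for i j \<omega>
    using that unfolding Q_def by (intro sum_mono2) (auto intro!: mult_nonneg_nonneg less_imp_le[OF q(2)])
  have \<eta>_sum: "(\<Sum>j<k. (\<eta> j \<omega>)\<^sup>2 * (q (Suc j) - q j)) \<le> \<delta>" if "k \<le> n" for k \<omega>
    using that
  proof (induction k)
    case 0
    then show ?case using pos by simp
  next
    case (Suc k)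
    show ?case
    proof (cases "Q (Suc k) \<omega> \<le> \<delta>")
      case True
      have "\<eta> j \<omega> = \<xi> j \<omega>" if "j < Suc k" for j
        using Q_mono[of "Suc j" "Suc k" \<omega>] that Suc.prems True by (auto simp: \<eta>_def)
      then show ?thesis using True by (simp add: Q_def)
    next
      case False
      then show ?thesis using Suc by (simp add: \<eta>_def)
    qed
  qed
  have QF [measurable]: "Q (Suc j) \<in> borel_measurable (F (q j))" if "j < n" for j
    unfolding Q_def using that by (intro borel_measurable_sum borel_measurable_times borel_measurable_power \<xi>M) auto
  have \<eta>F: "\<eta> j \<in> borel_measurable (F (q j))" if "j < n" for j
    unfolding \<eta>_def using QF[OF that] \<xi>[OF that] by measurable
  have \<eta>M: "\<eta> j \<in> borel_measurable M" if "j < n" for j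
    using \<eta>F[OF that] by (rule measurable_F_M)
  have \<eta>_int: "square_integrable (\<eta> j)" if "j < n" for j
  proof (rule integrable_const_bound)
    have "(\<eta> j \<omega>)\<^sup>2 * (q (Suc j) - q j) \<le> \<delta>" for \<omega>
    proof -
      have "(\<eta> j \<omega>)\<^sup>2 * (q (Suc j) - q j) \<le> (\<Sum>j<n. (\<eta> j \<omega>)\<^sup>2 * (q (Suc j) - q j))"
        using that by (intro member_le_sum) (auto intro!: mult_nonneg_nonneg less_imp_le[OF q(2)])
      with \<eta>_sum[of n \<omega>] show ?thesis by simp
    qed
    then have "norm ((\<eta> j \<omega>)\<^sup>2) \<le> \<delta> / (q (Suc j) - q j)" for \<omega>
      using q(2)[OF that] by (simp add: field_simps)
    then show "AE \<omega> in M. norm ((\<eta> j \<omega>)\<^sup>2) \<le> \<delta> / (q (Suc j) - q j)" by simp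
  qed (use \<eta>M[OF that] in measurable)
  define S where "S \<omega> = (\<Sum>j<n. \<eta> j \<omega> * (incr q j \<omega>))" for \<omega>
  have qj: "0 \<le> q j" "q j \<le> q (Suc j)" if "j < n" for j
    using q_mono[of j "Suc j"] that by auto
  have S: "square_integrable S"
    "msq S = (\<Sum>j<n. msq (\<eta> j) * (q (Suc j) - q j))"
    using transform_second_moment[of q n \<eta> "\<lambda>_ z. z"] q(1) qj \<eta>F \<eta>_int unfolding S_def
    by (simp_all add: integrable_W_increment_square expectation_W_increment_square expectation_W_increment)
  have "msq S = (\<integral>\<omega>. (\<Sum>j<n. (\<eta> j \<omega>)\<^sup>2 * (q (Suc j) - q j)) \<partial>M)"
    unfolding S using \<eta>_int by simp
  also have "\<dots> \<le> (\<integral>\<omega>. \<delta> \<partial>M)"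
    using \<eta>_int \<eta>_sum by (intro integral_mono) auto
  finally have ES: "msq S \<le> \<delta>" by (simp add: prob_space)
  have SM [measurable]: "S \<in> borel_measurable M"
    unfolding S_def using \<eta>M qj order_trans[OF qj]
    by (intro borel_measurable_sum borel_measurable_times borel_measurable_diff W_measurable) auto
  have "prob {\<omega>\<in>space M. \<epsilon>\<^sup>2 \<le> (S \<omega>)\<^sup>2} \<le> msq S / \<epsilon>\<^sup>2"
    using integral_Markov_inequality_measure[OF S(1), of "{}" "\<epsilon>\<^sup>2"] pos by simp
  also have "\<dots> \<le> \<delta> / \<epsilon>\<^sup>2" using ES pos by (simp add: divide_right_mono)
  finally have markov: "prob {\<omega>\<in>space M. \<epsilon>\<^sup>2 \<le> (S \<omega>)\<^sup>2} \<le> \<delta> / \<epsilon>\<^sup>2" .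
  have QM [measurable]: "Q n \<in> borel_measurable M"
    unfolding Q_def using \<xi>M' by (intro borel_measurable_sum borel_measurable_times borel_measurable_power) auto
  have "{\<omega>\<in>space M. \<epsilon> < \<bar>\<Sum>j<n. \<xi> j \<omega> * (incr q j \<omega>)\<bar>}
    \<subseteq> {\<omega>\<in>space M. \<delta> < Q n \<omega>} \<union> {\<omega>\<in>space M. \<epsilon>\<^sup>2 \<le> (S \<omega>)\<^sup>2}"
  proof safe
    fix \<omega> assume \<omega>: "\<epsilon> < \<bar>\<Sum>j<n. \<xi> j \<omega> * (incr q j \<omega>)\<bar>"
      and "\<not> \<epsilon>\<^sup>2 \<le> (S \<omega>)\<^sup>2"
    then have "\<bar>S \<omega>\<bar> < \<epsilon>"
      using pos by (metis abs_le_square_iff abs_of_pos not_le)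
    have "\<not> Q n \<omega> \<le> \<delta>"
    proof
      assume "Q n \<omega> \<le> \<delta>"
      then have "\<eta> j \<omega> = \<xi> j \<omega>" if "j < n" for j
        using Q_mono[of "Suc j" n \<omega>] that by (auto simp: \<eta>_def)
      then show False using \<omega> \<open>\<bar>S \<omega>\<bar> < \<epsilon>\<close> by (simp add: S_def)
    qed
    then show "\<delta> < Q n \<omega>" by simp
  qed
  then have "prob {\<omega>\<in>space M. \<epsilon> < \<bar>\<Sum>j<n. \<xi> j \<omega> * (incr q j \<omega>)\<bar>}
    \<le> prob ({\<omega>\<in>space M. \<delta> < Q n \<omega>} \<union> {\<omega>\<in>space M. \<epsilon>\<^sup>2 \<le> (S \<omega>)\<^sup>2})"
    by (intro finite_measure_mono) measurable
  also have "\<dots> \<le> prob {\<omega>\<in>space M. \<delta> < Q n \<omega>} + prob {\<omega>\<in>space M. \<epsilon>\<^sup>2 \<le> (S \<omega>)\<^sup>2}"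
    by (intro measure_Un_le) measurable
  finally show ?thesis using markov by (simp add: Q_def)
qed

end

section \<open>Partitions and common refinements\<close>

lemma sum_indicator_consecutive:
  fixes q :: "nat \<Rightarrow> real"
  assumes "\<And>i. i < m \<Longrightarrow> q i \<le> q (Suc i)"
  shows "(\<Sum>i<m. indicator {q i<..q (Suc i)} u :: real) = indicator {q 0<..q m} u \<and> q 0 \<le> q m"
  using assms
proof (induction m)
  case (Suc m)
  then have "q m \<le> q (Suc m)" "(\<Sum>i<m. indicator {q i<..q (Suc i)} u :: real) = indicator {q 0<..q m} u" "q 0 \<le> q m"
    by auto
  then show ?case by (auto simp: indicator_def)
qed simp

text \<open>Enumerates the union of two partitions without repetitions; strict increase is the form
  in which \<open>prob_transform_le\<close> takes its grid.\<close>

lemma strict_grid_exists: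
  fixes a b :: real
  assumes "finite P" "a \<in> P" "b \<in> P" "P \<subseteq> {a..b}"
  shows "\<exists>m q. (\<forall>i j. i < j \<longrightarrow> j \<le> m \<longrightarrow> q i < q j) \<and> q 0 = a \<and> q m = b \<and> P = q ` {..m::nat}"
proof -
  define xs where "xs = sorted_list_of_set P"
  have xs: "set xs = P" "sorted_wrt (<) xs"
    using assms by (simp_all add: xs_def)
  then have ne: "xs \<noteq> []" using assms by auto
  define m where "m = length xs - 1"
  have len: "length xs = Suc m" using ne by (simp add: m_def)
  have strict: "xs ! i < xs ! j" if "i < j" "j \<le> m" for i j
    using sorted_wrt_nth_less[OF xs(2) that(1)] that len by simp
  then have mono: "xs ! i \<le> xs ! j" if "i \<le> j" "j \<le> m" for i j
    using that by (cases "i = j") (auto intro: less_imp_le)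
  have img: "P = (\<lambda>i. xs ! i) ` {..m}"
    using xs(1) len by (auto simp: set_conv_nth less_Suc_eq_le)
  have bounds: "a \<le> xs ! i" "xs ! i \<le> b" if "i \<le> m" for i
    using img assms(4) that by auto
  obtain k l where kl: "k \<le> m" "xs ! k = a" "l \<le> m" "xs ! l = b"
    using img assms(2,3) by auto
  have "xs ! 0 = a" using mono[of 0 k] bounds(1)[of 0] kl by simp
  moreover have "xs ! m = b" using mono[of l m] bounds(2)[of m] kl by simp
  ultimately show ?thesis
    using strict img by (intro exI[of _ m] exI[of _ "\<lambda>i. xs ! i"]) auto
qed

text \<open>Every point of \<open>p\<close> is a point of \<open>q\<close>, so none lies inside a
  cell of \<open>q\<close> and the process is constant there. Its value is read off at the right
  endpoint, since cells are open on the left and closed on the right.\<close>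

lemma
  fixes q :: "nat \<Rightarrow> real"
  assumes q: "\<And>i j. i < j \<Longrightarrow> j \<le> m \<Longrightarrow> q i < q j" and p: "p ` {..n} \<subseteq> q ` {..m}"
    and p_mono: "\<And>k. k < n \<Longrightarrow> p k \<le> p (Suc k)"
  shows simple_process_refine:
      "i < m \<Longrightarrow> u \<in> {q i<..q (Suc i)} \<Longrightarrow> simple_process n p \<xi> u \<omega> = simple_process n p \<xi> (q (Suc i)) \<omega>"
    and simple_integral_refine:
      "simple_integral W n p \<xi> \<omega>
        = (\<Sum>i<m. simple_process n p \<xi> (q (Suc i)) \<omega> * (W (q (Suc i)) \<omega> - W (q i) \<omega>))"
proof -
  have q_le: "q i \<le> q j \<longleftrightarrow> i \<le> j" if "i \<le> m" "j \<le> m" for i j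
    using q[of i j] q[of j i] that by (cases i j rule: linorder_cases) auto
  have pq: "\<exists>l\<le>m. p k = q l" if "k \<le> n" for k
    using p that by auto
  have less_iff: "p k < u \<longleftrightarrow> p k \<le> q i" if "k \<le> n" "i < m" "u \<in> {q i<..q (Suc i)}" for k i u
  proof -
    obtain l where l: "l \<le> m" "p k = q l" using pq[OF \<open>k \<le> n\<close>] by auto
    show ?thesis
    proof
      assume "p k < u"
      then have "q l < q (Suc i)" using that l by auto
      then have "\<not> Suc i \<le> l" using q_le[of "Suc i" l] that l by auto
      then show "p k \<le> q i" using q_le[of l i] l that by simp
    qed (use that in auto)
  qed
  show "simple_process n p \<xi> u \<omega> = simple_process n p \<xi> (q (Suc i)) \<omega>"
    if i: "i < m" and u: "u \<in> {q i<..q (Suc i)}"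
  proof -
    have su: "q (Suc i) \<in> {q i<..q (Suc i)}" using q[of i "Suc i"] i by simp
    have "indicator {p k<..p (Suc k)} u = (indicator {p k<..p (Suc k)} (q (Suc i)) :: real)" if "k < n" for k
      using less_iff[of k i u] less_iff[of "Suc k" i u] less_iff[of k i "q (Suc i)"]
        less_iff[of "Suc k" i "q (Suc i)"] that i u su by (auto simp: indicator_def not_less[symmetric])
    then show ?thesis by (simp add: simple_process_def)
  qed
  \<comment> \<open>The cells of \<open>q\<close> inside one interval of \<open>p\<close> have
    consecutive indices \<open>l..<l'\<close>; an empty interval gives \<open>l = l'\<close> and the
    sum 0.\<close>
  have telescope: "(\<Sum>i<m. indicator {p k<..p (Suc k)} (q (Suc i)) * (f (q (Suc i)) - f (q i))) = f (p (Suc k)) - f (p k)"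
    if k: "k < n" for k and f :: "real \<Rightarrow> real"
  proof -
    obtain l l' where l: "l \<le> m" "p k = q l" "l' \<le> m" "p (Suc k) = q l'"
      using pq[of k] pq[of "Suc k"] k by auto
    have ll: "l \<le> l'" using p_mono[OF k] q_le[of l l'] l by simp
    have "indicator {p k<..p (Suc k)} (q (Suc i)) = (indicator {l..<l'} i :: real)" if "i < m" for i
      using q_le[of "Suc i" l] q_le[of "Suc i" l'] l that by (auto simp: indicator_def not_le[symmetric])
    then have "(\<Sum>i<m. indicator {p k<..p (Suc k)} (q (Suc i)) * (f (q (Suc i)) - f (q i)))
      = (\<Sum>i<m. indicator {l..<l'} i * (f (q (Suc i)) - f (q i)))" by simp
    also have "\<dots> = (\<Sum>i=l..<l'. f (q (Suc i)) - f (q i))"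
      using l by (intro sum.mono_neutral_cong_right) auto
    also have "\<dots> = f (q l') - f (q l)" using ll by (rule sum_Suc_diff')
    finally show ?thesis using l by simp
  qed
  show "simple_integral W n p \<xi> \<omega>
        = (\<Sum>i<m. simple_process n p \<xi> (q (Suc i)) \<omega> * (W (q (Suc i)) \<omega> - W (q i) \<omega>))"
  proof -
    have "(\<Sum>i<m. simple_process n p \<xi> (q (Suc i)) \<omega> * (W (q (Suc i)) \<omega> - W (q i) \<omega>))
      = (\<Sum>i<m. \<Sum>k<n. \<xi> k \<omega> * (indicator {p k<..p (Suc k)} (q (Suc i)) * (W (q (Suc i)) \<omega> - W (q i) \<omega>)))"
      unfolding simple_process_def sum_distrib_right mult.assoc ..
    also have "\<dots> = (\<Sum>k<n. \<xi> k \<omega> * (\<Sum>i<m. indicator {p k<..p (Suc k)} (q (Suc i)) * (W (q (Suc i)) \<omega> - W (q i) \<omega>)))"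
      unfolding sum_distrib_left by (rule sum.swap)
    also have "\<dots> = simple_integral W n p \<xi> \<omega>"
      unfolding simple_integral_def
      by (intro sum.cong refl) (simp only: telescope[of _ "\<lambda>u. W u \<omega>"] lessThan_iff)
    finally show ?thesis ..
  qed
qed

section \<open>Convergence in probability\<close>

lemma (in prob_space) prob_Un_bound:
  assumes "A \<subseteq> B \<union> C" "B \<in> events" "C \<in> events"
  shows "prob A \<le> prob B + prob C"
proof -
  have "prob A \<le> prob (B \<union> C)" using assms by (intro finite_measure_mono) auto
  also have "\<dots> \<le> prob B + prob C" using assms by (intro measure_Un_le) auto
  finally show ?thesis .
qed

lemma (in prob_space) prob_triangle:
  assumes [measurable]: "f \<in> borel_measurable M" "g \<in> borel_measurable M" "h \<in> borel_measurable M"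
  shows "prob {\<omega>\<in>space M. \<epsilon> < \<bar>f \<omega> - h \<omega> :: real\<bar>}
    \<le> prob {\<omega>\<in>space M. \<epsilon> / 2 < \<bar>f \<omega> - g \<omega>\<bar>} + prob {\<omega>\<in>space M. \<epsilon> / 2 < \<bar>g \<omega> - h \<omega>\<bar>}"
proof (rule prob_Un_bound)
  have "\<epsilon> / 2 < \<bar>a - b\<bar> \<or> \<epsilon> / 2 < \<bar>b - c\<bar>" if "\<epsilon> < \<bar>a - c\<bar>" for a b c :: real
    using that by linarith
  then show "{\<omega>\<in>space M. \<epsilon> < \<bar>f \<omega> - h \<omega>\<bar>}
      \<subseteq> {\<omega>\<in>space M. \<epsilon> / 2 < \<bar>f \<omega> - g \<omega>\<bar>} \<union> {\<omega>\<in>space M. \<epsilon> / 2 < \<bar>g \<omega> - h \<omega>\<bar>}" by blast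
qed measurable

lemma (in prob_space) converges_in_prob_if_AE:
  assumes [measurable]: "\<And>k. Y k \<in> borel_measurable M" "Z \<in> borel_measurable M"
    and lim: "AE \<omega> in M. (\<lambda>k. Y k \<omega>) \<longlonglongrightarrow> Z \<omega>"
  shows "converges_in_prob M Y Z"
  unfolding converges_in_prob_def
proof (intro conjI allI impI)
  fix \<epsilon> :: real assume "\<epsilon> > 0"
  have "(\<lambda>k. \<integral>\<omega>. indicator {\<omega>\<in>space M. \<epsilon> < \<bar>Y k \<omega> - Z \<omega>\<bar>} \<omega> \<partial>M) \<longlonglongrightarrow> (\<integral>\<omega>. 0 \<partial>M :: real)"
  proof (rule integral_dominated_convergence[where w="\<lambda>_. 1"])
    show "AE \<omega> in M. (\<lambda>k. indicator {\<omega>\<in>space M. \<epsilon> < \<bar>Y k \<omega> - Z \<omega>\<bar>} \<omega>) \<longlonglongrightarrow> (0::real)"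
      using lim
    proof eventually_elim
      case (elim \<omega>)
      have "\<forall>\<^sub>F k in sequentially. \<bar>Y k \<omega> - Z \<omega>\<bar> < \<epsilon>"
        using tendstoD[OF elim \<open>\<epsilon> > 0\<close>] by (simp add: dist_real_def)
      then have "\<forall>\<^sub>F k in sequentially. indicator {\<omega>\<in>space M. \<epsilon> < \<bar>Y k \<omega> - Z \<omega>\<bar>} \<omega> = (0::real)"
        by eventually_elim (auto simp: indicator_def)
      then show ?case by (rule tendsto_eventually)
    qed
  qed (auto simp: indicator_def)
  then show "(\<lambda>k. prob {\<omega> \<in> space M. \<epsilon> < \<bar>Y k \<omega> - Z \<omega>\<bar>}) \<longlonglongrightarrow> 0"
    by simp
qed simp_all

section \<open>Sampling a path on uniform meshes\<close>

lemma simple_process_eq: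
  fixes p :: "nat \<Rightarrow> real"
  assumes "\<And>i k. i \<le> k \<Longrightarrow> k \<le> n \<Longrightarrow> p i \<le> p k" "j < n" "u \<in> {p j<..p (Suc j)}"
  shows "simple_process n p \<xi> u \<omega> = \<xi> j \<omega>"
proof -
  have "indicator {p i<..p (Suc i)} u = (if i = j then 1 else 0 :: real)" if "i < n" for i
    using assms(1)[of "Suc i" j] assms(1)[of "Suc j" i] assms(2,3) that
    by (cases i j rule: linorder_cases) auto
  then have "simple_process n p \<xi> u \<omega> = (\<Sum>i<n. if i = j then \<xi> j \<omega> else 0)"
    unfolding simple_process_def by (intro sum.cong) auto
  with assms(2) show ?thesis by simp
qed

lemma set_integrable_simple_process_diff_square:
  fixes h :: "real \<Rightarrow> real"
  assumes "continuous_on {a..b} h"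
  shows "set_integrable lborel {a..b} (\<lambda>u. (simple_process n p \<xi> u \<omega> - h u)\<^sup>2)"
proof -
  define h' where "h' u = indicator {a..b} u *\<^sub>R h u" for u
  have [measurable]: "h' \<in> borel_measurable borel"
    unfolding h'_def using assms by (intro borel_measurable_continuous_on_indicator) auto
  have "bounded (h ` {a..b})"
    using assms by (intro compact_imp_bounded compact_continuous_image) auto
  then obtain B where "\<forall>v\<in>h ` {a..b}. norm v \<le> B"
    unfolding bounded_iff by blast
  then have B: "\<bar>h u\<bar> \<le> B" if "u \<in> {a..b}" for u
    using that by simp
  have S: "\<bar>simple_process n p \<xi> u \<omega>\<bar> \<le> (\<Sum>i<n. \<bar>\<xi> i \<omega>\<bar>)" for u
    unfolding simple_process_def
    by (rule order_trans[OF sum_abs]) (auto intro!: sum_mono simp: indicator_def)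
  have [measurable]: "(\<lambda>u. simple_process n p \<xi> u \<omega>) \<in> borel_measurable borel"
    unfolding simple_process_def by measurable
  have "set_integrable lborel {a..b} (\<lambda>u. (simple_process n p \<xi> u \<omega> - h' u)\<^sup>2)"
    unfolding set_integrable_def
  proof (rule integrableI_bounded_set_indicator)
    show "AE u\<in>{a..b} in lborel. norm ((simple_process n p \<xi> u \<omega> - h' u)\<^sup>2) \<le> ((\<Sum>i<n. \<bar>\<xi> i \<omega>\<bar>) + B)\<^sup>2"
    proof (intro AE_I2 impI)
      fix u assume u: "u \<in> {a..b}"
      have "\<bar>simple_process n p \<xi> u \<omega> - h' u\<bar> \<le> \<bar>(\<Sum>i<n. \<bar>\<xi> i \<omega>\<bar>) + B\<bar>"
        using S[of u] B[OF u] u by (auto simp: h'_def)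
      then show "norm ((simple_process n p \<xi> u \<omega> - h' u)\<^sup>2) \<le> ((\<Sum>i<n. \<bar>\<xi> i \<omega>\<bar>) + B)\<^sup>2"
        by (simp add: abs_le_square_iff)
    qed
  qed (auto simp: emeasure_lborel_Icc_eq)
  then show ?thesis
    by (subst set_integrable_cong[OF refl refl]) (auto simp: h'_def)
qed

text \<open>There are \<open>Suc n\<close> cells, which keeps the denominator positive for every
  \<open>n\<close>; accordingly the last index is \<open>Suc n\<close>.\<close>

definition mesh :: "real \<Rightarrow> real \<Rightarrow> nat \<Rightarrow> nat \<Rightarrow> real" where
  "mesh a b n j = a + (b - a) * real j / real (Suc n)"

lemma mesh_0 [simp]: "mesh a b n 0 = a"
  by (simp add: mesh_def)

lemma mesh_last [simp]: "mesh a b n (Suc n) = b"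
  by (simp add: mesh_def del: of_nat_Suc)

lemma mesh_diff: "mesh a b n (Suc j) - mesh a b n j = (b - a) / real (Suc n)"
  unfolding mesh_def of_nat_Suc[of j] distrib_left add_divide_distrib by simp

lemma mesh_mono: "a \<le> b \<Longrightarrow> i \<le> j \<Longrightarrow> mesh a b n i \<le> mesh a b n j"
  by (simp add: mesh_def divide_right_mono mult_left_mono)

lemma mesh_bounds:
  assumes "a \<le> b" "j \<le> Suc n"
  shows "mesh a b n j \<in> {a..b}"
  using mesh_mono[OF assms(1), of 0 j n] mesh_mono[OF assms(1) assms(2), of n] by simp

lemma mesh_cover:
  assumes "a < b" "a < u" "u \<le> b"
  obtains j where "j \<le> n" "u \<in> {mesh a b n j<..mesh a b n (Suc j)}"
proof -
  define k where "k = (LEAST k. u \<le> mesh a b n k)"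
  have last: "u \<le> mesh a b n (Suc n)" using assms by simp
  have k: "u \<le> mesh a b n k" unfolding k_def using last by (rule LeastI)
  have "k \<le> Suc n" unfolding k_def using last by (rule Least_le)
  moreover have "k \<noteq> 0" using k assms by (auto intro: gr0I)
  ultimately obtain j where j: "k = Suc j" "j \<le> n" by (cases k) auto
  then have "\<not> u \<le> mesh a b n j"
    using not_less_Least[of j "\<lambda>k. u \<le> mesh a b n k"] by (simp add: k_def[symmetric])
  with k j that show thesis by auto
qed

lemma eventually_mesh_less: "\<epsilon> > 0 \<Longrightarrow> \<forall>\<^sub>F n in sequentially. (b - a :: real) / real (Suc n) < \<epsilon>"
  by (rule order_tendstoD(2)[OF LIMSEQ_Suc[OF lim_const_over_n]])

abbreviation grid_process ::
    "real \<Rightarrow> real \<Rightarrow> (real \<Rightarrow> 'a \<Rightarrow> real) \<Rightarrow> nat \<Rightarrow> real \<Rightarrow> 'a \<Rightarrow> real" where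
  "grid_process a b H n \<equiv> simple_process (Suc n) (mesh a b n) (\<lambda>j. H (mesh a b n j))"

text \<open>Uniform continuity of the path on the compact interval. The point \<open>a\<close> is
  left out: cells are open on the left, so the sampled process vanishes there.\<close>

lemma simple_process_grid_tendsto:
  assumes ab: "a < b" and h: "continuous_on {a..b} (\<lambda>u. H u \<omega>)" and "\<eta> > 0"
  shows "\<forall>\<^sub>F n in sequentially. \<forall>u\<in>{a<..b}.
    \<bar>grid_process a b H n u \<omega> - H u \<omega>\<bar> < \<eta>"
proof -
  have "uniformly_continuous_on {a..b} (\<lambda>u. H u \<omega>)"
    using h by (intro compact_uniformly_continuous) auto
  then obtain d where d: "d > 0" "\<And>u v. u \<in> {a..b} \<Longrightarrow> v \<in> {a..b} \<Longrightarrow> \<bar>u - v\<bar> < d \<Longrightarrow> \<bar>H u \<omega> - H v \<omega>\<bar> < \<eta>"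
    using \<open>\<eta> > 0\<close> unfolding uniformly_continuous_on_def dist_real_def by metis
  show ?thesis
    using eventually_mesh_less[OF d(1), of b a]
  proof eventually_elim
    case (elim n)
    show ?case
    proof
      fix u assume u: "u \<in> {a<..b}"
      obtain j where j: "j \<le> n" "u \<in> {mesh a b n j<..mesh a b n (Suc j)}"
        using mesh_cover[OF ab, of u n] u by auto
      have "grid_process a b H n u \<omega> = H (mesh a b n j) \<omega>"
        using j ab by (intro simple_process_eq) (auto intro: mesh_mono)
      moreover have "\<bar>mesh a b n j - u\<bar> < d"
        using mesh_diff[of a b n j] j elim by auto
      ultimately show "\<bar>grid_process a b H n u \<omega> - H u \<omega>\<bar> < \<eta>"
        using d(2)[of "mesh a b n j" u] mesh_bounds[of a b j n] ab j u by auto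
    qed
  qed
qed

lemma set_integral_le_const:
  fixes f :: "real \<Rightarrow> real"
  assumes "a \<le> b" "\<And>u. u \<in> {a<..b} \<Longrightarrow> f u \<le> c" "c \<ge> 0"
  shows "(LBINT u:{a..b}. f u) \<le> c * (b - a)"
proof (cases "set_integrable lborel {a..b} f")
  case True
  have "(LBINT u:{a..b}. f u) \<le> (LBINT u:{a..b}. c)"
  proof (rule set_integral_mono_AE[OF True])
    show "AE u\<in>{a..b} in lborel. f u \<le> c"
      using AE_lborel_singleton[of a] by eventually_elim (auto intro!: assms(2))
    have "integrable lborel (indicat_real {a..b})"
      by (intro integrable_real_indicator) (auto simp: emeasure_lborel_Icc_eq)
    then show "set_integrable lborel {a..b} (\<lambda>u. c)"
      by (simp add: set_integrable_def)
  qed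
  also have "\<dots> = c * (b - a)"
    using assms(1) by (simp add: set_lebesgue_integral_def mult.commute)
  finally show ?thesis .
next
  \<comment> \<open>A non-integrable function has integral 0 by convention, and the hypotheses make
    the right-hand side nonnegative.\<close>
  case False
  then have "(LBINT u:{a..b}. f u) = 0"
    unfolding set_lebesgue_integral_def set_integrable_def by (rule not_integrable_integral_eq)
  with assms show ?thesis by simp
qed

section \<open>Comparison of simple integrals and identification of the Ito integral\<close>

context brownian_setting begin

definition adapted_simple :: "real \<Rightarrow> real \<Rightarrow> nat \<Rightarrow> (nat \<Rightarrow> real) \<Rightarrow> (nat \<Rightarrow> 'a \<Rightarrow> real) \<Rightarrow> bool" where
  "adapted_simple a b n p \<xi> \<longleftrightarrow> p 0 = a \<and> p n = b \<and>
     (\<forall>i<n. p i \<le> p (Suc i) \<and> \<xi> i \<in> borel_measurable (F (p i)))"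

lemma adapted_simple_bounds:
  assumes "adapted_simple a b n p \<xi>" "i \<le> j" "j \<le> n"
  shows "a \<le> p i" "p i \<le> p j" "p j \<le> b"
proof -
  have mono: "p i \<le> p j" if "i \<le> j" "j \<le> n" for i j
    using that
  proof (induction rule: dec_induct)
    case (step k)
    then have "p k \<le> p (Suc k)" using assms(1) by (simp add: adapted_simple_def)
    with step show ?case by simp
  qed simp
  from mono[of i j] mono[of 0 i] mono[of j n] assms
  show "a \<le> p i" "p i \<le> p j" "p j \<le> b"
    by (auto simp: adapted_simple_def)
qed

text \<open>Adaptedness survives refinement: an interval of \<open>p\<close> that contains
  \<open>q (Suc i)\<close> starts at a grid point strictly before \<open>q (Suc i)\<close>, hence at
  or before \<open>q i\<close>, where its coefficient is known.\<close>

lemma adapted_simple_refine_measurable: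
  assumes S: "adapted_simple a b n p \<xi>" and q: "\<And>i j. i < j \<Longrightarrow> j \<le> m \<Longrightarrow> q i < q j"
    and p: "p ` {..n} \<subseteq> q ` {..m}" and i: "i < m"
  shows "simple_process n p \<xi> (q (Suc i)) \<in> borel_measurable (F (q i))"
proof -
  have "(\<lambda>\<omega>. \<xi> k \<omega> * indicator {p k<..p (Suc k)} (q (Suc i))) \<in> borel_measurable (F (q i))" if k: "k < n" for k
  proof (cases "p k < q (Suc i)")
    case True
    have "p k \<in> q ` {..m}" using p k by (simp add: image_subset_iff)
    then obtain l where "p k = q l" "l \<in> {..m}" by (rule imageE)
    then have l: "l \<le> m" "p k = q l" by simp_all
    have "\<not> Suc i \<le> l"
      using q[of "Suc i" l] True l by (cases "l = Suc i") auto
    then have "l \<le> i" by simp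
    then have "p k \<le> q i" using q[of l i] l i by (cases "l = i") auto
    moreover have "\<xi> k \<in> borel_measurable (F (p k))" using S k by (simp add: adapted_simple_def)
    ultimately have [measurable]: "\<xi> k \<in> borel_measurable (F (q i))"
      by (rule measurable_F_mono)
    show ?thesis by measurable
  qed simp
  then show ?thesis
    unfolding simple_process_def by (intro borel_measurable_sum) auto
qed

text \<open>On a common refinement the difference of the two integrals is one discrete transform,
  and \<open>D\<close> is its sum of squared coefficients weighted by the cell lengths. The tail
  bound for transforms then compares the integrals through \<open>D\<close> alone, without any
  moment assumption on the coefficients.\<close>

lemma
  assumes ab: "0 \<le> a" "a < b" and S: "adapted_simple a b n p \<xi>" and S': "adapted_simple a b n' p' \<xi>'"
  defines "D \<equiv> \<lambda>\<omega>. LBINT u:{a..b}. (simple_process n p \<xi> u \<omega> - simple_process n' p' \<xi>' u \<omega>)\<^sup>2"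
  shows simple_process_diff_measurable: "D \<in> borel_measurable M"
    and prob_simple_integral_diff_le: "\<epsilon> > 0 \<Longrightarrow> \<delta> > 0 \<Longrightarrow>
      prob {\<omega>\<in>space M. \<epsilon> < \<bar>simple_integral W n p \<xi> \<omega> - simple_integral W n' p' \<xi>' \<omega>\<bar>}
        \<le> prob {\<omega>\<in>space M. \<delta> < D \<omega>} + \<delta> / \<epsilon>\<^sup>2"
proof -
  define P where "P = p ` {..n} \<union> p' ` {..n'}"
  have "a \<in> P" "b \<in> P"
    using S by (auto simp: P_def adapted_simple_def)
  moreover have "P \<subseteq> {a..b}"
    using adapted_simple_bounds[OF S order_refl] adapted_simple_bounds[OF S' order_refl] by (auto simp: P_def)
  moreover have "finite P" by (simp add: P_def)
  ultimately have "\<exists>m q. (\<forall>i j. i < j \<longrightarrow> j \<le> m \<longrightarrow> q i < q j) \<and> q 0 = a \<and> q m = b \<and> P = q ` {..m::nat}"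
    by (intro strict_grid_exists)
  then obtain m q where Q: "(\<forall>i j. i < j \<longrightarrow> j \<le> m \<longrightarrow> q i < q j) \<and> q 0 = a \<and> q m = b \<and> P = q ` {..m::nat}"
    by (elim exE) (rule that)
  then have q: "\<And>i j. i < j \<Longrightarrow> j \<le> m \<Longrightarrow> q i < q j" "q 0 = a" "q m = b" "P = q ` {..m}"
    by simp_all
  have pq: "p ` {..n} \<subseteq> q ` {..m}" "p' ` {..n'} \<subseteq> q ` {..m}"
    using q(4) by (auto simp: P_def)
  define c where "c i \<omega> = simple_process n p \<xi> (q (Suc i)) \<omega> - simple_process n' p' \<xi>' (q (Suc i)) \<omega>" for i \<omega>
  have mono: "\<And>k. k < n \<Longrightarrow> p k \<le> p (Suc k)" "\<And>k. k < n' \<Longrightarrow> p' k \<le> p' (Suc k)"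
    using S S' by (auto simp: adapted_simple_def)
  have c: "c i \<in> borel_measurable (F (q i))" if "i < m" for i
    unfolding c_def using adapted_simple_refine_measurable[OF S q(1) pq(1) that]
      adapted_simple_refine_measurable[OF S' q(1) pq(2) that] by measurable
  have D_eq: "D \<omega> = (\<Sum>i<m. (c i \<omega>)\<^sup>2 * (q (Suc i) - q i))" for \<omega>
  proof -
    let ?d = "\<lambda>u. (simple_process n p \<xi> u \<omega> - simple_process n' p' \<xi>' u \<omega>)\<^sup>2"
    have q_le: "q i \<le> q (Suc i)" if "i < m" for i using q(1)[of i "Suc i"] that by simp
    have "indicator {a..b} u *\<^sub>R ?d u = (\<Sum>i<m. (c i \<omega>)\<^sup>2 * indicator {q i<..q (Suc i)} u)" for u
    proof -
      have "(\<Sum>i<m. (c i \<omega>)\<^sup>2 * indicator {q i<..q (Suc i)} u) = (\<Sum>i<m. ?d u * indicator {q i<..q (Suc i)} u)"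
      proof (intro sum.cong refl)
        fix i assume "i \<in> {..<m}"
        then have i: "i < m" by simp
        show "(c i \<omega>)\<^sup>2 * indicator {q i<..q (Suc i)} u = ?d u * indicator {q i<..q (Suc i)} u"
          using simple_process_refine[OF q(1) pq(1) mono(1) i, of u \<xi> \<omega>]
            simple_process_refine[OF q(1) pq(2) mono(2) i, of u \<xi>' \<omega>]
          by (auto simp: c_def indicator_def)
      qed
      also have "\<dots> = ?d u * indicator {a<..b} u"
        using sum_indicator_consecutive[of m q u] q_le q(2,3) unfolding sum_distrib_left[symmetric] by simp
      also have "\<dots> = indicator {a..b} u *\<^sub>R ?d u"
      \<comment> \<open>Both processes vanish at \<open>a\<close>, which reconciles the closed
        interval of integration with the left-open cells.\<close>
      proof (cases "u = a")
        case True
        have "simple_process n p \<xi> a \<omega> = 0" "simple_process n' p' \<xi>' a \<omega> = 0"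
          using adapted_simple_bounds(1)[OF S order_refl less_imp_le, THEN leD]
            adapted_simple_bounds(1)[OF S' order_refl less_imp_le, THEN leD]
          unfolding simple_process_def by (auto intro!: sum.neutral simp: indicator_def)
        with True show ?thesis by simp
      qed (auto simp: indicator_def)
      finally show ?thesis ..
    qed
    then have "D \<omega> = (\<integral>u. (\<Sum>i<m. (c i \<omega>)\<^sup>2 * indicator {q i<..q (Suc i)} u) \<partial>lborel)"
      unfolding D_def set_lebesgue_integral_def by simp
    also have "\<dots> = (\<Sum>i<m. \<integral>u. (c i \<omega>)\<^sup>2 * indicator {q i<..q (Suc i)} u \<partial>lborel)"
      by (intro Bochner_Integration.integral_sum integrable_mult_right integrable_real_indicator)
        (auto simp: q_le)
    also have "\<dots> = (\<Sum>i<m. (c i \<omega>)\<^sup>2 * (q (Suc i) - q i))"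
      using q_le by (intro sum.cong) auto
    finally show ?thesis .
  qed
  show "D \<in> borel_measurable M"
    unfolding D_eq using measurable_F_M[OF c] by (intro borel_measurable_sum borel_measurable_times borel_measurable_power) auto
  assume pos: "\<epsilon> > 0" "\<delta> > 0"
  have "simple_integral W n p \<xi> \<omega> = (\<Sum>i<m. simple_process n p \<xi> (q (Suc i)) \<omega> * (incr q i \<omega>))" for \<omega>
    by (rule simple_integral_refine) (use q(1) pq(1) mono(1) in auto)
  moreover have "simple_integral W n' p' \<xi>' \<omega> = (\<Sum>i<m. simple_process n' p' \<xi>' (q (Suc i)) \<omega> * (incr q i \<omega>))" for \<omega>
    by (rule simple_integral_refine) (use q(1) pq(2) mono(2) in auto)
  ultimately have "simple_integral W n p \<xi> \<omega> - simple_integral W n' p' \<xi>' \<omega>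
      = (\<Sum>i<m. c i \<omega> * (incr q i \<omega>))" for \<omega>
    unfolding c_def left_diff_distrib sum_subtractf by simp
  moreover have "prob {\<omega>\<in>space M. \<epsilon> < \<bar>\<Sum>i<m. c i \<omega> * (incr q i \<omega>)\<bar>}
     \<le> prob {\<omega>\<in>space M. \<delta> < D \<omega>} + \<delta> / \<epsilon>\<^sup>2"
    unfolding D_eq using ab q c pos by (intro prob_transform_le) auto
  ultimately show "prob {\<omega>\<in>space M. \<epsilon> < \<bar>simple_integral W n p \<xi> \<omega> - simple_integral W n' p' \<xi>' \<omega>\<bar>}
        \<le> prob {\<omega>\<in>space M. \<delta> < D \<omega>} + \<delta> / \<epsilon>\<^sup>2" by simp
qed

end

lemma converges_in_probD:
  "converges_in_prob M Y Z \<Longrightarrow> \<epsilon> > 0 \<Longrightarrow>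
    (\<lambda>k. measure M {\<omega> \<in> space M. \<epsilon> < \<bar>Y k \<omega> - Z \<omega>\<bar>}) \<longlonglongrightarrow> 0"
  by (simp add: converges_in_prob_def)

context brownian_setting begin

text \<open>Progressive measurability at the final time \<open>b\<close> gives joint measurability
  of \<open>H\<close> in time and outcome, so that integrating out time leaves an
  \<open>F b\<close>-measurable function.\<close>

lemma riemann_error_measurable:
  assumes ab: "0 \<le> a" "a < b" and H: "progressively_measurable F a b H"
    and S: "adapted_simple a b n p \<xi>"
  shows "(\<lambda>\<omega>. LBINT u:{a..b}. (simple_process n p \<xi> u \<omega> - H u \<omega>)\<^sup>2) \<in> borel_measurable M"
proof -
  let ?R = "restrict_space lborel {a..b} :: real measure"
  have b: "b \<in> {a..b}" using ab by simp
  interpret R: sigma_finite_measure ?R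
    by (rule sigma_finite_measure_restrict_space[OF sigma_finite_lborel]) simp
  have sets_R: "sets ?R = sets (restrict_space borel {a..b})"
    by (intro sets_restrict_space_cong) simp
  have "(\<lambda>(u, \<omega>). H u \<omega>) \<in> borel_measurable (restrict_space borel {a..b} \<Otimes>\<^sub>M F b)"
    using H b unfolding progressively_measurable_def by blast
  then have H1: "(\<lambda>(u, \<omega>). H u \<omega>) \<in> borel_measurable (?R \<Otimes>\<^sub>M F b)"
    using measurable_cong_sets[OF sets_pair_measure_cong[OF sets_R refl] refl] by blast
  have H2 [measurable]: "(\<lambda>(\<omega>, u). H u \<omega>) \<in> borel_measurable (F b \<Otimes>\<^sub>M ?R)"
    using measurable_compose[OF measurable_pair_swap' H1] by (simp add: split_beta')
  have [measurable]: "\<xi> i \<in> borel_measurable (F b)" if "i < n" for i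
    using S adapted_simple_bounds(2,3)[OF S, of i n] that
    by (auto simp: adapted_simple_def intro: measurable_F_mono)
  have id [measurable]: "(\<lambda>u. u) \<in> borel_measurable ?R"
    by (intro measurable_restrict_space1) simp
  have [measurable]: "(\<lambda>(\<omega>, u). simple_process n p \<xi> u \<omega>) \<in> borel_measurable (F b \<Otimes>\<^sub>M ?R)"
    unfolding simple_process_def split_beta'
  proof (intro borel_measurable_sum borel_measurable_times)
    fix i assume "i \<in> {..<n}"
    then have [measurable]: "\<xi> i \<in> borel_measurable (F b)" by simp
    show "(\<lambda>x. \<xi> i (fst x)) \<in> borel_measurable (F b \<Otimes>\<^sub>M ?R)" by measurable
    have "(\<lambda>u. indicator {p i<..p (Suc i)} u :: real) \<in> borel_measurable ?R"
      by (intro measurable_restrict_space1) simp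
    from measurable_compose[OF measurable_snd this]
    show "(\<lambda>x. indicator {p i<..p (Suc i)} (snd x) :: real) \<in> borel_measurable (F b \<Otimes>\<^sub>M ?R)" .
  qed
  have "(\<lambda>(\<omega>, u). (simple_process n p \<xi> u \<omega> - H u \<omega>)\<^sup>2) \<in> borel_measurable (F b \<Otimes>\<^sub>M ?R)"
    by measurable
  then have "(\<lambda>\<omega>. \<integral>u. (simple_process n p \<xi> u \<omega> - H u \<omega>)\<^sup>2 \<partial>?R) \<in> borel_measurable (F b)"
    by (rule R.borel_measurable_lebesgue_integral)
  then have "(\<lambda>\<omega>. \<integral>u. (simple_process n p \<xi> u \<omega> - H u \<omega>)\<^sup>2 \<partial>?R) \<in> borel_measurable M"
    by (rule measurable_F_M)
  moreover have "(\<integral>u. (simple_process n p \<xi> u \<omega> - H u \<omega>)\<^sup>2 \<partial>?R)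
      = (LBINT u:{a..b}. (simple_process n p \<xi> u \<omega> - H u \<omega>)\<^sup>2)" for \<omega>
    unfolding set_lebesgue_integral_def by (rule integral_restrict_space) simp
  ultimately show ?thesis by simp
qed

lemma adapted_simple_mesh:
  assumes "a < b" "\<And>u. u \<in> {a..b} \<Longrightarrow> H u \<in> borel_measurable (F u)"
  shows "adapted_simple a b (Suc n) (mesh a b n) (\<lambda>j. H (mesh a b n j))"
  unfolding adapted_simple_def
proof (intro conjI allI impI)
  fix i assume "i < Suc n"
  then show "H (mesh a b n i) \<in> borel_measurable (F (mesh a b n i))"
    using assms mesh_bounds[of a b i n] by auto
qed (use assms in \<open>auto intro: mesh_mono\<close>)

text \<open>The definition of the integral only provides some approximating simple processes.
  Continuity of the paths makes the sampled processes approximate \<open>H\<close> as well, so the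
  two families are close to each other and their integrals have the same limit.\<close>

lemma riemann_sums_converge_to_ito_integral:
  assumes ab: "0 \<le> a" "a < b" and ito: "has_ito_integral M F W a b H I"
    and cont: "\<And>\<omega>. \<omega> \<in> space M \<Longrightarrow> continuous_on {a..b} (\<lambda>u. H u \<omega>)"
    and adapted: "\<And>u. u \<in> {a..b} \<Longrightarrow> H u \<in> borel_measurable (F u)"
  shows "converges_in_prob M
    (\<lambda>n. simple_integral W (Suc n) (mesh a b n) (\<lambda>j. H (mesh a b n j))) I"
proof -
  define R where "R n = simple_integral W (Suc n) (mesh a b n) (\<lambda>j. H (mesh a b n j))" for n
  define RH where "RH n \<omega> = (LBINT u:{a..b}. (grid_process a b H n u \<omega> - H u \<omega>)\<^sup>2)" for n \<omega>
  have simple_R: "adapted_simple a b (Suc n) (mesh a b n) (\<lambda>j. H (mesh a b n j))" for n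
    using ab adapted by (intro adapted_simple_mesh) auto
  from ito obtain m p \<xi> where
    prog: "progressively_measurable F a b H" and
    simple: "\<And>k. simple_integrand F a b (m k) (p k) (\<xi> k)" and
    approx: "converges_in_prob M
          (\<lambda>k \<omega>. LBINT u:{a..b}. (simple_process (m k) (p k) (\<xi> k) u \<omega> - H u \<omega>)\<^sup>2) (\<lambda>_. 0)" and
    J_lim: "converges_in_prob M (\<lambda>k. simple_integral W (m k) (p k) (\<xi> k)) I"
    unfolding has_ito_integral_def by blast
  define J where "J k = simple_integral W (m k) (p k) (\<xi> k)" for k
  define JH where "JH k \<omega> = (LBINT u:{a..b}. (simple_process (m k) (p k) (\<xi> k) u \<omega> - H u \<omega>)\<^sup>2)" for k \<omega>
  have simple_J: "adapted_simple a b (m k) (p k) (\<xi> k)" for k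
    using simple[of k] by (auto simp: simple_integrand_def adapted_simple_def)
  have [measurable]: "RH n \<in> borel_measurable M" "JH n \<in> borel_measurable M" for n
    unfolding RH_def JH_def
    using riemann_error_measurable[OF ab prog simple_R] riemann_error_measurable[OF ab prog simple_J] by auto
  have [measurable]: "J k \<in> borel_measurable M" "I \<in> borel_measurable M" for k
    using J_lim by (auto simp: converges_in_prob_def J_def)
  have R_meas [measurable]: "R n \<in> borel_measurable M" for n
    unfolding R_def simple_integral_def
  proof (intro borel_measurable_sum borel_measurable_times borel_measurable_diff)
    fix j assume "j \<in> {..<Suc n}"
    then have "mesh a b n j \<in> {a..b}" "mesh a b n (Suc j) \<in> {a..b}"
      using ab by (intro mesh_bounds; simp)+
    then show "H (mesh a b n j) \<in> borel_measurable M" "W (mesh a b n j) \<in> borel_measurable M"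
      "W (mesh a b n (Suc j)) \<in> borel_measurable M"
      using ab measurable_F_M[OF adapted] by auto
  qed
  have RH_lim: "converges_in_prob M RH (\<lambda>_. 0)"
  proof (rule converges_in_prob_if_AE)
    show "AE \<omega> in M. (\<lambda>n. RH n \<omega>) \<longlonglongrightarrow> 0"
    proof (rule AE_I2)
      fix \<omega> assume \<omega>: "\<omega> \<in> space M"
      show "(\<lambda>n. RH n \<omega>) \<longlonglongrightarrow> 0"
      proof (rule LIMSEQ_I)
        fix e :: real assume "e > 0"
        define \<eta> where "\<eta> = sqrt (e / (2 * (b - a)))"
        have \<eta>: "\<eta> > 0" "\<eta>\<^sup>2 * (b - a) < e"
          using \<open>e > 0\<close> ab by (auto simp: \<eta>_def field_simps)
        have "\<forall>\<^sub>F n in sequentially. norm (RH n \<omega> - 0) < e"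
          using simple_process_grid_tendsto[of a b H \<omega> \<eta>, OF ab(2) cont[OF \<omega>] \<eta>(1)]
        proof eventually_elim
          case (elim n)
          have "RH n \<omega> \<le> \<eta>\<^sup>2 * (b - a)"
            unfolding RH_def
          proof (rule set_integral_le_const)
            fix u assume "u \<in> {a<..b}"
            then have "\<bar>grid_process a b H n u \<omega> - H u \<omega>\<bar> \<le> \<bar>\<eta>\<bar>"
              using elim \<eta> by force
            then show "(grid_process a b H n u \<omega> - H u \<omega>)\<^sup>2 \<le> \<eta>\<^sup>2"
              by (simp add: abs_le_square_iff)
          qed (use ab in auto)
          moreover have "0 \<le> RH n \<omega>"
            unfolding RH_def set_lebesgue_integral_def by (intro integral_nonneg_AE AE_I2) auto
          ultimately show ?case using \<eta> by simp
        qed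
        then show "\<exists>no. \<forall>n\<ge>no. norm (RH n \<omega> - 0) < e"
          by (simp add: eventually_sequentially)
      qed
    qed
  qed simp_all
  \<comment> \<open>The mesh \<open>n\<close> is fixed and the index \<open>k\<close> of the given
    approximation goes to infinity. The quarter comes from \<open>D \<le> 2 * RH + 2 * JH\<close>:
    if \<open>D\<close> exceeds \<open>\<delta>\<close>, one of the two errors exceeds
    \<open>\<delta> / 4\<close>.\<close>
  have bound: "prob {\<omega>\<in>space M. \<epsilon> < \<bar>R n \<omega> - I \<omega>\<bar>}
      \<le> prob {\<omega>\<in>space M. \<delta> / 4 < \<bar>RH n \<omega>\<bar>} + \<delta> / (\<epsilon> / 2)\<^sup>2"
    if pos: "\<epsilon> > 0" "\<delta> > 0" for \<epsilon> \<delta> n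
  proof (rule LIMSEQ_le_const)
    let ?f = "\<lambda>k. prob {\<omega>\<in>space M. \<epsilon> / 2 < \<bar>J k \<omega> - I \<omega>\<bar>} + (prob {\<omega>\<in>space M. \<delta> / 4 < \<bar>JH k \<omega> - 0\<bar>}
      + (prob {\<omega>\<in>space M. \<delta> / 4 < \<bar>RH n \<omega>\<bar>} + \<delta> / (\<epsilon> / 2)\<^sup>2))"
    have "?f \<longlonglongrightarrow> 0 + (0 + (prob {\<omega>\<in>space M. \<delta> / 4 < \<bar>RH n \<omega>\<bar>} + \<delta> / (\<epsilon> / 2)\<^sup>2))"
      using converges_in_probD[OF J_lim, of "\<epsilon> / 2"] converges_in_probD[OF approx, of "\<delta> / 4"] pos
      unfolding J_def[symmetric] JH_def[symmetric]
      by (intro tendsto_add tendsto_const) simp_all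
    then show "?f \<longlonglongrightarrow> prob {\<omega>\<in>space M. \<delta> / 4 < \<bar>RH n \<omega>\<bar>} + \<delta> / (\<epsilon> / 2)\<^sup>2" by simp
    show "\<exists>N. \<forall>k\<ge>N. prob {\<omega>\<in>space M. \<epsilon> < \<bar>R n \<omega> - I \<omega>\<bar>} \<le> ?f k"
    proof (intro exI[of _ 0] allI impI)
      fix k
      define D where "D \<omega> = (LBINT u:{a..b}. (grid_process a b H n u \<omega> - simple_process (m k) (p k) (\<xi> k) u \<omega>)\<^sup>2)" for \<omega>
      have [measurable]: "D \<in> borel_measurable M"
        unfolding D_def by (rule simple_process_diff_measurable[OF ab simple_R simple_J])
      have D_le: "D \<omega> \<le> 2 * RH n \<omega> + 2 * JH k \<omega>" if \<omega>: "\<omega> \<in> space M" for \<omega>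
      proof -
        let ?R = "\<lambda>u. grid_process a b H n u \<omega>" and ?J = "\<lambda>u. simple_process (m k) (p k) (\<xi> k) u \<omega>"
        let ?d = "\<lambda>u. 2 * (?R u - H u \<omega>)\<^sup>2 + 2 * (?J u - H u \<omega>)\<^sup>2"
        note int = set_integrable_simple_process_diff_square[OF cont[OF \<omega>]]
        have "D \<omega> \<le> (LBINT u:{a..b}. ?d u)"
          unfolding D_def set_lebesgue_integral_def
        proof (rule integral_mono')
          have "set_integrable lborel {a..b} ?d"
            using int by (intro set_integral_add set_integrable_mult_right) auto
          then show "integrable lborel (\<lambda>u. indicator {a..b} u *\<^sub>R ?d u)"
            unfolding set_integrable_def .
          have "(v - w)\<^sup>2 \<le> 2 * (v - h)\<^sup>2 + 2 * (w - h)\<^sup>2" for v w h :: real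
            using zero_le_power2[of "v + w - 2 * h"] by (simp add: power2_eq_square algebra_simps)
          then show "indicator {a..b} u *\<^sub>R (?R u - ?J u)\<^sup>2
            \<le> indicator {a..b} u *\<^sub>R ?d u" for u
            by (intro scaleR_left_mono) auto
        qed (auto intro!: mult_nonneg_nonneg)
        also have "\<dots> = 2 * RH n \<omega> + 2 * JH k \<omega>"
          unfolding RH_def JH_def using int by (subst set_integral_add) auto
        finally show ?thesis .
      qed
      have "prob {\<omega>\<in>space M. \<epsilon> < \<bar>R n \<omega> - I \<omega>\<bar>}
        \<le> prob {\<omega>\<in>space M. \<epsilon> / 2 < \<bar>J k \<omega> - I \<omega>\<bar>} + prob {\<omega>\<in>space M. \<epsilon> / 2 < \<bar>R n \<omega> - J k \<omega>\<bar>}"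
        using prob_triangle[of "R n" "J k" I \<epsilon>] by simp
      also have "prob {\<omega>\<in>space M. \<epsilon> / 2 < \<bar>R n \<omega> - J k \<omega>\<bar>} \<le> prob {\<omega>\<in>space M. \<delta> < D \<omega>} + \<delta> / (\<epsilon> / 2)\<^sup>2"
        using prob_simple_integral_diff_le[OF ab simple_R[of n] simple_J[of k], of "\<epsilon> / 2" \<delta>] pos
        unfolding R_def J_def D_def by simp
      also have "prob {\<omega>\<in>space M. \<delta> < D \<omega>} \<le> prob {\<omega>\<in>space M. \<delta> / 4 < \<bar>JH k \<omega> - 0\<bar>} + prob {\<omega>\<in>space M. \<delta> / 4 < \<bar>RH n \<omega>\<bar>}"
      proof (rule prob_Un_bound)
        show "{\<omega>\<in>space M. \<delta> < D \<omega>} \<subseteq> {\<omega>\<in>space M. \<delta> / 4 < \<bar>JH k \<omega> - 0\<bar>} \<union> {\<omega>\<in>space M. \<delta> / 4 < \<bar>RH n \<omega>\<bar>}"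
        proof safe
          fix \<omega> assume "\<omega> \<in> space M" "\<delta> < D \<omega>" "\<not> \<delta> / 4 < \<bar>RH n \<omega>\<bar>"
          with D_le[of \<omega>] show "\<delta> / 4 < \<bar>JH k \<omega> - 0\<bar>" by linarith
        qed
      qed simp_all
      finally show "prob {\<omega>\<in>space M. \<epsilon> < \<bar>R n \<omega> - I \<omega>\<bar>} \<le> ?f k" by simp
    qed
  qed
  show ?thesis
    unfolding converges_in_prob_def R_def[symmetric]
  proof (intro conjI allI impI)
    fix \<epsilon> :: real assume \<epsilon>: "\<epsilon> > 0"
    show "(\<lambda>n. prob {\<omega> \<in> space M. \<epsilon> < \<bar>R n \<omega> - I \<omega>\<bar>}) \<longlonglongrightarrow> 0"
    proof (rule LIMSEQ_I)
      fix e :: real assume e: "e > 0"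
      \<comment> \<open>Chosen so that the term \<open>\<delta> / (\<epsilon> / 2)\<^sup>2\<close>
        of \<open>bound\<close> uses half of the tolerance \<open>e\<close>.\<close>
      define \<delta> where "\<delta> = e / 2 * (\<epsilon> / 2)\<^sup>2"
      have \<delta>: "\<delta> > 0" "\<delta> / (\<epsilon> / 2)\<^sup>2 = e / 2" using e \<epsilon> by (auto simp: \<delta>_def)
      have "(\<lambda>n. prob {\<omega>\<in>space M. \<delta> / 4 < \<bar>RH n \<omega>\<bar>}) \<longlonglongrightarrow> 0"
        using converges_in_probD[OF RH_lim, of "\<delta> / 4"] \<delta> by simp
      from order_tendstoD(2)[OF this, of "e / 2"] e
      have "\<forall>\<^sub>F n in sequentially. prob {\<omega>\<in>space M. \<delta> / 4 < \<bar>RH n \<omega>\<bar>} < e / 2" by simp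
      then have "\<forall>\<^sub>F n in sequentially. norm (prob {\<omega> \<in> space M. \<epsilon> < \<bar>R n \<omega> - I \<omega>\<bar>} - 0) < e"
      proof eventually_elim
        case (elim n)
        with bound[OF \<epsilon> \<delta>(1), of n] \<delta>(2) show ?case by simp
      qed
      then show "\<exists>no. \<forall>n\<ge>no. norm (prob {\<omega> \<in> space M. \<epsilon> < \<bar>R n \<omega> - I \<omega>\<bar>} - 0) < e"
        by (simp add: eventually_sequentially)
    qed
  qed simp_all
qed

end

section \<open>Uniqueness for the linear equation\<close>

text \<open>Serves the one-step moments of the Euler defect: \<open>Suc n\<close> steps of length
  \<open>L / Suc n\<close>, each with an error of smaller order than the step, add up to a vanishing
  total.\<close>

lemma tendsto_Suc_times_of_deriv_zero:
  fixes f :: "real \<Rightarrow> real"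
  assumes "(f has_real_derivative 0) (at 0)" "f 0 = 0" "L > 0"
  shows "(\<lambda>n. real (Suc n) * f (L / real (Suc n))) \<longlonglongrightarrow> 0"
proof -
  have lim: "((\<lambda>h. f h / h) \<longlongrightarrow> 0) (at 0)"
    using assms(1,2) by (simp add: DERIV_def)
  have "filterlim (\<lambda>n. L / real (Suc n)) (at 0) sequentially"
    unfolding filterlim_at using assms(3) LIMSEQ_Suc[OF lim_const_over_n[of L]] by auto
  from tendsto_mult[OF tendsto_const[of L] filterlim_compose[OF lim this]]
  moreover have "L * (f (L / real (Suc n)) / (L / real (Suc n))) = real (Suc n) * f (L / real (Suc n))" for n
    using assms(3) by (simp del: of_nat_Suc)
  ultimately show ?thesis by simp
qed

text \<open>The sum is the exact integral of the sampled step function, whose uniform distance to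
  \<open>h\<close> away from the left endpoint tends to 0.\<close>

lemma lebesgue_riemann_sums_converge:
  fixes h :: "real \<Rightarrow> real"
  assumes ab: "a < b" and h: "continuous_on {a..b} h"
  shows "(\<lambda>n. \<Sum>j<Suc n. h (mesh a b n j) * ((b - a) / real (Suc n))) \<longlonglongrightarrow> (LBINT u:{a..b}. h u)"
proof (rule LIMSEQ_I)
  fix e :: real assume e: "e > 0"
  define \<eta> where "\<eta> = e / (2 * (b - a))"
  have \<eta>: "\<eta> > 0" "\<eta> * (b - a) < e" using e ab by (auto simp: \<eta>_def field_simps)
  define S where "S n u = simple_process (Suc n) (mesh a b n) (\<lambda>j _. h (mesh a b n j)) u ()" for n u
  have int_h: "set_integrable lborel {a..b} h"
    using h by (intro borel_integrable_atLeastAtMost') 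
  have int_ind: "set_integrable lborel {a..b} (\<lambda>u. c * indicator {mesh a b n j<..mesh a b n (Suc j)} u :: real)" for c n j
    unfolding set_integrable_def
    by (rule integrableI_bounded_set_indicator[where B="\<bar>c\<bar>"]) (auto simp: emeasure_lborel_Icc_eq indicator_def)
  have S: "set_integrable lborel {a..b} (S n)"
    "(LBINT u:{a..b}. S n u) = (\<Sum>j<Suc n. h (mesh a b n j) * ((b - a) / real (Suc n)))" for n
  proof -
    show "set_integrable lborel {a..b} (S n)"
      using int_ind unfolding S_def simple_process_def set_integrable_def scaleR_sum_right
      by (intro Bochner_Integration.integrable_sum) auto
    have "(LBINT u:{a..b}. S n u)
      = (\<Sum>j<Suc n. LBINT u:{a..b}. h (mesh a b n j) * indicator {mesh a b n j<..mesh a b n (Suc j)} u)"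
      using int_ind unfolding S_def simple_process_def set_integrable_def set_lebesgue_integral_def scaleR_sum_right
      by (intro Bochner_Integration.integral_sum) auto
    also have "\<dots> = (\<Sum>j<Suc n. h (mesh a b n j) * ((b - a) / real (Suc n)))"
    proof (intro sum.cong refl)
      fix j assume "j \<in> {..<Suc n}"
      then have sub: "{mesh a b n j<..mesh a b n (Suc j)} \<subseteq> {a..b}"
        using mesh_bounds[of a b j n] mesh_bounds[of a b "Suc j" n] ab by auto
      have "(LBINT u:{a..b}. h (mesh a b n j) * indicator {mesh a b n j<..mesh a b n (Suc j)} u)
        = (\<integral>u. h (mesh a b n j) * indicator {mesh a b n j<..mesh a b n (Suc j)} u \<partial>lborel)"
        unfolding set_lebesgue_integral_def using sub
        by (intro Bochner_Integration.integral_cong) (auto simp: indicator_def)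
      also have "\<dots> = h (mesh a b n j) * (mesh a b n (Suc j) - mesh a b n j)"
        using mesh_mono[of a b j "Suc j" n] ab by simp
      finally show "(LBINT u:{a..b}. h (mesh a b n j) * indicator {mesh a b n j<..mesh a b n (Suc j)} u)
        = h (mesh a b n j) * ((b - a) / real (Suc n))"
        unfolding mesh_diff .
    qed
    finally show "(LBINT u:{a..b}. S n u) = (\<Sum>j<Suc n. h (mesh a b n j) * ((b - a) / real (Suc n)))" .
  qed
  have "\<forall>\<^sub>F n in sequentially. \<forall>u\<in>{a<..b}. \<bar>S n u - h u\<bar> < \<eta>"
    unfolding S_def using simple_process_grid_tendsto[of a b "\<lambda>u _. h u" "()" \<eta>] ab h \<eta> by simp
  then have "\<forall>\<^sub>F n in sequentially. norm ((\<Sum>j<Suc n. h (mesh a b n j) * ((b - a) / real (Suc n))) - (LBINT u:{a..b}. h u)) < e"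
  proof eventually_elim
    case (elim n)
    have "\<bar>(LBINT u:{a..b}. S n u) - (LBINT u:{a..b}. h u)\<bar> = \<bar>LBINT u:{a..b}. S n u - h u\<bar>"
      using S(1)[of n] int_h by simp
    also have "\<dots> \<le> (LBINT u:{a..b}. \<bar>S n u - h u\<bar>)"
      using set_integral_norm_bound[of lborel "{a..b}" "\<lambda>u. S n u - h u"] S(1)[of n] int_h by simp
    also have "\<dots> \<le> \<eta> * (b - a)"
      using elim ab \<eta> by (intro set_integral_le_const) (auto intro: less_imp_le)
    finally show ?case using \<eta> S(2)[of n] by simp
  qed
  then show "\<exists>no. \<forall>n\<ge>no. norm ((\<Sum>j<Suc n. h (mesh a b n j) * ((b - a) / real (Suc n))) - (LBINT u:{a..b}. h u)) < e"
    by (simp add: eventually_sequentially)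
qed

text \<open>A discrete Gronwall weight. The sum is geometric with ratio
  \<open>exp (l * \<Delta>)\<close>, and \<open>exp (l * \<Delta>) - 1 \<ge> l * \<Delta>\<close>
  gives a bound uniform in the mesh. The factor \<open>1 / l\<close> is what turns one step of the
  recursion below into a contraction.\<close>

lemma geometric_riemann_sum_le:
  fixes l :: real
  assumes "l > 0" "a \<le> b"
  shows "(b - a) / real (Suc n) * (\<Sum>j<Suc n. exp (l * (mesh a b n j - a))) \<le> exp (l * (b - a)) / l"
proof (cases "a = b")
  case True
  then show ?thesis using assms by simp
next
  case False
  define \<Delta> where "\<Delta> = (b - a) / real (Suc n)"
  have \<Delta>: "\<Delta> > 0" using False assms by (simp add: \<Delta>_def)
  have "exp (l * (mesh a b n j - a)) = exp (l * \<Delta>) ^ j" for j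
    by (simp add: mesh_def \<Delta>_def exp_of_nat_mult[symmetric] mult_ac)
  then have "(\<Sum>j<Suc n. exp (l * (mesh a b n j - a))) = (\<Sum>j<Suc n. exp (l * \<Delta>) ^ j)"
    by (intro sum.cong refl)
  also have "\<dots> = (exp (l * \<Delta>) ^ Suc n - 1) / (exp (l * \<Delta>) - 1)"
    using \<Delta> assms by (subst geometric_sum) auto
  also have "exp (l * \<Delta>) ^ Suc n = exp (l * (b - a))"
    unfolding exp_of_nat_mult[symmetric] by (simp add: \<Delta>_def del: of_nat_Suc)
  also have "(exp (l * (b - a)) - 1) / (exp (l * \<Delta>) - 1) \<le> exp (l * (b - a)) / (l * \<Delta>)"
  proof (rule frac_le)
    show "l * \<Delta> \<le> exp (l * \<Delta>) - 1" using exp_ge_add_one_self[of "l * \<Delta>"] by linarith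
  qed (use \<Delta> assms in auto)
  finally have "\<Delta> * (\<Sum>j<Suc n. exp (l * (mesh a b n j - a))) \<le> \<Delta> * (exp (l * (b - a)) / (l * \<Delta>))"
    using \<Delta> by (intro mult_left_mono) auto
  also have "\<dots> = exp (l * (b - a)) / l" using \<Delta> by simp
  finally show ?thesis unfolding \<Delta>_def .
qed

text \<open>Mesh points are dense in the interval, so a closed condition checked on all meshes
  passes to all times. This reduces statements about whole paths to countably many times.\<close>

lemma continuous_on_closed_mesh:
  fixes h :: "real \<Rightarrow> real"
  assumes h: "continuous_on {t..s} h" and C: "closed C"
    and grid: "\<And>n j. j \<le> Suc n \<Longrightarrow> h (mesh t s n j) \<in> C" and u: "u \<in> {t..s}"
  shows "h u \<in> C"
proof (cases "u = t")
  case True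
  then show ?thesis using grid[of 0 0] by simp
next
  case False
  then have tu: "t < s" "t < u" "u \<le> s" using u by auto
  have "\<exists>j\<le>Suc n. \<bar>mesh t s n j - u\<bar> \<le> (s - t) / real (Suc n)" for n
  proof -
    obtain j where "j \<le> n" "u \<in> {mesh t s n j<..mesh t s n (Suc j)}"
      using mesh_cover[OF tu] by blast
    then show ?thesis using mesh_diff[of t s n j] by (intro exI[of _ j]) auto
  qed
  then obtain j where j: "\<And>n. j n \<le> Suc n" "\<And>n. \<bar>mesh t s n (j n) - u\<bar> \<le> (s - t) / real (Suc n)"
    by metis
  have "(\<lambda>n. mesh t s n (j n) - u) \<longlonglongrightarrow> 0"
    by (rule Lim_null_comparison[OF _ LIMSEQ_Suc[OF lim_const_over_n[of "s - t"]]]) (use j in auto)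
  then have "(\<lambda>n. mesh t s n (j n)) \<longlonglongrightarrow> u" by (simp add: LIM_zero_iff)
  then have "(\<lambda>n. h (mesh t s n (j n))) \<longlonglongrightarrow> h u"
    using j(1) mesh_bounds[of t s] tu u
    by (intro continuous_on_tendsto_compose[OF h]) auto
  then show ?thesis
    by (rule Lim_in_closed_set[OF C, rotated 2]) (use grid j(1) in auto)
qed

section \<open>Euler error and contraction in mean square\<close>

context brownian_setting begin

text \<open>The factor \<open>y\<close> may have a nonzero mean \<open>m\<close>. Its constant part
  is bounded by Cauchy-Schwarz at the price of a factor \<open>n\<close>, the centred part by the
  isometry. In the uses below \<open>m\<close> is at most of the order of the step, hence so is
  \<open>n * m\<^sup>2\<close>.\<close>

lemma transform_second_moment_le:
  fixes q :: "nat \<Rightarrow> real" and \<xi> :: "nat \<Rightarrow> 'a \<Rightarrow> real" and y :: "real \<Rightarrow> real"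
  assumes q: "0 \<le> q 0" "\<And>j. j < n \<Longrightarrow> q j \<le> q (Suc j)"
    and \<xi>: "\<And>j. j < n \<Longrightarrow> \<xi> j \<in> borel_measurable (F (q j))"
      "\<And>j. j < n \<Longrightarrow> square_integrable (\<xi> j)"
    and y [measurable]: "y \<in> borel_measurable borel"
    and y2: "\<And>j. j < n \<Longrightarrow> integrable M (\<lambda>\<omega>. (y (incr q j \<omega>))\<^sup>2)"
      "\<And>j. j < n \<Longrightarrow> (\<integral>\<omega>. y (incr q j \<omega>) \<partial>M) = m"
      "\<And>j. j < n \<Longrightarrow> (\<integral>\<omega>. (y (incr q j \<omega>))\<^sup>2 \<partial>M) = v"
  defines "S \<equiv> \<lambda>\<omega>. \<Sum>j<n. \<xi> j \<omega> * y (incr q j \<omega>)"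
  shows "square_integrable S"
    and "msq S \<le> (2 * real n * m\<^sup>2 + 2 * v) * (\<Sum>j<n. msq (\<xi> j))"
proof -
  define C where "C \<omega> = (\<Sum>j<n. \<xi> j \<omega> * (y (incr q j \<omega>) - m))" for \<omega>
  have q_nonneg: "j \<le> n \<Longrightarrow> 0 \<le> q j" for j
  proof (induction j)
    case (Suc j)
    then show ?case using q(2)[of j] by simp
  qed (use q in simp)
  have [measurable]: "W (q j) \<in> borel_measurable M" if "j \<le> n" for j
    using q_nonneg[OF that] by simp
  have Ym [measurable]: "(\<lambda>\<omega>. y (incr q j \<omega>)) \<in> borel_measurable M" if "j < n" for j
  proof (rule measurable_compose[OF _ y])
    show "(\<lambda>\<omega>. incr q j \<omega>) \<in> borel_measurable M"
      using that by (intro borel_measurable_diff W_measurable q_nonneg) auto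
  qed
  have \<xi>M [measurable]: "\<xi> j \<in> borel_measurable M" if "j < n" for j
    using \<xi>(1)[OF that] by (rule measurable_F_M)
  have yint: "integrable M (\<lambda>\<omega>. y (incr q j \<omega>))" if "j < n" for j
    by (rule integrable_if_square_integrable[OF Ym[OF that] y2(1)[OF that]])
  have expand: "(w - m)\<^sup>2 = w\<^sup>2 - 2 * m * w + m\<^sup>2" for w
    by (simp add: power2_diff)
  have c2: "integrable M (\<lambda>\<omega>. (y (incr q j \<omega>) - m)\<^sup>2)"
    "(\<integral>\<omega>. (y (incr q j \<omega>) - m)\<^sup>2 \<partial>M) \<le> v" if j: "j < n" for j
  proof -
    show "integrable M (\<lambda>\<omega>. (y (incr q j \<omega>) - m)\<^sup>2)"
      unfolding expand using y2(1)[OF j] yint[OF j] by simp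
    have "(\<integral>\<omega>. (y (incr q j \<omega>) - m)\<^sup>2 \<partial>M) = v - 2 * m * m + m\<^sup>2"
      unfolding expand using y2[OF j] yint[OF j] by (simp add: prob_space)
    also have "\<dots> \<le> v" by (simp add: power2_eq_square)
    finally show "(\<integral>\<omega>. (y (incr q j \<omega>) - m)\<^sup>2 \<partial>M) \<le> v" .
  qed
  have c1: "(\<integral>\<omega>. y (incr q j \<omega>) - m \<partial>M) = 0" if j: "j < n" for j
    using y2(2)[OF j] yint[OF j] by (simp add: prob_space)
  have ym: "(\<lambda>z. y z - m) \<in> borel_measurable borel" by measurable
  have C: "square_integrable C"
    unfolding C_def by (rule transform_second_moment(1)[where y="\<lambda>_ z. y z - m"]) (rule q \<xi> ym c1 c2 | assumption)+
  have "msq C = (\<Sum>j<n. msq (\<xi> j) * (\<integral>\<omega>. (y (incr q j \<omega>) - m)\<^sup>2 \<partial>M))"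
    unfolding C_def by (rule transform_second_moment(2)[where y="\<lambda>_ z. y z - m"]) (rule q \<xi> ym c1 c2 | assumption)+
  also have "\<dots> \<le> (\<Sum>j<n. msq (\<xi> j) * v)"
    using c2(2) by (intro sum_mono mult_left_mono) auto
  finally have C_le: "msq C \<le> v * (\<Sum>j<n. msq (\<xi> j))"
    by (simp add: sum_distrib_left mult.commute)
  have S_le: "(S \<omega>)\<^sup>2 \<le> 2 * real n * m\<^sup>2 * (\<Sum>j<n. (\<xi> j \<omega>)\<^sup>2) + 2 * (C \<omega>)\<^sup>2" for \<omega>
  proof -
    have S: "S \<omega> = m * (\<Sum>j<n. \<xi> j \<omega>) + C \<omega>"
      unfolding S_def C_def sum_distrib_left sum.distrib[symmetric] by (simp add: algebra_simps)
    have "(u + w)\<^sup>2 \<le> 2 * u\<^sup>2 + 2 * w\<^sup>2" for u w :: real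
      using zero_le_power2[of "u - w"] by (simp add: power2_eq_square algebra_simps)
    from this[of "m * (\<Sum>j<n. \<xi> j \<omega>)" "C \<omega>"]
    have "(S \<omega>)\<^sup>2 \<le> 2 * (m\<^sup>2 * (\<Sum>j<n. \<xi> j \<omega>)\<^sup>2) + 2 * (C \<omega>)\<^sup>2"
      by (simp add: S power_mult_distrib)
    moreover have "(\<Sum>j<n. \<xi> j \<omega>)\<^sup>2 \<le> (\<Sum>j<n. (\<xi> j \<omega>)\<^sup>2) * real n"
      using sum_squared_le_sum_of_squares[of "\<lambda>j. \<xi> j \<omega>" "{..<n}"] by simp
    then have "m\<^sup>2 * (\<Sum>j<n. \<xi> j \<omega>)\<^sup>2 \<le> m\<^sup>2 * ((\<Sum>j<n. (\<xi> j \<omega>)\<^sup>2) * real n)"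
      by (rule mult_left_mono) simp
    ultimately show ?thesis by (simp add: mult.commute mult.left_commute)
  qed
  have int_r: "integrable M (\<lambda>\<omega>. 2 * real n * m\<^sup>2 * (\<Sum>j<n. (\<xi> j \<omega>)\<^sup>2) + 2 * (C \<omega>)\<^sup>2)"
    using \<xi>(2) C by (intro Bochner_Integration.integrable_add integrable_mult_right Bochner_Integration.integrable_sum) auto
  have [measurable]: "S \<in> borel_measurable M"
    unfolding S_def by (intro borel_measurable_sum borel_measurable_times Ym \<xi>M) auto
  show int_S: "square_integrable S"
  proof (rule Bochner_Integration.integrable_bound[OF int_r])
    show "AE \<omega> in M. norm ((S \<omega>)\<^sup>2) \<le> norm (2 * real n * m\<^sup>2 * (\<Sum>j<n. (\<xi> j \<omega>)\<^sup>2) + 2 * (C \<omega>)\<^sup>2)"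
      using S_le by (intro AE_I2) (simp add: order_trans[OF _ abs_ge_self])
  qed simp
  have "msq S \<le> (\<integral>\<omega>. 2 * real n * m\<^sup>2 * (\<Sum>j<n. (\<xi> j \<omega>)\<^sup>2) + 2 * (C \<omega>)\<^sup>2 \<partial>M)"
    by (rule integral_mono[OF int_S int_r S_le])
  also have "\<dots> = 2 * real n * m\<^sup>2 * (\<Sum>j<n. msq (\<xi> j)) + 2 * msq C"
    using \<xi>(2) C by (subst Bochner_Integration.integral_add) (auto simp: Bochner_Integration.integral_sum)
  also have "\<dots> \<le> (2 * real n * m\<^sup>2 + 2 * v) * (\<Sum>j<n. msq (\<xi> j))"
    using C_le by (simp add: distrib_right)
  finally show "msq S \<le> (2 * real n * m\<^sup>2 + 2 * v) * (\<Sum>j<n. msq (\<xi> j))" .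
qed

text \<open>By continuity the uncountable condition on the path equals its restriction to all mesh
  points, and each of these is at most \<open>s\<close>, so the event belongs to
  \<open>F s\<close>.\<close>

lemma sets_bounded_path:
  fixes Y :: "real \<Rightarrow> 'a \<Rightarrow> real"
  assumes "t \<le> s" and Y: "\<And>u. u \<in> {t..s} \<Longrightarrow> Y u \<in> borel_measurable (F u)"
    and cont: "\<And>\<omega>. \<omega> \<in> space M \<Longrightarrow> continuous_on {t..s} (\<lambda>u. Y u \<omega>)"
  shows "{\<omega>\<in>space M. \<forall>u\<in>{t..s}. \<bar>Y u \<omega>\<bar> \<le> N} \<in> sets (F s)"
proof -
  let ?g = "mesh t s"
  have "{\<omega>\<in>space M. \<forall>u\<in>{t..s}. \<bar>Y u \<omega>\<bar> \<le> N} = {\<omega>\<in>space (F s). \<forall>n. \<forall>j\<in>{..Suc n}. \<bar>Y (?g n j) \<omega>\<bar> \<le> N}"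
  proof (intro Collect_cong conj_cong)
    fix \<omega> assume "\<omega> \<in> space (F s)"
    then have c: "continuous_on {t..s} (\<lambda>u. Y u \<omega>)" using cont space_F by auto
    show "(\<forall>u\<in>{t..s}. \<bar>Y u \<omega>\<bar> \<le> N) \<longleftrightarrow> (\<forall>n. \<forall>j\<in>{..Suc n}. \<bar>Y (?g n j) \<omega>\<bar> \<le> N)"
    proof safe
      fix n j assume "\<forall>u\<in>{t..s}. \<bar>Y u \<omega>\<bar> \<le> N" "j \<le> Suc n"
      then show "\<bar>Y (?g n j) \<omega>\<bar> \<le> N" using mesh_bounds[OF \<open>t \<le> s\<close>] by blast
    next
      fix u assume *: "\<forall>n. \<forall>j\<in>{..Suc n}. \<bar>Y (?g n j) \<omega>\<bar> \<le> N" and u: "u \<in> {t..s}"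
      have "Y u \<omega> \<in> {- N..N}"
        by (rule continuous_on_closed_mesh[OF c _ _ u]) (use * in \<open>auto simp: abs_le_iff minus_le_iff\<close>)
      then show "\<bar>Y u \<omega>\<bar> \<le> N" by auto
    qed
  qed (simp add: space_F)
  also have "\<dots> \<in> sets (F s)"
  proof (intro sets.sets_Collect_countable_All sets.sets_Collect_finite_All)
    fix n j assume "j \<in> {..Suc n}"
    then have g: "?g n j \<in> {t..s}" using mesh_bounds[OF \<open>t \<le> s\<close>] by auto
    then have [measurable]: "Y (?g n j) \<in> borel_measurable (F s)"
      by (intro measurable_F_mono[OF _ Y]) auto
    show "{\<omega> \<in> space (F s). \<bar>Y (?g n j) \<omega>\<bar> \<le> N} \<in> sets (F s)" by measurable
  qed simp
  finally show ?thesis .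
qed

text \<open>\<open>\<kappa>\<close> is the Euler factor minus the exact growth factor of the
  geometric Brownian motion over one step. Its mean and its second moment vanish at
  \<open>\<Delta> = 0\<close> together with their first derivatives, the second moment because the
  contributions of \<open>\<sigma>\<^sup>2\<close> cancel.\<close>

lemma euler_defect_moments:
  fixes r \<sigma> :: real
  assumes "0 \<le> s" "s \<le> u"
  defines "\<Delta> \<equiv> u - s" and "dW \<equiv> \<lambda>\<omega>. W u \<omega> - W s \<omega>"
  defines "\<kappa> \<equiv> \<lambda>z. 1 + r * \<Delta> + \<sigma> * z - exp ((r - \<sigma>\<^sup>2 / 2) * \<Delta> + \<sigma> * z)"
  shows "integrable M (\<lambda>\<omega>. (\<kappa> (dW \<omega>))\<^sup>2)"
    and "(\<integral>\<omega>. \<kappa> (dW \<omega>) \<partial>M) = 1 + r * \<Delta> - exp (r * \<Delta>)"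
    and "(\<integral>\<omega>. (\<kappa> (dW \<omega>))\<^sup>2 \<partial>M) = (1 + r * \<Delta>)\<^sup>2 + \<sigma>\<^sup>2 * \<Delta>
      - 2 * exp (r * \<Delta>) * (1 + r * \<Delta> + \<sigma>\<^sup>2 * \<Delta>) + exp ((2 * r + \<sigma>\<^sup>2) * \<Delta>)"
proof -
  define c where "c = (r - \<sigma>\<^sup>2 / 2) * \<Delta>"
  have w: "integrable M (\<lambda>\<omega>. dW \<omega>)" "(\<integral>\<omega>. dW \<omega> \<partial>M) = 0"
    "integrable M (\<lambda>\<omega>. (dW \<omega>)\<^sup>2)" "(\<integral>\<omega>. (dW \<omega>)\<^sup>2 \<partial>M) = \<Delta>"
    "integrable M (\<lambda>\<omega>. exp (c * dW \<omega>))" "(\<integral>\<omega>. exp (c * dW \<omega>) \<partial>M) = exp (c\<^sup>2 * \<Delta> / 2)"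
    "integrable M (\<lambda>\<omega>. dW \<omega> * exp (c * dW \<omega>))"
    "(\<integral>\<omega>. dW \<omega> * exp (c * dW \<omega>) \<partial>M) = c * \<Delta> * exp (c\<^sup>2 * \<Delta> / 2)" for c
    unfolding dW_def \<Delta>_def using assms(1,2)
    by (rule integrable_W_increment expectation_W_increment integrable_W_increment_square
        expectation_W_increment_square integrable_W_increment_exp expectation_W_increment_exp
        integrable_W_increment_mult_exp expectation_W_increment_mult_exp)+
  have e1: "exp c * exp (\<sigma>\<^sup>2 * \<Delta> / 2) = exp (r * \<Delta>)"
    by (simp add: mult_exp_exp c_def field_simps)
  have e2: "exp (2 * c) * exp ((2 * \<sigma>)\<^sup>2 * \<Delta> / 2) = exp ((2 * r + \<sigma>\<^sup>2) * \<Delta>)"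
    by (simp add: mult_exp_exp c_def field_simps power2_eq_square)
  have \<kappa>: "\<kappa> z = (1 + r * \<Delta>) + \<sigma> * z - exp c * exp (\<sigma> * z)" for z
    by (simp add: \<kappa>_def c_def exp_add)
  have \<kappa>2: "(\<kappa> z)\<^sup>2 = (1 + r * \<Delta>)\<^sup>2 + \<sigma>\<^sup>2 * z\<^sup>2 + exp (2 * c) * exp (2 * \<sigma> * z)
      + 2 * (1 + r * \<Delta>) * \<sigma> * z - 2 * (1 + r * \<Delta>) * exp c * exp (\<sigma> * z) - 2 * \<sigma> * exp c * (z * exp (\<sigma> * z))" for z
  proof -
    have "exp (2 * c) * exp (2 * \<sigma> * z) = (exp c * exp (\<sigma> * z))\<^sup>2"
      by (simp add: power_mult_distrib exp_double[symmetric] mult.assoc)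
    then show ?thesis unfolding \<kappa> by (simp add: power2_eq_square algebra_simps)
  qed
  show "integrable M (\<lambda>\<omega>. (\<kappa> (dW \<omega>))\<^sup>2)"
    unfolding \<kappa>2 using w by (intro Bochner_Integration.integrable_add Bochner_Integration.integrable_diff integrable_mult_right) auto
  have "(\<integral>\<omega>. \<kappa> (dW \<omega>) \<partial>M) = 1 + r * \<Delta> - exp c * exp (\<sigma>\<^sup>2 * \<Delta> / 2)"
    unfolding \<kappa> using w by (simp add: prob_space)
  then show "(\<integral>\<omega>. \<kappa> (dW \<omega>) \<partial>M) = 1 + r * \<Delta> - exp (r * \<Delta>)"
    unfolding e1 .
  have "(\<integral>\<omega>. (\<kappa> (dW \<omega>))\<^sup>2 \<partial>M) = (1 + r * \<Delta>)\<^sup>2 + \<sigma>\<^sup>2 * \<Delta> + exp (2 * c) * exp ((2 * \<sigma>)\<^sup>2 * \<Delta> / 2)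
     - 2 * (1 + r * \<Delta>) * (exp c * exp (\<sigma>\<^sup>2 * \<Delta> / 2)) - 2 * \<sigma>\<^sup>2 * \<Delta> * (exp c * exp (\<sigma>\<^sup>2 * \<Delta> / 2))"
    unfolding \<kappa>2 using w by (simp add: prob_space power2_eq_square)
  then show "(\<integral>\<omega>. (\<kappa> (dW \<omega>))\<^sup>2 \<partial>M) = (1 + r * \<Delta>)\<^sup>2 + \<sigma>\<^sup>2 * \<Delta>
      - 2 * exp (r * \<Delta>) * (1 + r * \<Delta> + \<sigma>\<^sup>2 * \<Delta>) + exp ((2 * r + \<sigma>\<^sup>2) * \<Delta>)"
    unfolding e1 e2 by (simp add: algebra_simps)
qed

text \<open>The Euler sums are evaluated along \<open>X\<close> itself. Their drift part converges
  path by path, their noise part only in probability.\<close>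

lemma linear_sde_euler_error:
  assumes t: "0 \<le> t" and sde: "sde_solution M F W (\<lambda>y. r * y) (\<lambda>y. \<sigma> * y) t T x X"
    and s: "t < s" "s \<le> T"
  shows "converges_in_prob M
    (\<lambda>n \<omega>. x + (\<Sum>j<Suc n. X (mesh t s n j) \<omega>
      * (r * ((s - t) / real (Suc n)) + \<sigma> * (incr (mesh t s n) j \<omega>)))) (X s)"
proof -
  let ?q = "mesh t s"
  have XF: "X u \<in> borel_measurable (F u)" if "u \<in> {t..T}" for u
    using sde that by (simp add: sde_solution_def)
  have XM [measurable]: "X u \<in> borel_measurable M" if "u \<in> {t..T}" for u
    using XF[OF that] by (rule measurable_F_M)
  have q: "?q n j \<in> {t..T}" if "j \<le> Suc n" for n j
    using mesh_bounds[of t s j n] that s by auto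
  have cont: "continuous_on {t..s} (\<lambda>u. X u \<omega>)" if "\<omega> \<in> space M" for \<omega>
    using sde that s by (auto simp: sde_solution_def intro: continuous_on_subset)
  have "s \<in> {t..T}" using s by simp
  then obtain I where ito: "has_ito_integral M F W t s (\<lambda>u \<omega>. \<sigma> * X u \<omega>) I"
    and I: "AE \<omega> in M. X s \<omega> = x + (LBINT u:{t..s}. r * X u \<omega>) + I \<omega>"
    using sde unfolding sde_solution_def by blast
  define R where "R n \<omega> = (\<Sum>j<Suc n. \<sigma> * X (?q n j) \<omega> * (incr (?q n) j \<omega>))" for n \<omega>
  define L where "L n \<omega> = (\<Sum>j<Suc n. X (?q n j) \<omega> * ((s - t) / real (Suc n)))" for n \<omega>
  have R: "converges_in_prob M R I"
  proof -
    have "R = (\<lambda>n. simple_integral W (Suc n) (?q n) (\<lambda>j \<omega>. \<sigma> * X (?q n j) \<omega>))"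
      unfolding R_def simple_integral_def by (intro ext refl)
    moreover have "converges_in_prob M (\<lambda>n. simple_integral W (Suc n) (?q n) (\<lambda>j \<omega>. \<sigma> * X (?q n j) \<omega>)) I"
    proof (rule riemann_sums_converge_to_ito_integral[OF t s(1) ito])
      show "(\<lambda>\<omega>. \<sigma> * X u \<omega>) \<in> borel_measurable (F u)" if "u \<in> {t..s}" for u
        using XF[of u] that s by (intro borel_measurable_times) auto
    qed (intro continuous_intros cont)
    ultimately show ?thesis by simp
  qed
  have IM [measurable]: "I \<in> borel_measurable M" and RM [measurable]: "R n \<in> borel_measurable M" for n
    using R by (auto simp: converges_in_prob_def)
  have LM [measurable]: "L n \<in> borel_measurable M" for n
    unfolding L_def using q by (intro borel_measurable_sum borel_measurable_times XM) auto
  have XsM [measurable]: "X s \<in> borel_measurable M" using s by (intro XM) simp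
  have Y: "converges_in_prob M (\<lambda>n \<omega>. x + r * L n \<omega>) (\<lambda>\<omega>. X s \<omega> - I \<omega>)"
  proof (rule converges_in_prob_if_AE)
    show "AE \<omega> in M. (\<lambda>n. x + r * L n \<omega>) \<longlonglongrightarrow> X s \<omega> - I \<omega>"
      using I AE_space
    proof eventually_elim
      case (elim \<omega>)
      have "(\<lambda>n. x + r * L n \<omega>) \<longlonglongrightarrow> x + r * (LBINT u:{t..s}. X u \<omega>)"
        unfolding L_def by (intro tendsto_intros lebesgue_riemann_sums_converge s cont elim)
      then show ?case using elim by simp
    qed
  qed measurable
  have sum_eq: "x + (\<Sum>j<Suc n. X (?q n j) \<omega>
      * (r * ((s - t) / real (Suc n)) + \<sigma> * (incr (?q n) j \<omega>))) = (x + r * L n \<omega>) + R n \<omega>" for n \<omega>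
    unfolding L_def R_def sum_distrib_left add.assoc sum.distrib[symmetric]
    by (intro arg_cong[of _ _ "\<lambda>v. x + v"] sum.cong refl) (simp add: algebra_simps)
  show ?thesis
    unfolding sum_eq converges_in_prob_def
  proof (intro conjI allI impI)
    fix \<epsilon> :: real assume "\<epsilon> > 0"
    let ?f = "\<lambda>n. prob {\<omega>\<in>space M. \<epsilon> / 2 < \<bar>x + r * L n \<omega> - (X s \<omega> - I \<omega>)\<bar>} + prob {\<omega>\<in>space M. \<epsilon> / 2 < \<bar>R n \<omega> - I \<omega>\<bar>}"
    have f: "?f \<longlonglongrightarrow> 0 + 0"
      using \<open>\<epsilon> > 0\<close> by (intro tendsto_add converges_in_probD[OF Y] converges_in_probD[OF R]) simp_all
    \<comment> \<open>The intermediate variable \<open>X s - I + R n\<close> separates the two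
      errors: it differs from the Euler sum by the drift error and from \<open>X s\<close> by the
      noise error.\<close>
    have le: "prob {\<omega> \<in> space M. \<epsilon> < \<bar>x + r * L n \<omega> + R n \<omega> - X s \<omega>\<bar>} \<le> ?f n" for n
      using prob_triangle[of "\<lambda>\<omega>. x + r * L n \<omega> + R n \<omega>" "\<lambda>\<omega>. X s \<omega> - I \<omega> + R n \<omega>" "X s" \<epsilon>]
      by (simp add: algebra_simps)
    show "(\<lambda>n. prob {\<omega> \<in> space M. \<epsilon> < \<bar>x + r * L n \<omega> + R n \<omega> - X s \<omega>\<bar>}) \<longlonglongrightarrow> 0"
    proof (rule tendsto_sandwich[where f="\<lambda>_. 0" and h="?f"])
      show "?f \<longlonglongrightarrow> 0" using f unfolding add_0_left .
      show "\<forall>\<^sub>F n in sequentially. prob {\<omega> \<in> space M. \<epsilon> < \<bar>x + r * L n \<omega> + R n \<omega> - X s \<omega>\<bar>} \<le> ?f n"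
        by (rule always_eventually) (rule allI, rule le)
    qed auto
  qed measurable
qed

text \<open>\<open>a N u\<close> is the mean square difference on the event that both paths have
  stayed within \<open>N\<close> in absolute value. The recursion in \<open>step\<close> stays on a
  mesh, so no regularity of \<open>a N\<close> in time enters; iterating it in \<open>decay\<close>
  forces \<open>a N s = 0\<close>.\<close>

theorem linear_sde_unique:
  fixes X :: "real \<Rightarrow> 'a \<Rightarrow> real"
  assumes t: "0 \<le> t" and sde: "sde_solution M F W (\<lambda>y. r * y) (\<lambda>y. \<sigma> * y) t T x X"
    and s: "s \<in> {t..T}"
  shows "AE \<omega> in M. X s \<omega> = x * exp ((r - \<sigma>\<^sup>2 / 2) * (s - t) + \<sigma> * (W s \<omega> - W t \<omega>))"
proof -
  let ?q = "mesh t"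
  define G where "G u \<omega> = x * exp ((r - \<sigma>\<^sup>2 / 2) * (u - t) + \<sigma> * (W u \<omega> - W t \<omega>))" for u \<omega>
  define D where "D u \<omega> = X u \<omega> - G u \<omega>" for u \<omega>
  \<comment> \<open>Both paths have to be bounded on the event: \<open>X\<close> and
    \<open>G\<close> together bound \<open>D\<close>, and \<open>G\<close> by itself multiplies the
    Euler defects.\<close>
  define A where "A N u = {\<omega>\<in>space M. \<forall>v\<in>{t..u}. \<bar>X v \<omega>\<bar> \<le> real N} \<inter> {\<omega>\<in>space M. \<forall>v\<in>{t..u}. \<bar>G v \<omega>\<bar> \<le> real N}" for N u
  define a where "a N u = (\<integral>\<omega>. (indicator (A N u) \<omega> * D u \<omega>)\<^sup>2 \<partial>M)" for N u
  have XF: "X u \<in> borel_measurable (F u)" if "u \<in> {t..T}" for u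
    using sde that by (simp add: sde_solution_def)
  have Xcont: "continuous_on {t..u} (\<lambda>v. X v \<omega>)" if "\<omega> \<in> space M" "u \<le> T" for u \<omega>
    using sde that by (auto simp: sde_solution_def intro: continuous_on_subset)
  have GF: "G u \<in> borel_measurable (F u)" if "u \<in> {t..T}" for u
  proof -
    have [measurable]: "W u \<in> borel_measurable (F u)" "W t \<in> borel_measurable (F u)"
      using that t by (auto intro: W_measurable_F)
    show ?thesis unfolding G_def by measurable
  qed
  have Gcont: "continuous_on {t..u} (\<lambda>v. G v \<omega>)" if "\<omega> \<in> space M" for u \<omega>
    unfolding G_def using continuous_on_subset[OF W_continuous[OF that], of "{t..u}"] t
    by (intro continuous_intros) auto
  have DF: "D u \<in> borel_measurable (F u)" if "u \<in> {t..T}" for u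
    unfolding D_def using XF[OF that] GF[OF that] by measurable
  have AF: "A N u \<in> sets (F u)" if "u \<in> {t..T}" for N u
    unfolding A_def using that
    by (intro sets.Int sets_bounded_path Xcont Gcont XF GF) auto
  have AM: "A N u \<in> sets M" if "u \<in> {t..T}" for N u
    using AF[OF that] sets_F_subset by blast
  have A_mono: "A N u \<subseteq> A N v" if "v \<le> u" for N u v
    using that by (auto simp: A_def)
  have A_bounds: "\<bar>X v \<omega>\<bar> \<le> real N" "\<bar>G v \<omega>\<bar> \<le> real N" "\<bar>D v \<omega>\<bar> \<le> 2 * real N"
    if "\<omega> \<in> A N u" "v \<in> {t..u}" for N u v \<omega>
    using that by (force simp: A_def D_def)+
  have AD_sq: "(indicator (A N u) \<omega> * D u \<omega>)\<^sup>2 \<le> 4 * (real N)\<^sup>2" if "u \<in> {t..T}" for N u \<omega>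
  proof -
    have "\<bar>indicator (A N u) \<omega> * D u \<omega>\<bar> \<le> \<bar>2 * real N\<bar>"
      using A_bounds(3)[of \<omega> N u u] that by (auto simp: indicator_def)
    then have "(indicator (A N u) \<omega> * D u \<omega>)\<^sup>2 \<le> (2 * real N)\<^sup>2" unfolding abs_le_square_iff .
    then show ?thesis by (simp add: power_mult_distrib)
  qed
  have AG_sq: "(indicator (A N u) \<omega> * G u \<omega>)\<^sup>2 \<le> (real N)\<^sup>2" if "u \<in> {t..T}" for N u \<omega>
  proof -
    have "\<bar>indicator (A N u) \<omega> * G u \<omega>\<bar> \<le> \<bar>real N\<bar>"
      using A_bounds(2)[of \<omega> N u u] that by (auto simp: indicator_def)
    then show ?thesis unfolding abs_le_square_iff .
  qed
  have ADF: "(\<lambda>\<omega>. indicator (A N u) \<omega> * D u \<omega>) \<in> borel_measurable (F u)" if "u \<in> {t..T}" for N u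
    using AF[OF that] DF[OF that] by measurable
  have AGF: "(\<lambda>\<omega>. indicator (A N u) \<omega> * G u \<omega>) \<in> borel_measurable (F u)" if "u \<in> {t..T}" for N u
    using AF[OF that] GF[OF that] by measurable
  have AD_int: "integrable M (\<lambda>\<omega>. (indicator (A N u) \<omega> * D u \<omega>)\<^sup>2)" if "u \<in> {t..T}" for N u
    using AD_sq[OF that] measurable_F_M[OF ADF[OF that]] by (intro integrable_const_bound[where B="4 * (real N)\<^sup>2"]) auto
  have AG_int: "integrable M (\<lambda>\<omega>. (indicator (A N u) \<omega> * G u \<omega>)\<^sup>2)" if "u \<in> {t..T}" for N u
    using AG_sq[OF that] measurable_F_M[OF AGF[OF that]] by (intro integrable_const_bound[where B="(real N)\<^sup>2"]) auto

  \<comment> \<open>The first two terms bound the second moment of the propagated difference; the 1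
    keeps \<open>C\<close> positive, since it is divided by later and \<open>r\<close> and
    \<open>\<sigma>\<close> may be 0 here.\<close>
  define C where "C = 4 * r\<^sup>2 * (T - t) + 2 * \<sigma>\<^sup>2 + 1"
  define m where "m \<Delta> = 1 + r * \<Delta> - exp (r * \<Delta>)" for \<Delta>
  define v where "v \<Delta> = (1 + r * \<Delta>)\<^sup>2 + \<sigma>\<^sup>2 * \<Delta>
      - 2 * exp (r * \<Delta>) * (1 + r * \<Delta> + \<sigma>\<^sup>2 * \<Delta>) + exp ((2 * r + \<sigma>\<^sup>2) * \<Delta>)" for \<Delta>

  \<comment> \<open>The three squares come from the splitting \<open>D s = \<Phi> + Q - err\<close>
    on \<open>A N s\<close>: propagated difference, Euler defects of \<open>G\<close>, and Euler
    error of \<open>X\<close>. The last is small only in probability, so it is cut at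
    \<open>\<eta>\<close>, and \<open>\<bar>D s\<bar> \<le> 2 * N\<close> is used on the exceptional
    event.\<close>
  have step: "a N s \<le> 3 * C * ((s - t) / real (Suc n)) * (\<Sum>j<Suc n. a N (?q s n j))
      + 3 * ((2 * real (Suc n) * (m ((s - t) / real (Suc n)))\<^sup>2 + 2 * v ((s - t) / real (Suc n))) * (real (Suc n) * (real N)\<^sup>2))
      + 3 * \<eta>\<^sup>2 + 4 * (real N)\<^sup>2 * prob {\<omega>\<in>space M. \<eta> < \<bar>x + (\<Sum>j<Suc n. X (?q s n j) \<omega>
      * (r * ((s - t) / real (Suc n)) + \<sigma> * (incr (?q s n) j \<omega>))) - X s \<omega>\<bar>}"
    if s: "t < s" "s \<le> T" and "\<eta> > 0" for s N n \<eta>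
  proof -
    define \<Delta> where "\<Delta> = (s - t) / real (Suc n)"
    define q where "q = ?q s n"
    define y where "y z = r * \<Delta> + \<sigma> * z" for z
    define \<kappa> where "\<kappa> z = 1 + r * \<Delta> + \<sigma> * z - exp ((r - \<sigma>\<^sup>2 / 2) * \<Delta> + \<sigma> * z)" for z
    define \<Phi> where "\<Phi> \<omega> = (\<Sum>j<Suc n. (indicator (A N (q j)) \<omega> * D (q j) \<omega>) * y (incr q j \<omega>))" for \<omega>
    define Q where "Q \<omega> = (\<Sum>j<Suc n. (indicator (A N (q j)) \<omega> * G (q j) \<omega>) * \<kappa> (incr q j \<omega>))" for \<omega>
    define err where "err \<omega> = x + (\<Sum>j<Suc n. X (q j) \<omega> * y (incr q j \<omega>)) - X s \<omega>" for \<omega>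
    have \<Delta>: "0 < \<Delta>" "\<Delta> \<le> s - t"
      using s by (auto simp: \<Delta>_def divide_le_eq)
    have q: "q j \<in> {t..s}" "q j \<in> {t..T}" "0 \<le> q j" if "j \<le> Suc n" for j
      using mesh_bounds[of t s j n] that s t by (auto simp: q_def)
    have q_le: "q j \<le> q (Suc j)" for j
      unfolding q_def using s by (intro mesh_mono) auto
    have q_diff: "q (Suc j) - q j = \<Delta>" for j
      unfolding q_def \<Delta>_def by (rule mesh_diff)
    have q0: "q 0 = t" "q (Suc n) = s" by (simp_all add: q_def)
    have WM [measurable]: "W (q j) \<in> borel_measurable M" if "j \<le> Suc n" for j
      using q(3)[OF that] by simp
    have dW: "integrable M (\<lambda>\<omega>. incr q j \<omega>)" "(\<integral>\<omega>. incr q j \<omega> \<partial>M) = 0"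
      "integrable M (\<lambda>\<omega>. (incr q j \<omega>)\<^sup>2)" "(\<integral>\<omega>. (incr q j \<omega>)\<^sup>2 \<partial>M) = \<Delta>"
      if "j < Suc n" for j
      using integrable_W_increment[OF q(3) q_le, of j] expectation_W_increment[OF q(3) q_le, of j]
        integrable_W_increment_square[OF q(3) q_le, of j] expectation_W_increment_square[OF q(3) q_le, of j] that q_diff
      by simp_all
    have ysq: "(y z)\<^sup>2 = r\<^sup>2 * \<Delta>\<^sup>2 + 2 * r * \<Delta> * \<sigma> * z + \<sigma>\<^sup>2 * z\<^sup>2" for z
      by (simp add: y_def power2_eq_square algebra_simps)
    have y_moments: "integrable M (\<lambda>\<omega>. (y (incr q j \<omega>))\<^sup>2)"
      "(\<integral>\<omega>. y (incr q j \<omega>) \<partial>M) = r * \<Delta>"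
      "(\<integral>\<omega>. (y (incr q j \<omega>))\<^sup>2 \<partial>M) = r\<^sup>2 * \<Delta>\<^sup>2 + \<sigma>\<^sup>2 * \<Delta>" if "j < Suc n" for j
    proof -
      define Y where "Y \<omega> = W (q (Suc j)) \<omega> - W (q j) \<omega>" for \<omega>
      have Y: "integrable M Y" "(\<integral>\<omega>. Y \<omega> \<partial>M) = 0" "square_integrable Y" "msq Y = \<Delta>"
        using dW[OF that] unfolding Y_def by auto
      show "integrable M (\<lambda>\<omega>. (y (incr q j \<omega>))\<^sup>2)"
        "(\<integral>\<omega>. (y (incr q j \<omega>))\<^sup>2 \<partial>M) = r\<^sup>2 * \<Delta>\<^sup>2 + \<sigma>\<^sup>2 * \<Delta>"
        unfolding ysq Y_def[symmetric] using Y by (simp_all add: prob_space)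
      show "(\<integral>\<omega>. y (incr q j \<omega>) \<partial>M) = r * \<Delta>"
        unfolding y_def Y_def[symmetric] using Y by (simp add: prob_space)
    qed
    have \<kappa>_moments: "integrable M (\<lambda>\<omega>. (\<kappa> (incr q j \<omega>))\<^sup>2)"
      "(\<integral>\<omega>. \<kappa> (incr q j \<omega>) \<partial>M) = m \<Delta>"
      "(\<integral>\<omega>. (\<kappa> (incr q j \<omega>))\<^sup>2 \<partial>M) = v \<Delta>" if "j < Suc n" for j
      using euler_defect_moments[OF q(3) q_le, of j r \<sigma>] that unfolding q_diff \<kappa>_def m_def v_def by simp_all
    have y_meas: "y \<in> borel_measurable borel" and \<kappa>_meas: "\<kappa> \<in> borel_measurable borel"
      unfolding y_def \<kappa>_def by measurable
    have \<Phi>: "square_integrable \<Phi>" "msq \<Phi>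
        \<le> (2 * real (Suc n) * (r * \<Delta>)\<^sup>2 + 2 * (r\<^sup>2 * \<Delta>\<^sup>2 + \<sigma>\<^sup>2 * \<Delta>)) * (\<Sum>j<Suc n. a N (q j))"
      unfolding \<Phi>_def a_def
      by (rule transform_second_moment_le; (use q in \<open>simp add: q_le ADF AD_int y_meas y_moments\<close>))+
    have Q: "square_integrable Q" "msq Q
        \<le> (2 * real (Suc n) * (m \<Delta>)\<^sup>2 + 2 * v \<Delta>) * (\<Sum>j<Suc n. msq (\<lambda>\<omega>. indicator (A N (q j)) \<omega> * G (q j) \<omega>))"
      unfolding Q_def
      by (rule transform_second_moment_le; (use q in \<open>simp add: q_le AGF AG_int \<kappa>_meas \<kappa>_moments\<close>))+
    have err_meas [measurable]: "err \<in> borel_measurable M"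
    proof -
      have "X (q j) \<in> borel_measurable M" if "j \<le> Suc n" for j
        using measurable_F_M[OF XF[OF q(2)[OF that]]] .
      moreover have "(\<lambda>\<omega>. y (incr q j \<omega>)) \<in> borel_measurable M" if "j < Suc n" for j
        by (rule measurable_compose[OF borel_measurable_diff[OF WM WM] y_meas]) (use that in auto)
      ultimately show ?thesis
        unfolding err_def q0(2)[symmetric]
        by (intro borel_measurable_add borel_measurable_diff borel_measurable_sum borel_measurable_times) auto
    qed
    \<comment> \<open>On \<open>A N s\<close> the indicators at all earlier times are 1, since the
      events decrease in time; the truncated sums are then the full ones.\<close>
    have D_eq: "D s \<omega> = \<Phi> \<omega> + Q \<omega> - err \<omega>" if \<omega>: "\<omega> \<in> A N s" for \<omega>
    proof -
      define z where "z j = W (q (Suc j)) \<omega> - W (q j) \<omega>" for j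
      have ind: "indicator (A N (q j)) \<omega> = (1::real)" if "j < Suc n" for j
        using A_mono[of "q j" s N] \<omega> q(1)[of j] that by auto
      have G_step: "G (q (Suc j)) \<omega> - G (q j) \<omega> = G (q j) \<omega> * (y (z j) - \<kappa> (z j))" for j
      proof -
        have q_Suc: "q (Suc j) = q j + \<Delta>" using q_diff[of j] by simp
        have "g * (q (Suc j) - t) + \<sigma> * (W (q (Suc j)) \<omega> - W t \<omega>)
          = (g * (q j - t) + \<sigma> * (W (q j) \<omega> - W t \<omega>)) + (g * \<Delta> + \<sigma> * z j)" for g
          unfolding z_def unfolding q_Suc by (simp only: algebra_simps)
        then have "G (q (Suc j)) \<omega> = G (q j) \<omega> * exp ((r - \<sigma>\<^sup>2 / 2) * \<Delta> + \<sigma> * z j)"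
          unfolding G_def by (simp only: exp_add mult.assoc)
        then show ?thesis by (simp add: y_def \<kappa>_def algebra_simps)
      qed
      have "G s \<omega> - x = (\<Sum>j<Suc n. G (q (Suc j)) \<omega> - G (q j) \<omega>)"
      proof -
        have "G t \<omega> = x" by (simp add: G_def)
        then show ?thesis
          using sum_lessThan_telescope[of "\<lambda>j. G (q j) \<omega>" "Suc n"] unfolding q0 by simp
      qed
      also have "\<dots> = (\<Sum>j<Suc n. G (q j) \<omega> * y (z j)) - (\<Sum>j<Suc n. G (q j) \<omega> * \<kappa> (z j))"
        unfolding G_step right_diff_distrib sum_subtractf ..
      finally have G_eq: "G s \<omega> = x + (\<Sum>j<Suc n. G (q j) \<omega> * y (z j)) - (\<Sum>j<Suc n. G (q j) \<omega> * \<kappa> (z j))"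
        by linarith
      have \<Phi>_eq: "\<Phi> \<omega> = (\<Sum>j<Suc n. X (q j) \<omega> * y (z j)) - (\<Sum>j<Suc n. G (q j) \<omega> * y (z j))"
        unfolding \<Phi>_def z_def sum_subtractf[symmetric]
        by (intro sum.cong refl) (simp add: ind D_def left_diff_distrib)
      have Q_eq: "Q \<omega> = (\<Sum>j<Suc n. G (q j) \<omega> * \<kappa> (z j))"
        unfolding Q_def z_def by (intro sum.cong refl) (simp add: ind)
      have "err \<omega> = x + (\<Sum>j<Suc n. X (q j) \<omega> * y (z j)) - X s \<omega>"
        unfolding err_def z_def ..
      then show ?thesis unfolding D_def using G_eq \<Phi>_eq Q_eq by linarith
    qed
    define E where "E = {\<omega>\<in>space M. \<eta> < \<bar>err \<omega>\<bar>}"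
    have [measurable]: "E \<in> sets M" unfolding E_def by measurable
    have ptw: "(indicator (A N s) \<omega> * D s \<omega>)\<^sup>2
        \<le> 3 * (\<Phi> \<omega>)\<^sup>2 + 3 * (Q \<omega>)\<^sup>2 + 3 * \<eta>\<^sup>2 + 4 * (real N)\<^sup>2 * indicator E \<omega>" if "\<omega> \<in> space M" for \<omega>
    proof (cases "\<omega> \<in> A N s \<and> \<omega> \<notin> E")
      case True
      then have "\<bar>err \<omega>\<bar> \<le> \<bar>\<eta>\<bar>" using \<open>\<omega> \<in> space M\<close> \<open>\<eta> > 0\<close> by (auto simp: E_def)
      then have err: "(err \<omega>)\<^sup>2 \<le> \<eta>\<^sup>2" unfolding abs_le_square_iff .
      have "(u + v - w)\<^sup>2 \<le> 3 * u\<^sup>2 + 3 * v\<^sup>2 + 3 * w\<^sup>2" for u v w :: real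
        using zero_le_power2[of "u - v"] zero_le_power2[of "u + w"] zero_le_power2[of "v + w"]
        by (simp add: power2_eq_square algebra_simps)
      from this[of "\<Phi> \<omega>" "Q \<omega>" "err \<omega>"] err True D_eq[of \<omega>]
      show ?thesis by simp
    next
      case False
      then show ?thesis
      proof (cases "\<omega> \<in> E")
        case True
        then show ?thesis using AD_sq[of s N \<omega>] s by (simp add: add_increasing)
      qed auto
    qed
    have int_r: "integrable M (\<lambda>\<omega>. 3 * (\<Phi> \<omega>)\<^sup>2 + 3 * (Q \<omega>)\<^sup>2 + 3 * \<eta>\<^sup>2 + 4 * (real N)\<^sup>2 * indicator E \<omega>)"
      using \<Phi>(1) Q(1) by (intro Bochner_Integration.integrable_add integrable_mult_right integrable_real_indicator)
        (auto simp: emeasure_eq_measure)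
    have "a N s \<le> (\<integral>\<omega>. 3 * (\<Phi> \<omega>)\<^sup>2 + 3 * (Q \<omega>)\<^sup>2 + 3 * \<eta>\<^sup>2 + 4 * (real N)\<^sup>2 * indicator E \<omega> \<partial>M)"
      unfolding a_def using s by (intro integral_mono AD_int int_r ptw) auto
    also have "\<dots> = 3 * msq \<Phi> + 3 * msq Q + 3 * \<eta>\<^sup>2 + 4 * (real N)\<^sup>2 * prob E"
      using \<Phi>(1) Q(1) by (simp add: prob_space emeasure_eq_measure)
    finally have a_le: "a N s \<le> 3 * msq \<Phi> + 3 * msq Q + 3 * \<eta>\<^sup>2 + 4 * (real N)\<^sup>2 * prob E" .
    have "(2 * real (Suc n) * (r * \<Delta>)\<^sup>2 + 2 * (r\<^sup>2 * \<Delta>\<^sup>2 + \<sigma>\<^sup>2 * \<Delta>)) \<le> C * \<Delta>"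
    proof -
      have K: "real (Suc n) * \<Delta> = s - t" by (simp add: \<Delta>_def del: of_nat_Suc)
      have "2 * real (Suc n) * (r * \<Delta>)\<^sup>2 + 2 * (r\<^sup>2 * \<Delta>\<^sup>2 + \<sigma>\<^sup>2 * \<Delta>)
        = (2 * r\<^sup>2 * (real (Suc n) * \<Delta>) + 2 * r\<^sup>2 * \<Delta> + 2 * \<sigma>\<^sup>2) * \<Delta>"
        by (simp add: power2_eq_square algebra_simps)
      also have "\<dots> \<le> C * \<Delta>"
      proof (rule mult_right_mono)
        have "2 * r\<^sup>2 * (s - t) \<le> 2 * r\<^sup>2 * (T - t)" "2 * r\<^sup>2 * \<Delta> \<le> 2 * r\<^sup>2 * (T - t)"
          using s \<Delta> by (intro mult_left_mono; simp)+
        then show "2 * r\<^sup>2 * (real (Suc n) * \<Delta>) + 2 * r\<^sup>2 * \<Delta> + 2 * \<sigma>\<^sup>2 \<le> C"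
          unfolding K C_def by linarith
      qed (use \<Delta> in simp)
      finally show ?thesis .
    qed
    moreover have "0 \<le> (\<Sum>j<Suc n. a N (q j))"
      unfolding a_def by (intro sum_nonneg) simp
    ultimately have "msq \<Phi> \<le> C * \<Delta> * (\<Sum>j<Suc n. a N (q j))"
      using \<Phi>(2) by (meson mult_right_mono order_trans)
    moreover have "msq Q \<le> (2 * real (Suc n) * (m \<Delta>)\<^sup>2 + 2 * v \<Delta>) * (real (Suc n) * (real N)\<^sup>2)"
    proof (rule order_trans[OF Q(2)], rule mult_left_mono)
      have "msq (\<lambda>\<omega>. indicator (A N (q j)) \<omega> * G (q j) \<omega>) \<le> (real N)\<^sup>2" if "j < Suc n" for j
      proof -
        have "msq (\<lambda>\<omega>. indicator (A N (q j)) \<omega> * G (q j) \<omega>) \<le> (\<integral>\<omega>. (real N)\<^sup>2 \<partial>M)"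
          using q(2)[of j] that by (intro integral_mono AG_int AG_sq) auto
        then show ?thesis by (simp add: prob_space)
      qed
      then have "(\<Sum>j<Suc n. msq (\<lambda>\<omega>. indicator (A N (q j)) \<omega> * G (q j) \<omega>)) \<le> (\<Sum>j<Suc n. (real N)\<^sup>2)"
        by (intro sum_mono) auto
      then show "(\<Sum>j<Suc n. msq (\<lambda>\<omega>. indicator (A N (q j)) \<omega> * G (q j) \<omega>)) \<le> real (Suc n) * (real N)\<^sup>2"
        unfolding sum_constant card_lessThan by (simp only: of_nat_mult)
      have "0 \<le> v \<Delta>" unfolding \<kappa>_moments(3)[of 0, symmetric, OF zero_less_Suc] by simp
      then show "0 \<le> 2 * real (Suc n) * (m \<Delta>)\<^sup>2 + 2 * v \<Delta>" by simp
    qed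
    ultimately have "a N s \<le> 3 * (C * \<Delta> * (\<Sum>j<Suc n. a N (q j)))
      + 3 * ((2 * real (Suc n) * (m \<Delta>)\<^sup>2 + 2 * v \<Delta>) * (real (Suc n) * (real N)\<^sup>2)) + 3 * \<eta>\<^sup>2 + 4 * (real N)\<^sup>2 * prob E"
      using a_le by linarith
    then show ?thesis
      unfolding E_def err_def y_def \<Delta>_def q_def by (simp only: mult.assoc)
  qed
  \<comment> \<open>Each use of \<open>step\<close> halves the bound: the Riemann sums of the weight
    with rate \<open>6 * C\<close> are at most \<open>exp (6 * C * (u - t)) / (6 * C)\<close>, and
    the factor \<open>3 * C\<close> leaves one half.\<close>
  have decay: "a N u \<le> 4 * (real N)\<^sup>2 * (1 / 2) ^ k * exp (6 * C * (u - t))" if "u \<in> {t..T}" for N k u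
    using that
  proof (induction k arbitrary: u)
    case 0
    have "a N u \<le> (\<integral>\<omega>. 4 * (real N)\<^sup>2 \<partial>M)"
      unfolding a_def using 0 by (intro integral_mono AD_int AD_sq) auto
    also have "\<dots> \<le> 4 * (real N)\<^sup>2 * exp (6 * C * (u - t))"
    proof -
      have "0 \<le> C" using 0 by (auto simp: C_def)
      then have "1 \<le> exp (6 * C * (u - t))" using 0 by simp
      from mult_left_mono[OF this, of "4 * (real N)\<^sup>2"] show ?thesis by (simp add: prob_space)
    qed
    finally show ?case by simp
  next
    case (Suc k)
    define B where "B = 4 * (real N)\<^sup>2 * (1 / 2) ^ k"
    have B: "B \<ge> 0" by (simp add: B_def)
    have IH: "a N u \<le> B * exp (6 * C * (u - t))" if "u \<in> {t..T}" for u
      using Suc.IH[OF that] by (simp add: B_def)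
    have C: "C > 0" using Suc.prems by (auto simp: C_def intro!: add_nonneg_pos)
    show ?case
    proof (cases "u = t")
      case True
      have "AE \<omega> in M. X t \<omega> = x" using sde by (simp add: sde_solution_def)
      then have "AE \<omega> in M. (indicator (A N t) \<omega> * D t \<omega>)\<^sup>2 = 0"
        by eventually_elim (simp add: D_def G_def)
      then have "a N t = 0" unfolding a_def by (rule integral_eq_zero_AE)
      then show ?thesis using True by simp
    next
      case False
      then have u: "t < u" "u \<le> T" using Suc.prems by auto
      define P where "P \<eta> n = prob {\<omega>\<in>space M. \<eta> < \<bar>x + (\<Sum>j<Suc n. X (?q u n j) \<omega>
        * (r * ((u - t) / real (Suc n)) + \<sigma> * (incr (?q u n) j \<omega>))) - X u \<omega>\<bar>}" for \<eta> n
      define K where "K n = 3 * ((2 * real (Suc n) * (m ((u - t) / real (Suc n)))\<^sup>2 + 2 * v ((u - t) / real (Suc n))) * (real (Suc n) * (real N)\<^sup>2))" for n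
      have P: "P \<eta> \<longlonglongrightarrow> 0" if "\<eta> > 0" for \<eta>
        using converges_in_probD[OF linear_sde_euler_error[OF t sde u] that] unfolding P_def[abs_def] .
      have K: "K \<longlonglongrightarrow> 0"
      proof -
        have m: "(\<lambda>n. real (Suc n) * m ((u - t) / real (Suc n))) \<longlonglongrightarrow> 0"
          unfolding m_def by (rule tendsto_Suc_times_of_deriv_zero) (use u in \<open>auto intro!: derivative_eq_intros\<close>)
        have v: "(\<lambda>n. real (Suc n) * v ((u - t) / real (Suc n))) \<longlonglongrightarrow> 0"
          unfolding v_def by (rule tendsto_Suc_times_of_deriv_zero)
            (use u in \<open>auto intro!: derivative_eq_intros simp: algebra_simps\<close>)
        \<comment> \<open>The accumulated defect consists of \<open>(Suc n * m)\<^sup>2\<close> and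
          \<open>Suc n * v\<close> up to a constant factor, and both tend to 0.\<close>
        have "K n = 6 * (real N)\<^sup>2 * ((real (Suc n) * m ((u - t) / real (Suc n)))\<^sup>2 + real (Suc n) * v ((u - t) / real (Suc n)))" for n
          unfolding K_def by (simp only: power_mult_distrib power2_eq_square distrib_left distrib_right mult_ac)
        then have "K = (\<lambda>n. 6 * (real N)\<^sup>2 * ((real (Suc n) * m ((u - t) / real (Suc n)))\<^sup>2 + real (Suc n) * v ((u - t) / real (Suc n))))"
          by (rule ext)
        moreover have "\<dots> \<longlonglongrightarrow> 6 * (real N)\<^sup>2 * (0\<^sup>2 + 0)"
          by (intro tendsto_intros m v)
        ultimately show ?thesis by simp
      qed
      have main: "a N u \<le> B / 2 * exp (6 * C * (u - t)) + e" if e: "e > 0" for e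
      proof -
        define \<eta> where "\<eta> = sqrt (e / 3)"
        have \<eta>: "\<eta> > 0" "3 * \<eta>\<^sup>2 = e" using e by (auto simp: \<eta>_def)
        have "a N u \<le> B / 2 * exp (6 * C * (u - t)) + (K n + e + 4 * (real N)\<^sup>2 * P \<eta> n)" for n
        proof -
          have "(u - t) / real (Suc n) * (\<Sum>j<Suc n. a N (?q u n j))
            \<le> (u - t) / real (Suc n) * (\<Sum>j<Suc n. B * exp (6 * C * (?q u n j - t)))"
          proof (intro mult_left_mono sum_mono IH)
            fix j assume "j \<in> {..<Suc n}"
            then show "?q u n j \<in> {t..T}" using mesh_bounds[of t u j n] u by auto
          qed (use u in auto)
          also have "\<dots> = B * ((u - t) / real (Suc n) * (\<Sum>j<Suc n. exp (6 * C * (?q u n j - t))))"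
            unfolding sum_distrib_left[symmetric] by (simp only: mult_ac)
          also have "\<dots> \<le> B * (exp (6 * C * (u - t)) / (6 * C))"
            using u C by (intro mult_left_mono geometric_riemann_sum_le B) auto
          finally have "3 * C * ((u - t) / real (Suc n) * (\<Sum>j<Suc n. a N (?q u n j))) \<le> 3 * C * (B * (exp (6 * C * (u - t)) / (6 * C)))"
            using C by (intro mult_left_mono) auto
          also have "\<dots> = B / 2 * exp (6 * C * (u - t))"
            using C by (simp add: field_simps)
          finally have "3 * C * ((u - t) / real (Suc n)) * (\<Sum>j<Suc n. a N (?q u n j)) \<le> B / 2 * exp (6 * C * (u - t))"
            by (simp only: mult.assoc)
          with step[OF u \<eta>(1), of N n] show ?thesis
            unfolding P_def K_def \<eta>(2) by linarith
        qed
        moreover have "(\<lambda>n. B / 2 * exp (6 * C * (u - t)) + (K n + e + 4 * (real N)\<^sup>2 * P \<eta> n))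
           \<longlonglongrightarrow> B / 2 * exp (6 * C * (u - t)) + (0 + e + 4 * (real N)\<^sup>2 * 0)"
          by (intro tendsto_intros K P \<eta>)
        ultimately show ?thesis
          by (intro LIMSEQ_le_const) auto
      qed
      have "a N u \<le> B / 2 * exp (6 * C * (u - t))"
        by (rule field_le_epsilon) (rule main)
      then show ?thesis by (simp add: B_def)
    qed
  qed
  have "AE \<omega> in M. indicator (A N s) \<omega> * D s \<omega> = 0" for N
  proof -
    have "(\<lambda>k. 4 * (real N)\<^sup>2 * (1 / 2) ^ k * exp (6 * C * (s - t))) \<longlonglongrightarrow> 4 * (real N)\<^sup>2 * 0 * exp (6 * C * (s - t))"
      by (intro tendsto_intros LIMSEQ_power_zero) simp
    then have "a N s \<le> 4 * (real N)\<^sup>2 * 0 * exp (6 * C * (s - t))"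
      by (rule LIMSEQ_le_const) (use decay[OF s] in auto)
    moreover have "0 \<le> a N s" unfolding a_def by simp
    ultimately have "a N s = 0" by simp
    then have "AE \<omega> in M. (indicator (A N s) \<omega> * D s \<omega>)\<^sup>2 = 0"
      unfolding a_def by (subst (asm) integral_nonneg_eq_0_iff_AE[OF AD_int[OF s]]) auto
    then show ?thesis by simp
  qed
  then have "AE \<omega> in M. \<forall>N. indicator (A N s) \<omega> * D s \<omega> = 0"
    by (subst AE_all_countable) simp
  with AE_space have "AE \<omega> in M. D s \<omega> = 0"
  proof eventually_elim
    case (elim \<omega>)
    \<comment> \<open>A continuous path on a compact interval is bounded, so every outcome lies in
      \<open>A N s\<close> for some \<open>N\<close>.\<close>
    have "bounded ((\<lambda>v. X v \<omega>) ` {t..s})" "bounded ((\<lambda>v. G v \<omega>) ` {t..s})"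
      using Xcont[OF elim(1), of s] Gcont[OF elim(1), of s] s
      by (auto intro!: compact_imp_bounded compact_continuous_image)
    then obtain b b' where b: "\<forall>z\<in>(\<lambda>v. X v \<omega>) ` {t..s}. norm z \<le> b" "\<forall>z\<in>(\<lambda>v. G v \<omega>) ` {t..s}. norm z \<le> b'"
      unfolding bounded_iff by blast
    obtain N :: nat where "max b b' \<le> real N" using real_arch_simple by blast
    then have "\<omega> \<in> A N s" using b elim(1) unfolding A_def by force
    then show ?case using elim(2) by (auto dest: spec[of _ N])
  qed
  then show ?thesis by eventually_elim (simp add: D_def G_def)
qed

end

section \<open>The put option\<close>

lemma isCont_cdf_std_normal: "isCont (cdf gauss) c"
proof -
  interpret real_distribution gauss by (rule real_dist_normal_dist)
  have "emeasure gauss {c} = 0"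
    using AE_lborel_singleton[of c]
    by (subst emeasure_density) (auto intro!: nn_integral_0_iff_AE[THEN iffD2] elim!: eventually_mono)
  then show ?thesis
    unfolding isCont_cdf measure_def by simp
qed

text \<open>Whether the least index equals \<open>j\<close> is decided by the conditions up to
  \<open>j\<close>. This is what makes the events of a first passage index adapted.\<close>

lemma sets_Least_eq:
  fixes P :: "nat \<Rightarrow> 'a \<Rightarrow> bool"
  assumes sets: "\<And>i. i \<le> j \<Longrightarrow> {\<omega>\<in>space N. P i \<omega>} \<in> sets N" and ex: "\<And>\<omega>. \<exists>i. P i \<omega>"
  shows "{\<omega>\<in>space N. (LEAST i. P i \<omega>) = j} \<in> sets N"
proof -
  have "(LEAST i. P i \<omega>) = j \<longleftrightarrow> P j \<omega> \<and> (\<forall>i\<in>{..<j}. \<not> P i \<omega>)" for \<omega>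
  proof
    assume eq: "(LEAST i. P i \<omega>) = j"
    have "P j \<omega>" using LeastI_ex[OF ex[of \<omega>]] unfolding eq .
    moreover have "\<not> P i \<omega>" if "i < j" for i
      using not_less_Least[of i "\<lambda>i. P i \<omega>"] that unfolding eq by blast
    ultimately show "P j \<omega> \<and> (\<forall>i\<in>{..<j}. \<not> P i \<omega>)" by simp
  next
    assume *: "P j \<omega> \<and> (\<forall>i\<in>{..<j}. \<not> P i \<omega>)"
    show "(LEAST i. P i \<omega>) = j"
    proof (rule Least_equality)
      show "j \<le> i" if "P i \<omega>" for i using * that by (metis lessThan_iff not_le)
    qed (use * in simp)
  qed
  moreover have "{\<omega>\<in>space N. P j \<omega> \<and> (\<forall>i\<in>{..<j}. \<not> P i \<omega>)} \<in> sets N"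
  proof (intro sets.sets_Collect_conj sets.sets_Collect_finite_All sets.sets_Collect_neg)
    show "{\<omega> \<in> space N. P j \<omega>} \<in> sets N" by (rule sets) simp
    show "{\<omega> \<in> space N. P i \<omega>} \<in> sets N" if "i \<in> {..<j}" for i using that by (intro sets) simp
  qed simp
  ultimately show ?thesis by simp
qed

text \<open>The bound is stated for every \<open>f\<close>, measurable or not: a non-integrable
  function has expectation 0 by convention, which \<open>0 \<le> B\<close> covers.\<close>

lemma (in prob_space) expectation_le_if_AE_le:
  assumes "AE \<omega> in M. f \<omega> \<le> (B::real)" "0 \<le> B"
  shows "expectation f \<le> B"
proof (cases "integrable M f")
  case True
  then have "expectation f \<le> (\<integral>\<omega>. B \<partial>M)" using assms by (intro integral_mono_AE) auto
  then show ?thesis by (simp add: prob_space)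
qed (use assms in \<open>simp add: not_integrable_integral_eq\<close>)

locale gbm_put = brownian_setting M F W
  for M :: "'a measure" and F and W :: "real \<Rightarrow> 'a \<Rightarrow> real" +
  fixes T r \<sigma> K\<^sub>T t x :: real and X :: "real \<Rightarrow> 'a \<Rightarrow> real" and K :: "real \<Rightarrow> real"
  assumes r_pos: "r > 0" and \<sigma>_pos: "\<sigma> > 0" and K\<^sub>T_pos: "K\<^sub>T > 0"
    and t: "t \<in> {0..<T}" and x: "x > 0"
    and sde: "sde_solution M F W (\<lambda>y. r * y) (\<lambda>y. \<sigma> * y) t T x X"
    and K: "\<And>s. s \<in> {0..T} \<Longrightarrow>
      K s = 2 * K\<^sub>T * exp (- (r - \<sigma>\<^sup>2 / 2) * (T - s)) * cdf gauss (\<sigma> * sqrt (T - s))"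
begin

definition boundary :: "real \<Rightarrow> real" where
  "boundary s = K\<^sub>T * exp (- (r - \<sigma>\<^sup>2 / 2) * (T - s))"

text \<open>The Brownian motion restarted at time \<open>t\<close>; the process \<open>B\<close> of
  the overview is \<open>y\<^sub>0 + w\<close>.\<close>

definition w :: "real \<Rightarrow> 'a \<Rightarrow> real" where
  "w s \<omega> = W s \<omega> - W t \<omega>"

definition y\<^sub>0 :: real where
  "y\<^sub>0 = ln (x / boundary t) / \<sigma>"

text \<open>The discount factor from \<open>s\<close> to \<open>t\<close> times the factor
  \<open>K\<^sub>T * exp (- r * (T - s))\<close> of the strike; the dependence on \<open>s\<close>
  cancels.\<close>

definition \<kappa> :: real where
  "\<kappa> = K\<^sub>T * exp (- r * (T - t))"

abbreviation abs_mean :: "real \<Rightarrow> real \<Rightarrow> real" where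
  "abs_mean s y \<equiv> abs_exp_mean \<sigma> (sqrt (T - s)) y"

abbreviation exp_mean :: "real \<Rightarrow> real \<Rightarrow> real" where
  "exp_mean s y \<equiv> exp (\<sigma> * y + \<sigma>\<^sup>2 * (T - s) / 2)"

definition payoff :: "real \<Rightarrow> 'a \<Rightarrow> real" where
  "payoff s \<omega> = exp (- r * (s - t)) * max 0 (K s - X s \<omega>)"

section \<open>Strike, price and payoff in terms of the driftless Brownian motion\<close>

lemma boundary_pos: "boundary s > 0"
  using K\<^sub>T_pos by (simp add: boundary_def)

lemma \<kappa>_pos: "\<kappa> > 0"
  using K\<^sub>T_pos by (simp add: \<kappa>_def)

lemma K_eq: "s \<in> {0..T} \<Longrightarrow> K s = K\<^sub>T * exp (- r * (T - s)) * abs_mean s 0"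
proof -
  assume s: "s \<in> {0..T}"
  have "exp (- (r - \<sigma>\<^sup>2 / 2) * (T - s)) = exp (- r * (T - s)) * exp ((\<sigma> * sqrt (T - s))\<^sup>2 / 2)"
    using s by (simp add: mult_exp_exp power_mult_distrib left_diff_distrib)
  then show ?thesis
    using s by (simp add: K abs_exp_mean_zero)
qed

lemma abs_mean_zero_le: "s \<in> {0..T} \<Longrightarrow> abs_mean s 0 \<le> 2 * exp (\<sigma>\<^sup>2 * T / 2)"
proof -
  assume s: "s \<in> {0..T}"
  interpret N: real_distribution gauss by (rule real_dist_normal_dist)
  have "exp ((\<sigma> * sqrt (T - s))\<^sup>2 / 2) \<le> exp (\<sigma>\<^sup>2 * T / 2)"
    using s by (simp add: power_mult_distrib mult_left_mono)
  moreover have "cdf gauss (\<sigma> * sqrt (T - s)) \<le> 1" by (rule N.cdf_bounded_prob)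
  ultimately have "exp ((\<sigma> * sqrt (T - s))\<^sup>2 / 2) * cdf gauss (\<sigma> * sqrt (T - s)) \<le> exp (\<sigma>\<^sup>2 * T / 2) * 1"
    by (intro mult_mono) (auto simp: N.cdf_nonneg)
  then show ?thesis using s by (simp add: abs_exp_mean_zero)
qed

lemma continuous_on_K: "continuous_on {0..T} K"
proof -
  have "continuous_on UNIV (cdf gauss)"
    unfolding continuous_on_eq_continuous_at[OF open_UNIV] by (intro ballI isCont_cdf_std_normal)
  moreover have "continuous_on {0..T} (\<lambda>s. \<sigma> * sqrt (T - s))"
    by (intro continuous_intros)
  ultimately have "continuous_on {0..T} (\<lambda>s. cdf gauss (\<sigma> * sqrt (T - s)))"
    by (rule continuous_on_compose2) simp
  then have "continuous_on {0..T} (\<lambda>s. 2 * K\<^sub>T * exp (- (r - \<sigma>\<^sup>2 / 2) * (T - s)) * cdf gauss (\<sigma> * sqrt (T - s)))"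
    by (intro continuous_on_mult continuous_on_exp continuous_on_diff continuous_on_const continuous_on_id)
  then show ?thesis
    using K by (subst continuous_on_cong[OF refl]) auto
qed

lemma X_measurable_F: "s \<in> {t..T} \<Longrightarrow> X s \<in> borel_measurable (F s)"
  using sde by (simp add: sde_solution_def)

lemma X_measurable [measurable]: "s \<in> {t..T} \<Longrightarrow> X s \<in> borel_measurable M"
  using X_measurable_F by (rule measurable_F_M)

lemma X_continuous: "\<omega> \<in> space M \<Longrightarrow> continuous_on {t..T} (\<lambda>s. X s \<omega>)"
  using sde by (simp add: sde_solution_def)

lemma w_measurable_F: "s \<in> {t..T} \<Longrightarrow> w s \<in> borel_measurable (F s)"
proof -
  assume s: "s \<in> {t..T}"
  then have [measurable]: "W s \<in> borel_measurable (F s)" "W t \<in> borel_measurable (F s)"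
    using t by (auto intro: W_measurable_F)
  show ?thesis unfolding w_def by measurable
qed

lemma w_continuous: "\<omega> \<in> space M \<Longrightarrow> continuous_on {t..T} (\<lambda>s. w s \<omega>)"
  unfolding w_def using continuous_on_subset[OF W_continuous, of \<omega> "{t..T}"] t
  by (intro continuous_intros) auto

lemma x_eq: "x = boundary t * exp (\<sigma> * y\<^sub>0)"
  using x \<sigma>_pos boundary_pos[of t] by (simp add: y\<^sub>0_def)

text \<open>Uniqueness holds at each time outside a null set that depends on the time. Countably
  many mesh points share one null set, and continuity extends the identity to all times, so that it
  can be used at random times.\<close>

lemma AE_X_eq: "AE \<omega> in M. \<forall>s\<in>{t..T}. X s \<omega> = boundary s * exp (\<sigma> * (y\<^sub>0 + w s \<omega>))"
proof -
  define G where "G s \<omega> = boundary s * exp (\<sigma> * (y\<^sub>0 + w s \<omega>))" for s \<omega>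
  have G: "x * exp ((r - \<sigma>\<^sup>2 / 2) * (s - t) + \<sigma> * (W s \<omega> - W t \<omega>)) = G s \<omega>" for s \<omega>
    unfolding G_def w_def by (subst x_eq) (simp add: boundary_def mult_exp_exp algebra_simps diff_divide_distrib)
  have "AE \<omega> in M. \<forall>n. \<forall>j. j \<le> Suc n \<longrightarrow> X (mesh t T n j) \<omega> - G (mesh t T n j) \<omega> = 0"
  proof (subst AE_all_countable, intro allI, subst AE_all_countable, intro allI)
    fix n j
    show "AE \<omega> in M. j \<le> Suc n \<longrightarrow> X (mesh t T n j) \<omega> - G (mesh t T n j) \<omega> = 0"
    proof (cases "j \<le> Suc n")
      case True
      then have "mesh t T n j \<in> {t..T}" using t by (intro mesh_bounds) auto
      then have "AE \<omega> in M. X (mesh t T n j) \<omega> = G (mesh t T n j) \<omega>"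
        using linear_sde_unique[OF _ sde, of "mesh t T n j"] t unfolding G by simp
      then show ?thesis by eventually_elim simp
    qed simp
  qed
  with AE_space show ?thesis
  proof eventually_elim
    case (elim \<omega>)
    have cont: "continuous_on {t..T} (\<lambda>s. X s \<omega> - G s \<omega>)"
      unfolding G_def boundary_def by (intro continuous_intros X_continuous w_continuous elim)
    show ?case
    proof
      fix s assume s: "s \<in> {t..T}"
      have "X s \<omega> - G s \<omega> \<in> {0}"
        by (rule continuous_on_closed_mesh[OF cont _ _ s]) (use elim(2) in auto)
      then show "X s \<omega> = boundary s * exp (\<sigma> * (y\<^sub>0 + w s \<omega>))" by (simp add: G_def)
    qed
  qed
qed

lemma discounted_gain_eq:
  assumes "s \<in> {t..T}"
  shows "exp (- r * (s - t)) * (K s - boundary s * exp (\<sigma> * y)) = \<kappa> * (abs_mean s 0 - exp_mean s y)"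
proof -
  have "exp (- r * (s - t)) * K s = \<kappa> * abs_mean s 0"
    using assms t by (simp add: K_eq \<kappa>_def mult_exp_exp algebra_simps)
  moreover have "exp (- r * (s - t)) * (boundary s * exp (\<sigma> * y)) = \<kappa> * exp_mean s y"
    by (simp add: boundary_def \<kappa>_def mult_exp_exp algebra_simps diff_divide_distrib)
  ultimately show ?thesis by (simp add: right_diff_distrib)
qed

lemma AE_payoff_eq:
  "AE \<omega> in M. \<forall>s\<in>{t..T}. payoff s \<omega> = \<kappa> * max 0 (abs_mean s 0 - exp_mean s (y\<^sub>0 + w s \<omega>))"
  using AE_X_eq
proof eventually_elim
  case (elim \<omega>)
  show ?case
  proof
    fix s assume s: "s \<in> {t..T}"
    have "payoff s \<omega> = max 0 (exp (- r * (s - t)) * (K s - boundary s * exp (\<sigma> * (y\<^sub>0 + w s \<omega>))))"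
      unfolding payoff_def using elim s by (simp add: max_mult_distrib_left)
    also have "\<dots> = \<kappa> * max 0 (abs_mean s 0 - exp_mean s (y\<^sub>0 + w s \<omega>))"
      unfolding discounted_gain_eq[OF s] using \<kappa>_pos by (simp add: max_mult_distrib_left)
    finally show "payoff s \<omega> = \<kappa> * max 0 (abs_mean s 0 - exp_mean s (y\<^sub>0 + w s \<omega>))" .
  qed
qed

lemma K_minus_x_eq: "K t - x = \<kappa> * (abs_mean t 0 - exp_mean t y\<^sub>0)"
  using discounted_gain_eq[of t y\<^sub>0] t x_eq by simp

lemma payoff_nonneg: "0 \<le> payoff s \<omega>"
  by (simp add: payoff_def)

definition payoff_bound :: real where
  "payoff_bound = \<kappa> * (2 * exp (\<sigma>\<^sup>2 * T / 2))"

lemma payoff_bound_nonneg: "0 \<le> payoff_bound"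
  using \<kappa>_pos by (simp add: payoff_bound_def)

lemma AE_payoff_le: "AE \<omega> in M. \<forall>s\<in>{t..T}. payoff s \<omega> \<le> payoff_bound"
  using AE_payoff_eq
proof eventually_elim
  case (elim \<omega>)
  have "\<kappa> * max 0 (abs_mean s 0 - exp_mean s (y\<^sub>0 + w s \<omega>)) \<le> payoff_bound" if s: "s \<in> {t..T}" for s
    unfolding payoff_bound_def
  proof (rule mult_left_mono)
    have "abs_mean s 0 \<le> 2 * exp (\<sigma>\<^sup>2 * T / 2)" using s t by (intro abs_mean_zero_le) auto
    moreover have "0 \<le> exp_mean s (y\<^sub>0 + w s \<omega>)" by simp
    ultimately show "max 0 (abs_mean s 0 - exp_mean s (y\<^sub>0 + w s \<omega>)) \<le> 2 * exp (\<sigma>\<^sup>2 * T / 2)"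
      by (intro max.boundedI) (simp, linarith)
  qed (use \<kappa>_pos in simp)
  then show ?case using elim by simp
qed

lemma payoff_measurable [measurable]: "s \<in> {t..T} \<Longrightarrow> payoff s \<in> borel_measurable M"
  unfolding payoff_def by measurable

section \<open>Optional stopping at grid times\<close>

lemma
  shows integrable_abs_exp_w: "integrable M (\<lambda>\<omega>. exp (\<sigma> * \<bar>c + w T \<omega>\<bar>))"
    and expectation_abs_exp_w: "(\<integral>\<omega>. exp (\<sigma> * \<bar>c + w T \<omega>\<bar>) \<partial>M) = abs_mean t c"
    and integrable_exp_w: "integrable M (\<lambda>\<omega>. exp (\<sigma> * (c + w T \<omega>)))"
    and expectation_exp_w: "(\<integral>\<omega>. exp (\<sigma> * (c + w T \<omega>)) \<partial>M) = exp_mean t c"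
proof -
  have tT: "0 \<le> t" "t \<le> T" using t by auto
  show "integrable M (\<lambda>\<omega>. exp (\<sigma> * \<bar>c + w T \<omega>\<bar>))"
    unfolding w_def using integrable_abs_exp[of \<sigma> c "sqrt (T - t)"]
    by (subst integrable_W_increment_iff[OF tT, of "\<lambda>z. exp (\<sigma> * \<bar>c + z\<bar>)"]) auto
  show "(\<integral>\<omega>. exp (\<sigma> * \<bar>c + w T \<omega>\<bar>) \<partial>M) = abs_mean t c"
    unfolding w_def abs_exp_mean_def
    by (subst integral_W_increment[OF tT, of "\<lambda>z. exp (\<sigma> * \<bar>c + z\<bar>)"]) auto
  have eq: "exp (\<sigma> * (c + w T \<omega>)) = exp (\<sigma> * c) * exp (\<sigma> * (W T \<omega> - W t \<omega>))" for \<omega>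
    by (simp add: w_def mult_exp_exp algebra_simps)
  show "integrable M (\<lambda>\<omega>. exp (\<sigma> * (c + w T \<omega>)))"
    unfolding eq by (intro integrable_mult_right integrable_W_increment_exp tT)
  show "(\<integral>\<omega>. exp (\<sigma> * (c + w T \<omega>)) \<partial>M) = exp_mean t c"
    unfolding eq by (simp add: expectation_W_increment_exp[OF tT] exp_add)
qed

text \<open>The martingale property of \<open>\<Psi>\<close> and \<open>M\<close>, tested on an
  event of \<open>F s\<close>. The starting points are separate because the upper bound starts
  \<open>\<Psi>\<close> at 0 and \<open>M\<close> at \<open>y\<^sub>0\<close>, while the lower bound
  starts both at \<open>y\<^sub>0\<close>.\<close>

lemma
  assumes s: "s \<in> {t..T}" and A: "A \<in> sets (F s)"
  shows integrable_freeze: "integrable M (\<lambda>\<omega>. indicator A \<omega> * (abs_mean s (c + w s \<omega>) - exp_mean s (d + w s \<omega>)))"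
    and expectation_freeze: "(\<integral>\<omega>. indicator A \<omega> * (abs_mean s (c + w s \<omega>) - exp_mean s (d + w s \<omega>)) \<partial>M)
      = (\<integral>\<omega>. indicator A \<omega> * (exp (\<sigma> * \<bar>c + w T \<omega>\<bar>) - exp (\<sigma> * (d + w T \<omega>))) \<partial>M)"
proof -
  have distr: "indicator A \<omega> * (p - q) = indicator A \<omega> * p - indicator A \<omega> * q" for \<omega> and p q :: real
    by (rule right_diff_distrib)
  have sT: "0 \<le> s" "s \<le> T" using s t by auto
  have AM [measurable]: "A \<in> sets M" using A sets_F_subset by blast
  have wT: "w T \<omega> = w s \<omega> + (W T \<omega> - W s \<omega>)" for \<omega> by (simp add: w_def)
  have c_meas: "(\<lambda>\<omega>. c + w s \<omega>) \<in> borel_measurable (F s)" for c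
    using w_measurable_F[OF s] by measurable
  have exp_mean_eq: "(\<integral>z. exp (\<sigma> * (y + sqrt (T - s) * z)) \<partial>gauss) = exp_mean s y" for y
  proof -
    have "exp (\<sigma> * (y + sqrt (T - s) * z)) = exp (\<sigma> * y) * exp ((\<sigma> * sqrt (T - s)) * z)" for z
      by (simp add: mult_exp_exp algebra_simps)
    then show ?thesis
      using sT by (simp add: integral_std_normal_exp power_mult_distrib exp_add)
  qed
  have 1: "integrable M (\<lambda>\<omega>. exp (\<sigma> * \<bar>(c + w s \<omega>) + (W T \<omega> - W s \<omega>)\<bar>))"
    using integrable_abs_exp_w[of c] unfolding wT by (simp only: add.assoc)
  have 2: "integrable M (\<lambda>\<omega>. exp (\<sigma> * ((d + w s \<omega>) + (W T \<omega> - W s \<omega>))))"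
    using integrable_exp_w[of d] unfolding wT by (simp only: add.assoc)
  note f1 = freezing[OF sT A c_meas _ 1, folded abs_exp_mean_def]
  note f2 = freezing[OF sT A c_meas _ 2, unfolded exp_mean_eq]
  have int1: "integrable M (\<lambda>\<omega>. indicator A \<omega> * abs_mean s (c + w s \<omega>))" using f1(2) by simp
  have int2: "integrable M (\<lambda>\<omega>. indicator A \<omega> * exp_mean s (d + w s \<omega>))" using f2(2) by simp
  show "integrable M (\<lambda>\<omega>. indicator A \<omega> * (abs_mean s (c + w s \<omega>) - exp_mean s (d + w s \<omega>)))"
    unfolding distr using int1 int2 by (rule Bochner_Integration.integrable_diff)
  have i1: "integrable M (\<lambda>\<omega>. indicator A \<omega> * exp (\<sigma> * \<bar>c + w T \<omega>\<bar>))"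
    and i2: "integrable M (\<lambda>\<omega>. indicator A \<omega> * exp (\<sigma> * (d + w T \<omega>)))"
    using integrable_real_mult_indicator[OF AM integrable_abs_exp_w[of c]]
      integrable_real_mult_indicator[OF AM integrable_exp_w[of d]] by (simp_all add: mult.commute)
  have "(\<integral>\<omega>. indicator A \<omega> * (abs_mean s (c + w s \<omega>) - exp_mean s (d + w s \<omega>)) \<partial>M)
    = (\<integral>\<omega>. indicator A \<omega> * abs_mean s (c + w s \<omega>) \<partial>M) - (\<integral>\<omega>. indicator A \<omega> * exp_mean s (d + w s \<omega>) \<partial>M)"
    unfolding distr using int1 int2 by (rule Bochner_Integration.integral_diff)
  also have "\<dots> = (\<integral>\<omega>. indicator A \<omega> * exp (\<sigma> * \<bar>c + w T \<omega>\<bar>) \<partial>M) - (\<integral>\<omega>. indicator A \<omega> * exp (\<sigma> * (d + w T \<omega>)) \<partial>M)"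
    using f1(1) f2(1) unfolding wT by (simp add: add.assoc)
  also have "\<dots> = (\<integral>\<omega>. indicator A \<omega> * (exp (\<sigma> * \<bar>c + w T \<omega>\<bar>) - exp (\<sigma> * (d + w T \<omega>))) \<partial>M)"
    unfolding distr using i1 i2 by (rule Bochner_Integration.integral_diff[symmetric])
  finally show "(\<integral>\<omega>. indicator A \<omega> * (abs_mean s (c + w s \<omega>) - exp_mean s (d + w s \<omega>)) \<partial>M)
      = (\<integral>\<omega>. indicator A \<omega> * (exp (\<sigma> * \<bar>c + w T \<omega>\<bar>) - exp (\<sigma> * (d + w T \<omega>))) \<partial>M)" .
qed

abbreviation grid :: "nat \<Rightarrow> nat \<Rightarrow> real" where
  "grid \<equiv> mesh t T"

lemma grid_bounds: "j \<le> Suc n \<Longrightarrow> grid n j \<in> {t..T}"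
  using t by (intro mesh_bounds) auto

text \<open>With \<open>A j\<close> the event that a stopping index equals \<open>j\<close>, this is
  optional stopping over finitely many times. The events may also cover less than the whole space,
  which later discards paths with a large overshoot.\<close>

lemma
  fixes c d :: real
  assumes A: "\<And>j. j \<le> Suc n \<Longrightarrow> A j \<in> sets (F (grid n j))"
  defines "h \<equiv> \<lambda>j \<omega>. abs_mean (grid n j) (c + w (grid n j) \<omega>) - exp_mean (grid n j) (d + w (grid n j) \<omega>)"
  shows integrable_freeze_sum: "integrable M (\<lambda>\<omega>. \<Sum>j\<le>Suc n. indicator (A j) \<omega> * h j \<omega>)"
    and expectation_freeze_sum: "(\<integral>\<omega>. (\<Sum>j\<le>Suc n. indicator (A j) \<omega> * h j \<omega>) \<partial>M)
      = (\<integral>\<omega>. (\<Sum>j\<le>Suc n. indicator (A j) \<omega>) * (exp (\<sigma> * \<bar>c + w T \<omega>\<bar>) - exp (\<sigma> * (d + w T \<omega>))) \<partial>M)"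
proof -
  have int: "integrable M (\<lambda>\<omega>. indicator (A j) \<omega> * h j \<omega>)" if "j \<in> {..Suc n}" for j
    unfolding h_def using that by (intro integrable_freeze grid_bounds A) auto
  show "integrable M (\<lambda>\<omega>. \<Sum>j\<le>Suc n. indicator (A j) \<omega> * h j \<omega>)"
    using int by (rule Bochner_Integration.integrable_sum)
  have AM: "A j \<in> sets M" if "j \<in> {..Suc n}" for j using A[of j] sets_F_subset that by auto
  have int': "integrable M (\<lambda>\<omega>. indicator (A j) \<omega> * (exp (\<sigma> * \<bar>c + w T \<omega>\<bar>) - exp (\<sigma> * (d + w T \<omega>))))" if "j \<in> {..Suc n}" for j
    using integrable_real_mult_indicator[OF AM[OF that] Bochner_Integration.integrable_diff[OF integrable_abs_exp_w[of c] integrable_exp_w[of d]]]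
    by (simp add: mult.commute)
  have "(\<integral>\<omega>. (\<Sum>j\<le>Suc n. indicator (A j) \<omega> * h j \<omega>) \<partial>M) = (\<Sum>j\<le>Suc n. \<integral>\<omega>. indicator (A j) \<omega> * h j \<omega> \<partial>M)"
    using int by (rule Bochner_Integration.integral_sum)
  also have "\<dots> = (\<Sum>j\<le>Suc n. \<integral>\<omega>. indicator (A j) \<omega> * (exp (\<sigma> * \<bar>c + w T \<omega>\<bar>) - exp (\<sigma> * (d + w T \<omega>))) \<partial>M)"
    unfolding h_def by (intro sum.cong refl expectation_freeze grid_bounds A) auto
  also have "\<dots> = (\<integral>\<omega>. (\<Sum>j\<le>Suc n. indicator (A j) \<omega> * (exp (\<sigma> * \<bar>c + w T \<omega>\<bar>) - exp (\<sigma> * (d + w T \<omega>)))) \<partial>M)"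
    using int' by (rule Bochner_Integration.integral_sum[symmetric])
  finally show "(\<integral>\<omega>. (\<Sum>j\<le>Suc n. indicator (A j) \<omega> * h j \<omega>) \<partial>M)
      = (\<integral>\<omega>. (\<Sum>j\<le>Suc n. indicator (A j) \<omega>) * (exp (\<sigma> * \<bar>c + w T \<omega>\<bar>) - exp (\<sigma> * (d + w T \<omega>))) \<partial>M)"
    unfolding sum_distrib_right .
qed

lemma indicator_Least_sum:
  fixes f :: "nat \<Rightarrow> real"
  assumes "J \<omega> \<le> Suc n" "\<omega> \<in> space M"
  shows "(\<Sum>j\<le>Suc n. indicator {\<omega>\<in>space M. J \<omega> = j} \<omega> * f j) = f (J \<omega>)"
proof -
  have "(\<Sum>j\<le>Suc n. indicator {\<omega>\<in>space M. J \<omega> = j} \<omega> * f j) = (\<Sum>j\<le>Suc n. if J \<omega> = j then f j else 0)"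
    using assms by (intro sum.cong) auto
  also have "\<dots> = f (J \<omega>)" using assms by simp
  finally show ?thesis .
qed

section \<open>The filtration of the price and its stopping times\<close>

lemma space_generated [simp]: "space (generated_filtration M t T X s) = space M"
  unfolding generated_filtration_def by (rule space_measure_of) auto

lemma sets_generated_subset:
  assumes "s \<in> {t..T}"
  shows "sets (generated_filtration M t T X s) \<subseteq> sets (F s)"
proof -
  have "{X u -` A \<inter> space M | u A. u \<in> {t..T} \<and> u \<le> s \<and> A \<in> sets borel} \<subseteq> sets (F s)"
  proof safe
    fix u and A :: "real set" assume "u \<in> {t..T}" "u \<le> s" "A \<in> sets borel"
    then show "X u -` A \<inter> space M \<in> sets (F s)"
      using measurable_sets[OF measurable_F_mono[OF _ X_measurable_F[of u]], of s A] space_F[of s] by auto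
  qed
  then show ?thesis
    unfolding generated_filtration_def
    using sets.sigma_sets_subset[of _ "F s"] space_F[of s] by (subst sets_measure_of) auto
qed

lemma sets_generated_le:
  assumes "u \<in> {t..T}" "u \<le> s"
  shows "{\<omega>\<in>space M. X u \<omega> \<le> c} \<in> sets (generated_filtration M t T X s)"
proof -
  have "X u -` {..c} \<inter> space M \<in> sets (generated_filtration M t T X s)"
    unfolding generated_filtration_def using assms
    by (subst sets_measure_of) (auto intro!: sigma_sets.Basic exI[of _ u] exI[of _ "{..c}"] assms)
  moreover have "X u -` {..c} \<inter> space M = {\<omega>\<in>space M. X u \<omega> \<le> c}" by auto
  ultimately show ?thesis by simp
qed

text \<open>An event known from the price path is known in \<open>F\<close>, relative to which the
  increments of \<open>W\<close> are independent; this transfers stopping times of the price to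
  \<open>F\<close>.\<close>

lemma admissible_sets:
  assumes "\<tau> \<in> admissible_stopping_times M t T X" "s \<in> {t..T}"
  shows "{\<omega>\<in>space M. \<tau> \<omega> \<le> s} \<in> sets (F s)"
proof -
  have "Measurable.pred (generated_filtration M t T X s) (\<lambda>\<omega>. \<tau> \<omega> \<le> s)"
    using assms(1) by (simp add: admissible_stopping_times_def stopping_time_def)
  then have "{\<omega>\<in>space M. \<tau> \<omega> \<le> s} \<in> sets (generated_filtration M t T X s)"
    by (simp add: pred_def)
  then show ?thesis using sets_generated_subset[OF assms(2)] by blast
qed

lemma AE_norm_payoff_le:
  assumes "\<And>\<omega>. \<omega> \<in> space M \<Longrightarrow> \<rho> \<omega> \<in> {t..T}"
  shows "AE \<omega> in M. norm (payoff (\<rho> \<omega>) \<omega>) \<le> payoff_bound"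
  using AE_payoff_le AE_space by eventually_elim (use assms payoff_nonneg in simp)

lemma integrable_payoff_grid:
  assumes J_le: "\<And>\<omega>. J \<omega> \<le> Suc n"
    and sets: "\<And>j. j \<le> Suc n \<Longrightarrow> {\<omega>\<in>space M. J \<omega> = j} \<in> sets M"
  shows "integrable M (\<lambda>\<omega>. payoff (grid n (J \<omega>)) \<omega>)"
proof (rule integrable_const_bound[OF AE_norm_payoff_le])
  have "(\<lambda>\<omega>. \<Sum>j\<le>Suc n. indicator {\<omega>\<in>space M. J \<omega> = j} \<omega> * payoff (grid n j) \<omega>) \<in> borel_measurable M"
    by (intro borel_measurable_sum borel_measurable_times borel_measurable_indicator sets payoff_measurable grid_bounds) auto
  then show "(\<lambda>\<omega>. payoff (grid n (J \<omega>)) \<omega>) \<in> borel_measurable M"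
    using indicator_Least_sum[of J _ n "\<lambda>j. payoff (grid n j) _", OF J_le] by (subst measurable_cong) auto
qed (rule grid_bounds[OF J_le])

lemma expectation_payoff_le:
  assumes \<tau>: "\<tau> \<in> admissible_stopping_times M t T X"
  shows "(\<integral>\<omega>. payoff (\<tau> \<omega>) \<omega> \<partial>M) \<le> payoff_bound"
proof (rule expectation_le_if_AE_le)
  show "AE \<omega> in M. payoff (\<tau> \<omega>) \<omega> \<le> payoff_bound"
    using AE_payoff_le AE_space
    by eventually_elim (use \<tau> in \<open>auto simp: admissible_stopping_times_def\<close>)
qed (rule payoff_bound_nonneg)

text \<open>A general stopping time is rounded up to the grid, where optional stopping is a finite
  sum; continuity of strike and price and the uniform bound on the payoff bring the inequality back
  to \<open>\<tau>\<close>.\<close>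

lemma expectation_payoff_le_below_boundary:
  assumes \<tau>: "\<tau> \<in> admissible_stopping_times M t T X" and y\<^sub>0: "y\<^sub>0 \<le> 0"
  shows "(\<integral>\<omega>. payoff (\<tau> \<omega>) \<omega> \<partial>M) \<le> K t - x"
proof -
  have tT: "t < T" "0 \<le> t" using t by auto
  have \<tau>_bounds: "\<tau> \<omega> \<in> {t..T}" if "\<omega> \<in> space M" for \<omega>
    using \<tau> that by (simp add: admissible_stopping_times_def)
  \<comment> \<open>Rounding up keeps \<open>J n = j\<close> an event of
    \<open>F (grid n j)\<close>. The alternative \<open>j = Suc n\<close> makes the least index
    exist for every outcome, also outside \<open>space M\<close>.\<close>
  define J where "J n \<omega> = (LEAST j. \<tau> \<omega> \<le> grid n j \<or> j = Suc n)" for n \<omega>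
  have J_le: "J n \<omega> \<le> Suc n" for n \<omega>
    unfolding J_def by (rule Least_le) simp
  have J_sets: "{\<omega>\<in>space M. J n \<omega> = j} \<in> sets (F (grid n j))" if j: "j \<le> Suc n" for n j
  proof -
    have "{\<omega>\<in>space (F (grid n j)). J n \<omega> = j} \<in> sets (F (grid n j))"
      unfolding J_def
    proof (rule sets_Least_eq)
      fix i assume "i \<le> j"
      then have "{\<omega>\<in>space M. \<tau> \<omega> \<le> grid n i} \<in> sets (F (grid n j))"
        using admissible_sets[OF \<tau> grid_bounds[of i n]] sets_F_mono[OF mesh_mono[of t T i j n]] tT j by auto
      then show "{\<omega> \<in> space (F (grid n j)). \<tau> \<omega> \<le> grid n i \<or> i = Suc n} \<in> sets (F (grid n j))"
        unfolding space_F by (cases "i = Suc n") (auto simp: sets.top[of "F (grid n j)", unfolded space_F])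
    qed blast
    then show ?thesis unfolding space_F .
  qed
  have J_close: "\<bar>grid n (J n \<omega>) - \<tau> \<omega>\<bar> \<le> (T - t) / real (Suc n)" if \<omega>: "\<omega> \<in> space M" for n \<omega>
  proof (cases "\<tau> \<omega> = t")
    case True
    then have "J n \<omega> \<le> 0" unfolding J_def by (intro Least_le) simp
    then show ?thesis using True tT by simp
  next
    case False
    then obtain k where k: "k \<le> n" "\<tau> \<omega> \<in> {grid n k<..grid n (Suc k)}"
      using mesh_cover[OF tT(1), of "\<tau> \<omega>" n] \<tau>_bounds[OF \<omega>] by auto
    have "J n \<omega> = Suc k"
      unfolding J_def
    proof (rule Least_equality)
      fix j assume j: "\<tau> \<omega> \<le> grid n j \<or> j = Suc n"
      show "Suc k \<le> j"
      proof (rule ccontr)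
        assume "\<not> Suc k \<le> j"
        then have "grid n j \<le> grid n k" "j \<noteq> Suc n" using k(1) tT by (auto intro: mesh_mono)
        with j k show False by auto
      qed
    qed (use k in auto)
    then show ?thesis using k mesh_diff[of t T n k] by auto
  qed
  define p where "p n \<omega> = payoff (grid n (J n \<omega>)) \<omega>" for n \<omega>
  have p_int: "integrable M (p n)" for n
    unfolding p_def using J_sets sets_F_subset by (intro integrable_payoff_grid J_le) blast
  have p_meas: "p n \<in> borel_measurable M" for n
    using p_int[of n] by simp
  have lim: "(\<lambda>n. p n \<omega>) \<longlonglongrightarrow> payoff (\<tau> \<omega>) \<omega>" if \<omega>: "\<omega> \<in> space M" for \<omega>
  proof -
    have cont: "continuous_on {t..T} (\<lambda>s. payoff s \<omega>)"
      unfolding payoff_def using continuous_on_subset[OF continuous_on_K, of "{t..T}"] tT X_continuous[OF \<omega>]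
      by (intro continuous_intros) auto
    have "(\<lambda>n. grid n (J n \<omega>) - \<tau> \<omega>) \<longlonglongrightarrow> 0"
      by (rule Lim_null_comparison[OF _ LIMSEQ_Suc[OF lim_const_over_n[of "T - t"]]]) (use J_close[OF \<omega>] in auto)
    then have "(\<lambda>n. grid n (J n \<omega>)) \<longlonglongrightarrow> \<tau> \<omega>" by (simp add: LIM_zero_iff)
    then have "(\<lambda>n. payoff (grid n (J n \<omega>)) \<omega>) \<longlonglongrightarrow> payoff (\<tau> \<omega>) \<omega>"
      using grid_bounds[OF J_le] \<tau>_bounds[OF \<omega>]
      by (intro continuous_on_tendsto_compose[OF cont]) auto
    then show ?thesis unfolding p_def .
  qed
  have "(\<lambda>n. \<integral>\<omega>. p n \<omega> \<partial>M) \<longlonglongrightarrow> (\<integral>\<omega>. payoff (\<tau> \<omega>) \<omega> \<partial>M)"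
  proof (rule integral_dominated_convergence[where w="\<lambda>_. payoff_bound"])
    show "(\<lambda>\<omega>. payoff (\<tau> \<omega>) \<omega>) \<in> borel_measurable M"
      by (rule borel_measurable_LIMSEQ_real[OF lim p_meas])
    show "AE \<omega> in M. norm (p n \<omega>) \<le> payoff_bound" for n
      unfolding p_def by (intro AE_norm_payoff_le grid_bounds J_le)
  qed (use p_meas lim in auto)
  moreover have "(\<integral>\<omega>. p n \<omega> \<partial>M) \<le> K t - x" for n
  proof -
    \<comment> \<open>\<open>\<Psi>\<close> runs from 0 although \<open>B\<close> starts at
      \<open>y\<^sub>0\<close>: since \<open>\<Psi> s\<close> is smallest at 0, any argument
      dominates, and starting at 0 makes the value at time \<open>t\<close> equal to the immediate
      gain.\<close>
    define h where "h j \<omega> = abs_mean (grid n j) (0 + w (grid n j) \<omega>) - exp_mean (grid n j) (y\<^sub>0 + w (grid n j) \<omega>)" for j \<omega>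
    have h_int: "integrable M (\<lambda>\<omega>. \<Sum>j\<le>Suc n. indicator {\<omega>\<in>space M. J n \<omega> = j} \<omega> * h j \<omega>)"
      unfolding h_def by (rule integrable_freeze_sum[OF J_sets])
    have "(\<integral>\<omega>. p n \<omega> \<partial>M) \<le> (\<integral>\<omega>. \<kappa> * (\<Sum>j\<le>Suc n. indicator {\<omega>\<in>space M. J n \<omega> = j} \<omega> * h j \<omega>) \<partial>M)"
    proof (rule integral_mono_AE)
      show "integrable M (p n)" by (rule p_int)
      show "AE \<omega> in M. p n \<omega> \<le> \<kappa> * (\<Sum>j\<le>Suc n. indicator {\<omega>\<in>space M. J n \<omega> = j} \<omega> * h j \<omega>)"
        using AE_payoff_eq AE_space
      proof eventually_elim
        case (elim \<omega>)
        define s where "s = grid n (J n \<omega>)"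
        have s: "s \<in> {t..T}" unfolding s_def by (rule grid_bounds[OF J_le])
        have "max 0 (abs_mean s 0 - exp_mean s (y\<^sub>0 + w s \<omega>)) \<le> abs_mean s (w s \<omega>) - exp_mean s (y\<^sub>0 + w s \<omega>)"
        proof (rule max.boundedI)
          have "exp_mean s (y\<^sub>0 + w s \<omega>) \<le> exp_mean s (w s \<omega>)"
            using y\<^sub>0 \<sigma>_pos by (simp add: mult_left_mono)
          also have "\<dots> \<le> abs_mean s (w s \<omega>)"
            using exp_mean_le_abs_exp_mean[OF \<sigma>_pos, of "w s \<omega>" "sqrt (T - s)"] s by simp
          finally show "0 \<le> abs_mean s (w s \<omega>) - exp_mean s (y\<^sub>0 + w s \<omega>)" by simp
        qed (use abs_exp_mean_ge_zero(1)[OF \<sigma>_pos] in simp)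
        then have "payoff s \<omega> \<le> \<kappa> * h (J n \<omega>) \<omega>"
          using elim(1) s \<kappa>_pos unfolding h_def s_def[symmetric] by simp
        then show ?case
          unfolding p_def s_def
          using indicator_Least_sum[of "J n" \<omega> n "\<lambda>j. h j \<omega>", OF J_le elim(2)] by simp
      qed
    qed (use h_int in simp)
    also have "\<dots> = \<kappa> * (\<integral>\<omega>. (\<Sum>j\<le>Suc n. indicator {\<omega>\<in>space M. J n \<omega> = j} \<omega>) *
        (exp (\<sigma> * \<bar>0 + w T \<omega>\<bar>) - exp (\<sigma> * (y\<^sub>0 + w T \<omega>))) \<partial>M)"
      unfolding h_def integral_mult_right_zero by (subst expectation_freeze_sum[OF J_sets]) simp_all
    \<comment> \<open>The events \<open>J n = j\<close> partition the space, so their indicators add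
      up to 1.\<close>
    also have "(\<integral>\<omega>. (\<Sum>j\<le>Suc n. indicator {\<omega>\<in>space M. J n \<omega> = j} \<omega>) *
        (exp (\<sigma> * \<bar>0 + w T \<omega>\<bar>) - exp (\<sigma> * (y\<^sub>0 + w T \<omega>))) \<partial>M)
      = (\<integral>\<omega>. exp (\<sigma> * \<bar>0 + w T \<omega>\<bar>) - exp (\<sigma> * (y\<^sub>0 + w T \<omega>)) \<partial>M)"
      using indicator_Least_sum[of "J n" _ n "\<lambda>_. 1", OF J_le]
      by (intro Bochner_Integration.integral_cong) (simp_all del: sum.atMost_Suc)
    also have "\<dots> = abs_mean t 0 - exp_mean t y\<^sub>0"
      using integrable_abs_exp_w[of 0] integrable_exp_w[of y\<^sub>0] expectation_abs_exp_w[of 0] expectation_exp_w[of y\<^sub>0]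
      by (subst Bochner_Integration.integral_diff) simp_all
    finally show ?thesis by (simp add: K_minus_x_eq)
  qed
  ultimately show ?thesis by (intro LIMSEQ_le_const2) auto
qed

text \<open>Defined through \<open>X\<close> and not through \<open>w\<close>: the two descriptions
  agree only almost surely, and the exceptional null set need not belong to the filtration of the
  price. The alternative \<open>n < j\<close> falls back on the index \<open>Suc n\<close>, that is
  on time \<open>T\<close>.\<close>

definition crossing :: "nat \<Rightarrow> 'a \<Rightarrow> nat" where
  "crossing n \<omega> = (LEAST j. X (grid n j) \<omega> \<le> boundary (grid n j) \<or> n < j)"

lemma crossing_le: "crossing n \<omega> \<le> Suc n"
  unfolding crossing_def by (rule Least_le) simp

lemma admissible_grid_crossing: "(\<lambda>\<omega>. grid n (crossing n \<omega>)) \<in> admissible_stopping_times M t T X"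
proof -
  define J where "J = crossing n"
  have tT: "t < T" using t by auto
  have J_le: "J \<omega> \<le> Suc n" for \<omega> unfolding J_def by (rule crossing_le)
  have J: "X (grid n (J \<omega>)) \<omega> \<le> boundary (grid n (J \<omega>)) \<or> n < J \<omega>" for \<omega>
    unfolding J_def crossing_def by (rule LeastI[of "\<lambda>j. X (grid n j) \<omega> \<le> boundary (grid n j) \<or> n < j" "Suc n"]) simp
  have "Measurable.pred (generated_filtration M t T X s) (\<lambda>\<omega>. grid n (J \<omega>) \<le> s)" for s
  proof (cases "T \<le> s")
    case True
    have "grid n (J \<omega>) \<le> s" for \<omega> using grid_bounds[OF J_le[of \<omega>]] True by auto
    then show ?thesis by simp
  next
    case False
    \<comment> \<open>For \<open>s < T\<close> the fall-back index is excluded because its grid time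
      is \<open>T\<close>, so having stopped by \<open>s\<close> means that some grid time up to
      \<open>s\<close> shows a price at or below the boundary.\<close>
    have eq: "grid n (J \<omega>) \<le> s \<longleftrightarrow> (\<exists>j\<in>{j. j \<le> Suc n \<and> grid n j \<le> s}. X (grid n j) \<omega> \<le> boundary (grid n j))" for \<omega>
    proof
      assume "grid n (J \<omega>) \<le> s"
      moreover from this have "J \<omega> \<noteq> Suc n" using False by auto
      ultimately show "\<exists>j\<in>{j. j \<le> Suc n \<and> grid n j \<le> s}. X (grid n j) \<omega> \<le> boundary (grid n j)"
        using J[of \<omega>] J_le[of \<omega>] by auto
    next
      assume "\<exists>j\<in>{j. j \<le> Suc n \<and> grid n j \<le> s}. X (grid n j) \<omega> \<le> boundary (grid n j)"
      then obtain j where j: "grid n j \<le> s" "X (grid n j) \<omega> \<le> boundary (grid n j)" by auto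
      have "J \<omega> \<le> j" unfolding J_def crossing_def using j by (intro Least_le) simp
      then have "grid n (J \<omega>) \<le> grid n j" using tT by (intro mesh_mono) auto
      with j show "grid n (J \<omega>) \<le> s" by simp
    qed
    have "{\<omega>\<in>space (generated_filtration M t T X s). \<exists>j\<in>{j. j \<le> Suc n \<and> grid n j \<le> s}. X (grid n j) \<omega> \<le> boundary (grid n j)}
      \<in> sets (generated_filtration M t T X s)"
    proof (rule sets.sets_Collect_finite_Ex)
      fix j assume "j \<in> {j. j \<le> Suc n \<and> grid n j \<le> s}"
      then show "{\<omega>\<in>space (generated_filtration M t T X s). X (grid n j) \<omega> \<le> boundary (grid n j)}
        \<in> sets (generated_filtration M t T X s)"
        using sets_generated_le[OF grid_bounds[of j n], of s] by simp
    qed simp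
    then show ?thesis unfolding pred_def eq .
  qed
  then show ?thesis
    unfolding admissible_stopping_times_def stopping_time_def J_def[symmetric]
    using grid_bounds[OF J_le] by simp
qed

text \<open>The claim \<open>exp (\<sigma> * \<bar>y\<bar>) - exp (\<sigma> * y)\<close> in \<open>y = y\<^sub>0 + w T\<close> pays nothing unless
  \<open>y < 0\<close>, and then some grid time lies just after the crossing, with overshoot at most \<open>\<delta>\<close>.\<close>

lemma exists_better_stopping_time:
  assumes y\<^sub>0: "0 < y\<^sub>0"
  shows "\<exists>\<tau>\<in>admissible_stopping_times M t T X. K t - x < (\<integral>\<omega>. payoff (\<tau> \<omega>) \<omega> \<partial>M)"
proof -
  have tT: "t < T" "0 \<le> t" using t by auto
  \<comment> \<open>The advantage of waiting. Half of \<open>g\<close> is spent on passing from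
    \<open>f\<close> to \<open>u n\<close>, a quarter on the overshoot, and the remaining quarter
    keeps the inequality strict.\<close>
  define g where "g = abs_mean t y\<^sub>0 - abs_mean t 0"
  have g: "g > 0"
    using abs_exp_mean_ge_zero(2)[OF \<sigma>_pos, of y\<^sub>0 "sqrt (T - t)"] y\<^sub>0 by (simp add: g_def)
  define E where "E = exp (\<sigma>\<^sup>2 * T / 2)"
  have E: "E > 0" by (simp add: E_def)
  \<comment> \<open>An overshoot of at most \<open>\<delta>\<close> costs at most
    \<open>exp (\<sigma> * \<delta>) - 1\<close> times \<open>\<Psi> s 0 \<le> 2 * E\<close>, which
    is at most \<open>g / 4\<close>.\<close>
  define \<delta> where "\<delta> = ln (1 + g / (8 * E)) / \<sigma>"
  have gE: "g / (8 * E) > 0" using g E by simp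
  have \<delta>: "\<delta> > 0" "exp (\<sigma> * \<delta>) - 1 = g / (8 * E)"
    using gE \<sigma>_pos by (auto simp: \<delta>_def)
  define y where "y s \<omega> = y\<^sub>0 + w s \<omega>" for s \<omega>
  have yF: "y s \<in> borel_measurable (F s)" if "s \<in> {t..T}" for s
    unfolding y_def using w_measurable_F[OF that] by measurable
  have y_t: "y t \<omega> = y\<^sub>0" for \<omega> by (simp add: y_def w_def)
  \<comment> \<open>The counterpart of \<open>crossing\<close> in terms of \<open>w\<close>: its
    events lie in \<open>F\<close>, where optional stopping applies, and the two indices agree
    almost surely.\<close>
  define J where "J n \<omega> = (LEAST j. y (grid n j) \<omega> \<le> 0 \<or> n < j)" for n \<omega>
  define \<tau> where "\<tau> n \<omega> = grid n (crossing n \<omega>)" for n \<omega>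
  define f where "f \<omega> = exp (\<sigma> * \<bar>y\<^sub>0 + w T \<omega>\<bar>) - exp (\<sigma> * (y\<^sub>0 + w T \<omega>))" for \<omega>
  \<comment> \<open>Only outcomes with a small overshoot are kept; on the others the payoff is
    bounded below by 0.\<close>
  define A where "A n j = {\<omega>\<in>space M. J n \<omega> = j} \<inter> {\<omega>\<in>space M. y (grid n j) \<omega> \<in> {- \<delta>..0}}" for n j
  define h where "h n j \<omega> = abs_mean (grid n j) (y\<^sub>0 + w (grid n j) \<omega>) - exp_mean (grid n j) (y\<^sub>0 + w (grid n j) \<omega>)" for n j \<omega>
  have J_le: "J n \<omega> \<le> Suc n" for n \<omega>
    unfolding J_def by (rule Least_le) simp
  have A_sets: "A n j \<in> sets (F (grid n j))" if j: "j \<le> Suc n" for n j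
  proof -
    have yFj: "y (grid n i) \<in> borel_measurable (F (grid n j))" if "i \<le> j" for i
      using yF[OF grid_bounds[of i n]] mesh_mono[of t T i j n] tT j that
      by (intro measurable_F_mono[of "grid n i" "grid n j"]) auto
    have "{\<omega>\<in>space (F (grid n j)). J n \<omega> = j} \<in> sets (F (grid n j))"
      unfolding J_def
    proof (rule sets_Least_eq)
      fix i assume "i \<le> j"
      from yFj[OF this] show "{\<omega> \<in> space (F (grid n j)). y (grid n i) \<omega> \<le> 0 \<or> n < i} \<in> sets (F (grid n j))"
        by measurable
    qed blast
    moreover have "{\<omega>\<in>space (F (grid n j)). y (grid n j) \<omega> \<in> {- \<delta>..0}} \<in> sets (F (grid n j))"
      using yFj[OF order_refl] by measurable
    ultimately show ?thesis unfolding A_def space_F by (rule sets.Int)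
  qed
  have A_sum: "(\<Sum>j\<le>Suc n. indicator (A n j) \<omega> * v j) = indicator {- \<delta>..0} (y (grid n (J n \<omega>)) \<omega>) * v (J n \<omega>)"
    if "\<omega> \<in> space M" for n \<omega> and v :: "nat \<Rightarrow> real"
  proof -
    have "(\<Sum>j\<le>Suc n. indicator (A n j) \<omega> * v j)
      = (\<Sum>j\<le>Suc n. indicator {\<omega>\<in>space M. J n \<omega> = j} \<omega> * (indicator {- \<delta>..0} (y (grid n j) \<omega>) * v j))"
      using that by (intro sum.cong refl) (auto simp: A_def indicator_def)
    also have "\<dots> = indicator {- \<delta>..0} (y (grid n (J n \<omega>)) \<omega>) * v (J n \<omega>)"
      by (rule indicator_Least_sum[of "J n", OF J_le that])
    finally show ?thesis .
  qed
  have \<tau>_eq: "AE \<omega> in M. \<forall>n. \<tau> n \<omega> = grid n (J n \<omega>)"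
    using AE_X_eq
  proof eventually_elim
    case (elim \<omega>)
    have "X (grid n j) \<omega> \<le> boundary (grid n j) \<or> n < j \<longleftrightarrow> y (grid n j) \<omega> \<le> 0 \<or> n < j" for n j
      using elim grid_bounds[of j n] boundary_pos[of "grid n j"] \<sigma>_pos
      by (cases "n < j") (simp_all add: y_def mult_le_0_iff)
    then have "crossing n \<omega> = J n \<omega>" for n
      unfolding J_def crossing_def by (intro arg_cong[of _ _ Least] ext)
    then show ?case by (simp add: \<tau>_def)
  qed
  have \<tau>_adm: "\<tau> n \<in> admissible_stopping_times M t T X" for n
    using admissible_grid_crossing[of n] unfolding \<tau>_def .
  have f_int: "integrable M f"
    unfolding f_def by (intro Bochner_Integration.integrable_diff integrable_abs_exp_w integrable_exp_w)
  have Ef: "(\<integral>\<omega>. f \<omega> \<partial>M) = abs_mean t y\<^sub>0 - exp_mean t y\<^sub>0"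
    unfolding f_def using integrable_abs_exp_w integrable_exp_w
    by (subst Bochner_Integration.integral_diff) (simp_all add: expectation_abs_exp_w expectation_exp_w)
  have f_nonneg: "0 \<le> f \<omega>" for \<omega>
    unfolding f_def using \<sigma>_pos by (simp add: mult_left_mono)
  define u where "u n \<omega> = (\<Sum>j\<le>Suc n. indicator (A n j) \<omega>) * f \<omega>" for n \<omega>
  have A_M: "A n j \<in> sets M" if "j \<le> Suc n" for n j
    using A_sets[OF that] sets_F_subset by blast
  have u_meas: "u n \<in> borel_measurable M" for n
    unfolding u_def using f_int A_M
    by (intro borel_measurable_times borel_measurable_sum borel_measurable_indicator) auto
  have u_eq: "u n \<omega> = indicator {- \<delta>..0} (y (grid n (J n \<omega>)) \<omega>) * f \<omega>" if "\<omega> \<in> space M" for n \<omega>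
    unfolding u_def using A_sum[OF that, of n "\<lambda>_. 1"] by simp
  have u_lim: "(\<lambda>n. u n \<omega>) \<longlonglongrightarrow> f \<omega>" if \<omega>: "\<omega> \<in> space M" for \<omega>
  proof (cases "y T \<omega> < 0")
    case False
    then have "f \<omega> = 0" by (simp add: f_def y_def)
    then show ?thesis by (simp add: u_eq[OF \<omega>])
  next
    case True
    have "uniformly_continuous_on {t..T} (\<lambda>s. w s \<omega>)"
      using w_continuous[OF \<omega>] by (intro compact_uniformly_continuous) auto
    then obtain d where d: "d > 0" "\<And>a b. a \<in> {t..T} \<Longrightarrow> b \<in> {t..T} \<Longrightarrow> \<bar>a - b\<bar> < d \<Longrightarrow> \<bar>w a \<omega> - w b \<omega>\<bar> < \<delta>"
      using \<delta>(1) unfolding uniformly_continuous_on_def dist_real_def by metis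
    have "\<forall>\<^sub>F n in sequentially. u n \<omega> = f \<omega>"
      using eventually_mesh_less[OF d(1), of T t]
    proof eventually_elim
      case (elim n)
      define k where "k = J n \<omega>"
      have k: "y (grid n k) \<omega> \<le> 0 \<or> n < k"
        unfolding k_def J_def by (rule LeastI[of "\<lambda>j. y (grid n j) \<omega> \<le> 0 \<or> n < j" "Suc n"]) simp
      \<comment> \<open>If the index is the fall-back \<open>Suc n\<close>, the grid time is
        \<open>T\<close>, where \<open>y\<close> is negative by the case assumption.\<close>
      have yk: "y (grid n k) \<omega> \<le> 0"
        using k True J_le[of n \<omega>] by (cases "k = Suc n") (auto simp: k_def)
      have "k \<noteq> 0"
        using yk y_t[of \<omega>] y\<^sub>0 by (auto intro!: gr0I)
      then obtain i where i: "k = Suc i" by (cases k) auto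
      have iN: "i \<le> n" using J_le[of n \<omega>] i by (simp add: k_def)
      have "i < (LEAST j. y (grid n j) \<omega> \<le> 0 \<or> n < j)"
        using i unfolding k_def J_def by simp
      from not_less_Least[OF this] have yi: "y (grid n i) \<omega> > 0" by simp
      have "\<bar>w (grid n (Suc i)) \<omega> - w (grid n i) \<omega>\<bar> < \<delta>"
        using mesh_diff[of t T n i] elim iN tT by (intro d(2) grid_bounds) auto
      then have "y (grid n k) \<omega> \<in> {- \<delta>..0}"
        using yi yk unfolding i y_def by auto
      then show ?case unfolding u_eq[OF \<omega>] k_def by simp
    qed
    then show ?thesis by (rule tendsto_eventually)
  qed
  have "(\<lambda>n. \<integral>\<omega>. u n \<omega> \<partial>M) \<longlonglongrightarrow> (\<integral>\<omega>. f \<omega> \<partial>M)"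
  proof (rule integral_dominated_convergence[where w=f])
    show "AE \<omega> in M. norm (u n \<omega>) \<le> f \<omega>" for n
      using f_nonneg by (intro AE_I2) (simp add: u_eq indicator_def)
  qed (use u_meas u_lim f_int in auto)
  from order_tendstoD(1)[OF this, of "abs_mean t y\<^sub>0 - exp_mean t y\<^sub>0 - g / 2"] g
  have "\<forall>\<^sub>F n in sequentially. abs_mean t y\<^sub>0 - exp_mean t y\<^sub>0 - g / 2 < (\<integral>\<omega>. u n \<omega> \<partial>M)"
    unfolding Ef by simp
  then obtain n where n: "abs_mean t y\<^sub>0 - exp_mean t y\<^sub>0 - g / 2 < (\<integral>\<omega>. u n \<omega> \<partial>M)"
    by (auto simp: eventually_sequentially)
  have h_int: "integrable M (\<lambda>\<omega>. \<Sum>j\<le>Suc n. indicator (A n j) \<omega> * h n j \<omega>)"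
    unfolding h_def by (rule integrable_freeze_sum[OF A_sets])
  have h_exp: "(\<integral>\<omega>. (\<Sum>j\<le>Suc n. indicator (A n j) \<omega> * h n j \<omega>) \<partial>M) = (\<integral>\<omega>. u n \<omega> \<partial>M)"
    unfolding h_def u_def f_def by (rule expectation_freeze_sum[OF A_sets])
  have bound: "AE \<omega> in M. \<kappa> * (\<Sum>j\<le>Suc n. indicator (A n j) \<omega> * h n j \<omega>) - \<kappa> * (g / 4) \<le> payoff (\<tau> n \<omega>) \<omega>"
    using AE_payoff_eq \<tau>_eq AE_space
  proof eventually_elim
    case (elim \<omega>)
    define s where "s = grid n (J n \<omega>)"
    have s: "s \<in> {t..T}" unfolding s_def by (rule grid_bounds[OF J_le])
    have "(\<Sum>j\<le>Suc n. indicator (A n j) \<omega> * h n j \<omega>) - g / 4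
      \<le> max 0 (abs_mean s 0 - exp_mean s (y s \<omega>))"
    proof (cases "y s \<omega> \<in> {- \<delta>..0}")
      case True
      have "\<bar>y s \<omega>\<bar> \<le> \<delta>" using True by auto
      then have "exp (\<sigma> * \<bar>y s \<omega>\<bar>) \<le> exp (\<sigma> * \<delta>)" using \<sigma>_pos by (simp add: mult_left_mono)
      then have e: "exp (\<sigma> * \<bar>y s \<omega>\<bar>) \<le> 1 + g / (8 * E)" using \<delta>(2) by linarith
      have m: "0 \<le> abs_mean s 0" "abs_mean s 0 \<le> 2 * E"
        using abs_mean_zero_le[of s] s tT by (auto simp: E_def abs_exp_mean_def)
      have "abs_mean s (y s \<omega>) \<le> exp (\<sigma> * \<bar>y s \<omega>\<bar>) * abs_mean s 0"
        by (rule abs_exp_mean_le[OF \<sigma>_pos])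
      also have "\<dots> \<le> (1 + g / (8 * E)) * abs_mean s 0"
        using e m by (intro mult_right_mono)
      also have "\<dots> \<le> abs_mean s 0 + g / (8 * E) * (2 * E)"
        unfolding distrib_right mult_1_left by (intro add_left_mono mult_left_mono[OF m(2)] less_imp_le[OF gE])
      also have "g / (8 * E) * (2 * E) = g / 4" using E by simp
      finally have "h n (J n \<omega>) \<omega> - g / 4 \<le> abs_mean s 0 - exp_mean s (y s \<omega>)"
        unfolding h_def s_def[symmetric] y_def by simp
      then show ?thesis
        unfolding A_sum[OF elim(3)] using True by (simp add: s_def[symmetric])
    next
      case False
      then show ?thesis
        unfolding A_sum[OF elim(3)] using g by (simp add: s_def[symmetric])
    qed
    from mult_left_mono[OF this less_imp_le[OF \<kappa>_pos]]
    have "\<kappa> * (\<Sum>j\<le>Suc n. indicator (A n j) \<omega> * h n j \<omega>) - \<kappa> * (g / 4) \<le> \<kappa> * max 0 (abs_mean s 0 - exp_mean s (y s \<omega>))"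
      by (simp only: right_diff_distrib[of \<kappa> _ "g / 4"])
    also have "\<dots> = payoff s \<omega>" using elim(1) s by (simp add: y_def)
    also have "\<dots> = payoff (\<tau> n \<omega>) \<omega>" using elim(2) by (simp add: s_def)
    finally show ?case .
  qed
  have payoff_int: "integrable M (\<lambda>\<omega>. payoff (\<tau> n \<omega>) \<omega>)"
    unfolding \<tau>_def
  proof (rule integrable_payoff_grid[OF crossing_le])
    fix j assume j: "j \<le> Suc n"
    show "{\<omega>\<in>space M. crossing n \<omega> = j} \<in> sets M"
      unfolding crossing_def
    proof (rule sets_Least_eq)
      fix i assume "i \<le> j"
      then have [measurable]: "X (grid n i) \<in> borel_measurable M" using j by (intro X_measurable grid_bounds) simp
      show "{\<omega> \<in> space M. X (grid n i) \<omega> \<le> boundary (grid n i) \<or> n < i} \<in> sets M" by measurable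
    qed blast
  qed
  have "K t - x = \<kappa> * (abs_mean t y\<^sub>0 - exp_mean t y\<^sub>0 - g)"
    by (simp add: K_minus_x_eq g_def)
  also have "\<dots> < \<kappa> * ((\<integral>\<omega>. u n \<omega> \<partial>M) - g / 4)"
    using n g \<kappa>_pos by (intro mult_strict_left_mono) auto
  also have "\<dots> = (\<integral>\<omega>. \<kappa> * (\<Sum>j\<le>Suc n. indicator (A n j) \<omega> * h n j \<omega>) - \<kappa> * (g / 4) \<partial>M)"
    using h_int unfolding h_exp[symmetric]
    by (subst Bochner_Integration.integral_diff) (simp_all add: prob_space right_diff_distrib del: sum.atMost_Suc)
  also have "\<dots> \<le> (\<integral>\<omega>. payoff (\<tau> n \<omega>) \<omega> \<partial>M)"
    using h_int payoff_int bound by (intro integral_mono_AE) (auto simp del: sum.atMost_Suc)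
  finally show ?thesis using \<tau>_adm[of n] by blast
qed

section \<open>The value against the immediate gain\<close>

lemma const_admissible: "(\<lambda>_. t) \<in> admissible_stopping_times M t T X"
  using t by (simp add: admissible_stopping_times_def stopping_time_const)

text \<open>At or below the boundary the strike is at least the price, because
  \<open>M t y\<^sub>0 \<le> M t 0 \<le> \<Psi> t 0\<close>; the positive part is then inactive at
  time \<open>t\<close>.\<close>

lemma expectation_immediate_payoff:
  assumes "y\<^sub>0 \<le> 0"
  shows "(\<integral>\<omega>. payoff t \<omega> \<partial>M) = K t - x"
proof -
  have "exp_mean t y\<^sub>0 \<le> exp_mean t 0"
    using assms \<sigma>_pos by (simp add: mult_nonneg_nonpos)
  also have "\<dots> \<le> abs_mean t 0"
    using exp_mean_le_abs_exp_mean[OF \<sigma>_pos, of 0 "sqrt (T - t)"] t by simp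
  finally have pos: "0 \<le> abs_mean t 0 - exp_mean t y\<^sub>0" by simp
  have "AE \<omega> in M. payoff t \<omega> = K t - x"
    using AE_payoff_eq
  proof eventually_elim
    case (elim \<omega>)
    have "payoff t \<omega> = \<kappa> * max 0 (abs_mean t 0 - exp_mean t (y\<^sub>0 + w t \<omega>))" using elim t by simp
    also have "\<dots> = K t - x" using pos by (simp add: w_def K_minus_x_eq)
    finally show ?case .
  qed
  then have "(\<integral>\<omega>. payoff t \<omega> \<partial>M) = (\<integral>\<omega>. K t - x \<partial>M)"
    using t by (intro integral_cong_AE) auto
  then show ?thesis by (simp add: prob_space)
qed

text \<open>The expected payoffs share an upper bound, so the real supremum dominates each of them;
  above the boundary a single strictly better stopping time therefore excludes equality.\<close>

lemma value_eq_intrinsic_iff: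
  "(SUP \<tau> \<in> admissible_stopping_times M t T X. \<integral>\<omega>. payoff (\<tau> \<omega>) \<omega> \<partial>M) = K t - x \<longleftrightarrow> x \<le> boundary t"
proof -
  let ?V = "SUP \<tau> \<in> admissible_stopping_times M t T X. \<integral>\<omega>. payoff (\<tau> \<omega>) \<omega> \<partial>M"
  have upper: "(\<integral>\<omega>. payoff (\<tau> \<omega>) \<omega> \<partial>M) \<le> ?V" if "\<tau> \<in> admissible_stopping_times M t T X" for \<tau>
    by (rule cSUP_upper[OF that]) (use expectation_payoff_le in \<open>auto simp: bdd_above_def\<close>)
  have iff: "x \<le> boundary t \<longleftrightarrow> y\<^sub>0 \<le> 0"
    using boundary_pos[of t] \<sigma>_pos by (subst x_eq) (simp add: mult_le_0_iff)
  show ?thesis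
  proof (cases "y\<^sub>0 \<le> 0")
    case True
    have "?V \<le> K t - x"
      using const_admissible expectation_payoff_le_below_boundary True by (intro cSUP_least) auto
    moreover have "K t - x \<le> ?V"
      using upper[OF const_admissible] expectation_immediate_payoff[OF True] by simp
    ultimately show ?thesis using True iff by simp
  next
    case False
    then obtain \<tau> where "\<tau> \<in> admissible_stopping_times M t T X" "K t - x < (\<integral>\<omega>. payoff (\<tau> \<omega>) \<omega> \<partial>M)"
      using exists_better_stopping_time by auto
    with upper[of \<tau>] have "K t - x < ?V" by simp
    then show ?thesis using False iff by simp
  qed
qed

end

theorem mainTheorem4:
  fixes T r \<sigma> K\<^sub>T \<gamma> :: real
    and M :: "'a measure" and F :: "real \<Rightarrow> 'a measure"
    and W :: "real \<Rightarrow> 'a \<Rightarrow> real"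
    and X :: "real \<Rightarrow> real \<Rightarrow> real \<Rightarrow> 'a \<Rightarrow> real"
    and K :: "real \<Rightarrow> real" and V :: "real \<Rightarrow> real \<Rightarrow> real"
  assumes "T > 0" and "r > 0" and "\<sigma> > 0" and "K\<^sub>T > 0"
    and "\<gamma> = r - \<sigma>\<^sup>2 / 2"
    and "filtered_prob_space M F"
    and "standard_brownian_motion M F W"
    and "\<And>t x. t \<in> {0..<T} \<Longrightarrow> x > 0 \<Longrightarrow>
           sde_solution M F W (\<lambda>y. r * y) (\<lambda>y. \<sigma> * y) t T x (X t x)"
    and "\<And>t. t \<in> {0..T} \<Longrightarrow>
           K t = 2 * K\<^sub>T * exp (- \<gamma> * (T - t)) * cdf std_normal_distribution (\<sigma> * sqrt (T - t))"
    and "\<And>t x. t \<in> {0..<T} \<Longrightarrow> x > 0 \<Longrightarrow> V t x = american_put_value M X r T K t x"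
  shows "is_optimal_exercise_boundary T K V (\<lambda>t. K\<^sub>T * exp (- \<gamma> * (T - t)))"
proof -
  have "V t x = K t - x \<longleftrightarrow> x \<le> K\<^sub>T * exp (- \<gamma> * (T - t))" if tx: "t \<in> {0..<T}" "x > 0" for t x
  proof -
    \<comment> \<open>Each starting point \<open>(t, x)\<close> has a price process of its own, so
      the locale is interpreted anew for each.\<close>
    interpret gbm_put M F W T r \<sigma> K\<^sub>T t x "X t x" K
      using assms(2-4,6,7) assms(8)[OF tx] assms(9)[unfolded assms(5)] tx
      by unfold_locales auto
    show ?thesis
      using value_eq_intrinsic_iff assms(10)[OF tx]
      unfolding american_put_value_def payoff_def boundary_def assms(5) by simp
  qed
  then show ?thesis
    using assms(4) unfolding is_optimal_exercise_boundary_def exercise_region_def by auto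
qed

end
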